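(* Let $p$ be a prime, let $\mathcal F$ be a saturated fusion system over a finite $p$-group $S$, and let $A(\mathcal F)$ be the Burnside ring of $\mathcal F$, i.e. the subring of the Burnside ring $A(S)$ consisting of the $\mathcal F$-stable elements. Let $Cl(\mathcal F)$ be the set of $\mathcal F$-conjugacy classes of subgroups of $S$. Then there are a ring homomorphism $\Phi$ and a group homomorphism $\Psi$ fitting into a short exact sequence of abelian groups \[0\to A(\mathcal F)\xrightarrow{\Phi}\prod_{[P]_{\mathcal F}\in Cl(\mathcal F)}\mathbb Z\xrightarrow{\Psi}\prod_{[P]_{\mathcal F}\in Cl(\mathcal F)}\mathbb Z/|W_SP|\mathbb Z\to 0,\] where in the last product $P$ is a fully $\mathcal F$-normalized representative of $[P]_{\mathcal F}$, and $W_SP:=N_S(P)/P$. The map $\Phi$ is the restriction of the mark homomorphism of $A(S)$, i.e. its $[P]_{\mathcal F}$-coordinate is $X\mapsto\Phi_P(X)$, and $\Psi$ is given by the $[P]_{\mathcal F}$-coordinate functions \[\Psi_P(f):=\sum_{\bar s\in W_SP}f_{\langle s\rangle P}\pmod{|W_SP|},\] when $P$ is a fully normalized representative of the class $[P]_{\mathcal F}$. Moreover $\Psi_P=\Psi_{P'}$ if $P\sim_{\mathcal F}P'$ are both fully normalized.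
   Context: Fusion systems. A fusion system $\mathcal F$ over a finite $p$-group $S$ is a category whose objects are the subgroups of $S$ and whose morphism sets $\mathcal F(P,Q)$ satisfy: (1) every morphism is an injective group homomorphism $P\to Q$, and composition is composition of homomorphisms; (2) every homomorphism $P\to Q$ of the form $c_s\colon x\mapsto sxs^{-1}$ with $s\in S$, $sPs^{-1}\leq Q$, is in $\mathcal F(P,Q)$; (3) for every $\varphi\in\mathcal F(P,Q)$ the isomorphism $\varphi\colon P\to\varphi(P)$ and its inverse $\varphi^{-1}\colon\varphi(P)\to P$ are morphisms of $\mathcal F$. Write $\operatorname{Aut}_{\mathcal F}(P)=\mathcal F(P,P)$, and let $\operatorname{Aut}_S(P)$ be the group of automorphisms of $P$ induced by conjugation by elements of $N_S(P)$. Subgroups $P,Q\leq S$ are $\mathcal F$-conjugate, $P\sim_{\mathcal F}Q$, if there is an isomorphism $P\to Q$ in $\mathcal F$; $[P]_{\mathcal F}$ denotes the $\mathcal F$-conjugacy class of $P$. $P$ is fully ($\mathcal F$-)normalized (resp. fully centralized) if $|N_S(P)|\geq|N_S(Q)|$ (resp. $|C_S(P)|\geq|C_S(Q)|$) for all $Q\in[P]_{\mathcal F}$. $\mathcal F$ is saturated if for all $P\leq S$: (i) if $P$ is fully normalized then $P$ is fully centralized and $\operatorname{Aut}_S(P)$ is a Sylow $p$-subgroup of $\operatorname{Aut}_{\mathcal F}(P)$; (ii) every $\varphi\in\mathcal F(P,S)$ with $\varphi(P)$ fully centralized extends to a morphism in $\mathcal F(N_\varphi,S)$, where $N_\varphi=\{x\in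 N_S(P)\mid\exists y\in S\colon\varphi\circ c_x=c_y\circ\varphi\}$. Burnside rings. $A_+(S)$ is the semiring of isomorphism classes of finite $S$-sets under disjoint union and cartesian product, and $A(S)$ is its Grothendieck ring (the Burnside ring). For $P\leq S$, $\Phi_P\colon A(S)\to\mathbb Z$ is the ring homomorphism extending $X\mapsto|X^P|$; the mark homomorphism of $A(S)$ is $(\Phi_P)_{[P]}$, the product over $S$-conjugacy classes of subgroups. For $\varphi\in\mathcal F(P,S)$, restriction of actions along $\varphi$ (on an $S$-set $X$: the $P$-action $p.x:=\varphi(p)x$) extends linearly to a ring homomorphism $A(S)\to A(P)$, written $X\mapsto{}_{P,\varphi}X$. An element $X\in A(S)$ is $\mathcal F$-stable if ${}_{P,\varphi}X={}_{P,\mathrm{incl}}X$ in $A(P)$ for all $P\leq S$ and $\varphi\in\mathcal F(P,S)$; equivalently, $\Phi_P(X)=\Phi_Q(X)$ whenever $P\sim_{\mathcal F}Q$. Notation. For $f\in\prod_{Cl(\mathcal F)}\mathbb Z$ and $Q\leq S$, $f_Q$ denotes the coordinate of $f$ at $[Q]_{\mathcal F}$. For $\bar s\in W_SP$ the class of $s\in N_S(P)$, $\langle s\rangle P$ is the subgroup generated by $s$ and $P$. *)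

theory Defs
  imports "HOL-Algebra.Algebra"
begin

section \<open>Fusion systems\<close>

definition centralizer :: "('a, 'm) monoid_scheme \<Rightarrow> 'a set \<Rightarrow> 'a set" where
  "centralizer G H = {g \<in> carrier G. \<forall>h\<in>H. g \<otimes>\<^bsub>G\<^esub> h = h \<otimes>\<^bsub>G\<^esub> g}"

definition conj_map :: "('a, 'm) monoid_scheme \<Rightarrow> 'a set \<Rightarrow> 'a \<Rightarrow> 'a \<Rightarrow> 'a" where
  "conj_map G P s = (\<lambda>x\<in>P. s \<otimes>\<^bsub>G\<^esub> x \<otimes>\<^bsub>G\<^esub> inv\<^bsub>G\<^esub> s)"

definition sylow_subgroup :: "nat \<Rightarrow> ('a, 'm) monoid_scheme \<Rightarrow> 'a set \<Rightarrow> bool" where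
  "sylow_subgroup p G H \<longleftrightarrow> subgroup H G \<and> card H = p ^ multiplicity p (order G)"

text \<open>
  A morphism \<open>P \<rightarrow> Q\<close> is represented by a function that is \<open>undefined\<close> outside \<open>P\<close>, so that
  equality of functions is equality of morphisms. The values \<open>F P Q\<close> are meaningful only
  when \<open>P\<close> and \<open>Q\<close> are subgroups of \<open>S\<close>. Identities are the morphisms \<open>conj_map S P \<one>\<close>.
\<close>

locale fusion_system = group S
  for p :: nat
    and S :: "('a, 'm) monoid_scheme" (structure)
    and F :: "'a set \<Rightarrow> 'a set \<Rightarrow> ('a \<Rightarrow> 'a) set" +
  assumes prime_p: "Factorial_Ring.prime p"
    and finite_carrier: "finite (carrier S)"
    and p_group: "\<exists>n. order S = p ^ n"
    and morphism: "\<lbrakk>subgroup P S; subgroup Q S; \<phi> \<in> F P Q\<rbrakk> \<Longrightarrow>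
      \<phi> \<in> hom (S\<lparr>carrier := P\<rparr>) (S\<lparr>carrier := Q\<rparr>) \<and> inj_on \<phi> P \<and> \<phi> \<in> extensional P"
    and comp: "\<lbrakk>subgroup P S; subgroup Q S; subgroup R S; \<phi> \<in> F P Q; \<psi> \<in> F Q R\<rbrakk> \<Longrightarrow>
      compose P \<psi> \<phi> \<in> F P R"
    and conj: "\<lbrakk>subgroup P S; subgroup Q S; s \<in> carrier S; conj_map S P s ` P \<subseteq> Q\<rbrakk> \<Longrightarrow>
      conj_map S P s \<in> F P Q"
    and onto_image: "\<lbrakk>subgroup P S; subgroup Q S; \<phi> \<in> F P Q\<rbrakk> \<Longrightarrow> \<phi> \<in> F P (\<phi> ` P)"
    and inverse: "\<lbrakk>subgroup P S; subgroup Q S; \<phi> \<in> F P Q\<rbrakk> \<Longrightarrow>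
      restrict (inv_into P \<phi>) (\<phi> ` P) \<in> F (\<phi> ` P) P"

definition fusion_conj_class ::
  "('a, 'm) monoid_scheme \<Rightarrow> ('a set \<Rightarrow> 'a set \<Rightarrow> ('a \<Rightarrow> 'a) set) \<Rightarrow> 'a set \<Rightarrow> 'a set set" where
  "fusion_conj_class S F P = {Q. subgroup Q S \<and>
     (\<exists>\<phi>\<in>F P Q. \<exists>\<psi>\<in>F Q P. compose P \<psi> \<phi> = (\<lambda>x\<in>P. x) \<and> compose Q \<phi> \<psi> = (\<lambda>x\<in>Q. x))}"

definition fusion_classes ::
  "('a, 'm) monoid_scheme \<Rightarrow> ('a set \<Rightarrow> 'a set \<Rightarrow> ('a \<Rightarrow> 'a) set) \<Rightarrow> 'a set set set" where
  "fusion_classes S F = {fusion_conj_class S F P | P. subgroup P S}"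

definition fully_normalized ::
  "('a, 'm) monoid_scheme \<Rightarrow> ('a set \<Rightarrow> 'a set \<Rightarrow> ('a \<Rightarrow> 'a) set) \<Rightarrow> 'a set \<Rightarrow> bool" where
  "fully_normalized S F P \<longleftrightarrow> subgroup P S \<and>
     (\<forall>Q\<in>fusion_conj_class S F P. card (normalizer S Q) \<le> card (normalizer S P))"

definition fully_centralized ::
  "('a, 'm) monoid_scheme \<Rightarrow> ('a set \<Rightarrow> 'a set \<Rightarrow> ('a \<Rightarrow> 'a) set) \<Rightarrow> 'a set \<Rightarrow> bool" where
  "fully_centralized S F P \<longleftrightarrow> subgroup P S \<and>
     (\<forall>Q\<in>fusion_conj_class S F P. card (centralizer S Q) \<le> card (centralizer S P))"

definition Aut_S :: "('a, 'm) monoid_scheme \<Rightarrow> 'a set \<Rightarrow> ('a \<Rightarrow> 'a) set" where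
  "Aut_S S P = conj_map S P ` normalizer S P"

definition Aut_F :: "('a set \<Rightarrow> 'a set \<Rightarrow> ('a \<Rightarrow> 'a) set) \<Rightarrow> 'a set \<Rightarrow> ('a \<Rightarrow> 'a) monoid" where
  "Aut_F F P = (BijGroup P)\<lparr>carrier := F P P\<rparr>"

definition extender :: "('a, 'm) monoid_scheme \<Rightarrow> 'a set \<Rightarrow> ('a \<Rightarrow> 'a) \<Rightarrow> 'a set" where
  "extender S P \<phi> = {x \<in> normalizer S P. \<exists>y\<in>carrier S.
     compose P \<phi> (conj_map S P x) = compose P (conj_map S (\<phi> ` P) y) \<phi>}"

locale saturated_fusion_system = fusion_system +
  assumes fully_normalized_sylow: "\<lbrakk>subgroup P S; fully_normalized S F P\<rbrakk> \<Longrightarrow>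
      fully_centralized S F P \<and> sylow_subgroup p (Aut_F F P) (Aut_S S P)"
    and extension: "\<lbrakk>subgroup P S; \<phi> \<in> F P (carrier S); fully_centralized S F (\<phi> ` P)\<rbrakk> \<Longrightarrow>
      \<exists>\<psi>\<in>F (extender S P \<phi>) (carrier S). \<forall>x\<in>P. \<psi> x = \<phi> x"


section \<open>The Grothendieck ring of a commutative semiring\<close>

text \<open>The class of \<open>(a, b)\<close> stands for the formal difference \<open>a - b\<close>.\<close>

definition groth_rel :: "('r, 'm) ring_scheme \<Rightarrow> (('r \<times> 'r) \<times> ('r \<times> 'r)) set" where
  "groth_rel R = {((a, b), (c, d)).
     a \<in> carrier R \<and> b \<in> carrier R \<and> c \<in> carrier R \<and> d \<in> carrier R \<and>
     (\<exists>k\<in>carrier R. (a \<oplus>\<^bsub>R\<^esub> d) \<oplus>\<^bsub>R\<^esub> k = (c \<oplus>\<^bsub>R\<^esub> b) \<oplus>\<^bsub>R\<^esub> k)}"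

definition groth_class :: "('r, 'm) ring_scheme \<Rightarrow> 'r \<Rightarrow> 'r \<Rightarrow> ('r \<times> 'r) set" where
  "groth_class R a b = groth_rel R `` {(a, b)}"

definition groth_ring :: "('r, 'm) ring_scheme \<Rightarrow> ('r \<times> 'r) set ring" where
  "groth_ring R =
    \<lparr>carrier = (carrier R \<times> carrier R) // groth_rel R,
     monoid.mult = (\<lambda>C D. \<Union>(a, b)\<in>C. \<Union>(c, d)\<in>D.
       groth_class R (a \<otimes>\<^bsub>R\<^esub> c \<oplus>\<^bsub>R\<^esub> b \<otimes>\<^bsub>R\<^esub> d) (a \<otimes>\<^bsub>R\<^esub> d \<oplus>\<^bsub>R\<^esub> b \<otimes>\<^bsub>R\<^esub> c)),
     monoid.one = groth_class R \<one>\<^bsub>R\<^esub> \<zero>\<^bsub>R\<^esub>,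
     ring.zero = groth_class R \<zero>\<^bsub>R\<^esub> \<zero>\<^bsub>R\<^esub>,
     ring.add = (\<lambda>C D. \<Union>(a, b)\<in>C. \<Union>(c, d)\<in>D. groth_class R (a \<oplus>\<^bsub>R\<^esub> c) (b \<oplus>\<^bsub>R\<^esub> d))\<rparr>"

text \<open>
  The linear extension to the Grothendieck ring of an additive map \<open>h\<close> into a ring \<open>T\<close>;
  the image is a singleton because \<open>h a - h b\<close> depends only on the class of \<open>(a, b)\<close>.
\<close>

definition groth_extend :: "('t, 'n) ring_scheme \<Rightarrow> ('r \<Rightarrow> 't) \<Rightarrow> ('r \<times> 'r) set \<Rightarrow> 't" where
  "groth_extend T h C = the_elem ((\<lambda>(a, b). h a \<ominus>\<^bsub>T\<^esub> h b) ` C)"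


section \<open>Burnside rings\<close>

definition gset :: "('a, 'm) monoid_scheme \<Rightarrow> 'x set \<Rightarrow> ('a \<Rightarrow> 'x \<Rightarrow> 'x) \<Rightarrow> bool" where
  "gset G E \<alpha> \<longleftrightarrow> finite E \<and> group_action G E \<alpha>"

definition gset_iso :: "('a, 'm) monoid_scheme \<Rightarrow> 'x set \<Rightarrow> ('a \<Rightarrow> 'x \<Rightarrow> 'x) \<Rightarrow>
    'y set \<Rightarrow> ('a \<Rightarrow> 'y \<Rightarrow> 'y) \<Rightarrow> bool" where
  "gset_iso G E \<alpha> D \<beta> \<longleftrightarrow>
     (\<exists>h. bij_betw h E D \<and> (\<forall>g\<in>carrier G. \<forall>x\<in>E. h (\<alpha> g x) = \<beta> g (h x)))"

text \<open>
  Every finite set is in bijection with a set of natural numbers, so an isomorphism class of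
  finite \<open>G\<close>-sets (over any type) is represented by the set of its members with underlying
  set in \<^typ>\<open>nat\<close>.
\<close>

type_synonym 'a gset_class = "(nat set \<times> ('a \<Rightarrow> nat \<Rightarrow> nat)) set"

definition gset_class ::
  "('a, 'm) monoid_scheme \<Rightarrow> 'x set \<Rightarrow> ('a \<Rightarrow> 'x \<Rightarrow> 'x) \<Rightarrow> 'a gset_class" where
  "gset_class G E \<alpha> = {(D, \<beta>). gset G D \<beta> \<and> gset_iso G E \<alpha> D \<beta>}"

definition burnside_semiring :: "('a, 'm) monoid_scheme \<Rightarrow> 'a gset_class ring" where
  "burnside_semiring G =
    \<lparr>carrier = {gset_class G E \<alpha> | (E :: nat set) \<alpha>. gset G E \<alpha>},
     monoid.mult = (\<lambda>c d. \<Union>(E, \<alpha>)\<in>c. \<Union>(D, \<beta>)\<in>d.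
       gset_class G (E \<times> D) (\<lambda>g. map_prod (\<alpha> g) (\<beta> g))),
     monoid.one = gset_class G {()} (\<lambda>g x. x),
     ring.zero = gset_class G ({} :: nat set) (\<lambda>g x. x),
     ring.add = (\<lambda>c d. \<Union>(E, \<alpha>)\<in>c. \<Union>(D, \<beta>)\<in>d.
       gset_class G (Sum_Type.Plus E D) (\<lambda>g. map_sum (\<alpha> g) (\<beta> g)))\<rparr>"

definition burnside_ring ::
  "('a, 'm) monoid_scheme \<Rightarrow> ('a gset_class \<times> 'a gset_class) set ring" where
  "burnside_ring G = groth_ring (burnside_semiring G)"

definition fixed_points :: "'a set \<Rightarrow> 'x set \<Rightarrow> ('a \<Rightarrow> 'x \<Rightarrow> 'x) \<Rightarrow> 'x set" where
  "fixed_points P E \<alpha> = {x \<in> E. \<forall>g\<in>P. \<alpha> g x = x}"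

definition mark :: "'a set \<Rightarrow> ('a gset_class \<times> 'a gset_class) set \<Rightarrow> int" where
  "mark P = groth_extend \<Z> (\<lambda>c. the_elem ((\<lambda>(E, \<alpha>). int (card (fixed_points P E \<alpha>))) ` c))"

definition restrict_gset_class ::
  "('a, 'm) monoid_scheme \<Rightarrow> 'a set \<Rightarrow> ('a \<Rightarrow> 'a) \<Rightarrow> 'a gset_class \<Rightarrow> 'a gset_class" where
  "restrict_gset_class S P \<phi> c = (\<Union>(E, \<alpha>)\<in>c. gset_class (S\<lparr>carrier := P\<rparr>) E (\<lambda>g. \<alpha> (\<phi> g)))"

definition burnside_restrict :: "('a, 'm) monoid_scheme \<Rightarrow> 'a set \<Rightarrow> ('a \<Rightarrow> 'a) \<Rightarrow>
    ('a gset_class \<times> 'a gset_class) set \<Rightarrow> ('a gset_class \<times> 'a gset_class) set" where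
  "burnside_restrict S P \<phi> =
     groth_extend (burnside_ring (S\<lparr>carrier := P\<rparr>))
       (\<lambda>c. groth_class (burnside_semiring (S\<lparr>carrier := P\<rparr>))
              (restrict_gset_class S P \<phi> c) \<zero>\<^bsub>burnside_semiring (S\<lparr>carrier := P\<rparr>)\<^esub>)"

definition fusion_stable :: "('a, 'm) monoid_scheme \<Rightarrow> ('a set \<Rightarrow> 'a set \<Rightarrow> ('a \<Rightarrow> 'a) set) \<Rightarrow>
    ('a gset_class \<times> 'a gset_class) set \<Rightarrow> bool" where
  "fusion_stable S F x \<longleftrightarrow>
     (\<forall>P. subgroup P S \<longrightarrow> (\<forall>\<phi>\<in>F P (carrier S).
        burnside_restrict S P \<phi> x = burnside_restrict S P (\<lambda>g\<in>P. g) x))"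

definition fusion_burnside_ring ::
  "('a, 'm) monoid_scheme \<Rightarrow> ('a set \<Rightarrow> 'a set \<Rightarrow> ('a \<Rightarrow> 'a) set) \<Rightarrow>
    ('a gset_class \<times> 'a gset_class) set ring" where
  "fusion_burnside_ring S F =
     (burnside_ring S)\<lparr>carrier := {x \<in> carrier (burnside_ring S). fusion_stable S F x}\<rparr>"


section \<open>The exact sequence\<close>

definition product_ring :: "'i set \<Rightarrow> ('i \<Rightarrow> ('r, 'm) ring_scheme) \<Rightarrow> ('i \<Rightarrow> 'r) ring" where
  "product_ring I R =
    \<lparr>carrier = (\<Pi>\<^sub>E i\<in>I. carrier (R i)),
     monoid.mult = (\<lambda>x y. \<lambda>i\<in>I. x i \<otimes>\<^bsub>R i\<^esub> y i),
     monoid.one = (\<lambda>i\<in>I. \<one>\<^bsub>R i\<^esub>),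
     ring.zero = (\<lambda>i\<in>I. \<zero>\<^bsub>R i\<^esub>),
     ring.add = (\<lambda>x y. \<lambda>i\<in>I. x i \<oplus>\<^bsub>R i\<^esub> y i)\<rparr>"

text \<open>
  The library's \<^const>\<open>short_exact_sequence\<close> forces all groups to have the same element type.
\<close>

definition short_exact :: "('a, 'k) monoid_scheme \<Rightarrow> ('b, 'l) monoid_scheme \<Rightarrow>
    ('c, 'm) monoid_scheme \<Rightarrow> ('a \<Rightarrow> 'b) \<Rightarrow> ('b \<Rightarrow> 'c) \<Rightarrow> bool" where
  "short_exact A B C f g \<longleftrightarrow>
     comm_group A \<and> comm_group B \<and> comm_group C \<and>
     f \<in> mon A B \<and> g \<in> epi B C \<and> f ` carrier A = kernel B C g"

definition ghost_ring :: "('a, 'm) monoid_scheme \<Rightarrow> ('a set \<Rightarrow> 'a set \<Rightarrow> ('a \<Rightarrow> 'a) set) \<Rightarrow>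
    ('a set set \<Rightarrow> int) ring" where
  "ghost_ring S F = product_ring (fusion_classes S F) (\<lambda>_. \<Z>)"

definition weyl_group :: "('a, 'm) monoid_scheme \<Rightarrow> 'a set \<Rightarrow> 'a set monoid" where
  "weyl_group S P = (S\<lparr>carrier := normalizer S P\<rparr>) Mod P"

definition obstruction_group :: "('a, 'm) monoid_scheme \<Rightarrow> ('a set \<Rightarrow> 'a set \<Rightarrow> ('a \<Rightarrow> 'a) set) \<Rightarrow>
    ('a set set \<Rightarrow> 'a set) \<Rightarrow> ('a set set \<Rightarrow> int) monoid" where
  "obstruction_group S F rep =
     product_group (fusion_classes S F) (\<lambda>c. integer_mod_group (order (weyl_group S (rep c))))"

text \<open>
  The summand belonging to a coset \<open>c\<close> of \<open>P\<close> is the value of \<open>f\<close> at the class of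
  \<open>\<langle>s\<rangle>P\<close>, which is the same for all \<open>s \<in> c\<close>. The result lies in
  \<open>{0..<|W\<^sub>SP|}\<close>, the carrier of \<open>integer_mod_group |W\<^sub>SP|\<close>.
\<close>

definition psi :: "('a, 'm) monoid_scheme \<Rightarrow> ('a set \<Rightarrow> 'a set \<Rightarrow> ('a \<Rightarrow> 'a) set) \<Rightarrow>
    'a set \<Rightarrow> ('a set set \<Rightarrow> int) \<Rightarrow> int" where
  "psi S F P f =
     (\<Sum>c\<in>carrier (weyl_group S P).
        the_elem ((\<lambda>s. f (fusion_conj_class S F (generate S (insert s P)))) ` c))
     mod int (order (weyl_group S P))"

end

theory Submission
  imports Defs
begin

text \<open>
  Two finite \<open>G\<close>-sets with equal marks are isomorphic, so the Burnside ring embeds into a product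
  of copies of \<open>\<int>\<close>, and all of its ring axioms can be read off there. The Cauchy-Frobenius
  lemma for the action of \<open>W(P)\<close> on \<open>P\<close>-fixed points gives \<open>\<Psi> \<circ> \<Phi> = 0\<close>.
  The map \<open>\<Psi>\<close> is onto because it is unitriangular with respect to the orders of the subgroups.

  Conversely, a class function \<open>f\<close> in the kernel of \<open>\<Psi>\<close> is realized by some \<open>x \<in> A(S)\<close>, constructed
  from the large subgroups downwards; at a subgroup \<open>Q\<close> this requires
  \<open>f\<^sub>Q \<equiv> \<Phi>\<^sub>Q(x) (mod |W(Q)|)\<close>. Let \<open>P\<close> be a fully normalized conjugate of \<open>Q\<close>. Saturation yields a
  morphism \<open>\<phi> : N(Q) \<rightarrow> N(P)\<close> with \<open>\<phi>(Q) = P\<close>. Comparing the congruence for \<open>x\<close> at \<open>P\<close> with that for \<open>f\<close>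
  gives \<open>f\<^sub>P \<equiv> \<Phi>\<^sub>P(x)\<close>, and comparing the congruences for \<open>x\<close> and its pullback along \<open>\<phi>\<close> at \<open>Q\<close> gives
  \<open>\<Phi>\<^sub>P(x) \<equiv> \<Phi>\<^sub>Q(x)\<close>. Marks also determine elements of \<open>A(R)\<close>
  for every subgroup \<open>R\<close>, so \<open>x\<close> is \<open>F\<close>-stable.
\<close>

section \<open>Grothendieck rings embedded in products of the integers\<close>

text \<open>The obstacle is that \<open>f\<close> satisfies its congruence only at fully normalized
  subgroups, whereas correcting a mark at \<open>Q\<close> needs a congruence modulo |W(Q)| for
  every \<open>Q\<close>. The element under construction agrees with \<open>f\<close> only on
  subgroups of larger order, so it need not be stable and its marks at \<open>P\<close> and
  \<open>Q\<close> may differ; hence the two separate comparisons. They need \<phi> on all of N(Q):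
  its injectivity makes |N(Q)| divide |N(P)|, so the congruence at \<open>P\<close> survives modulo
  |N(Q)|, and the pullback of \<open>x\<close> along \<phi> lies in A(N(Q)), where the
  Cauchy-Frobenius congruence is available. Congruences modulo |W(P)| are carried multiplied by |P|,
  as divisibility by |N(P)| of a sum over N(P). A term with s outside P involves a strictly larger
  subgroup and cancels when two functions that agree there are compared; the |P| terms with s in P
  leave |P| times the difference at P. The same cancellation makes \<Psi> unitriangular.\<close>

lemma UN_pairs_const:
  assumes "p \<in> C" "q \<in> D"
    and "\<And>a b c d. \<lbrakk>(a, b) \<in> C; (c, d) \<in> D\<rbrakk> \<Longrightarrow> f a b c d = Z"
  shows "(\<Union>(a, b)\<in>C. \<Union>(c, d)\<in>D. f a b c d) = Z"
proof -
  have "(\<Union>(a, b)\<in>C. \<Union>(c, d)\<in>D. f a b c d) = (\<Union>x\<in>C. \<Union>y\<in>D. Z)"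
    using assms(3) by (intro SUP_cong refl) auto
  then show ?thesis
    using assms(1,2) by auto
qed

text \<open>With marks for \<open>v\<close>, these are the ghost coordinates of an element of the
  Burnside ring, hence the name.\<close>

definition ghost :: "('i \<Rightarrow> 'r \<Rightarrow> int) \<Rightarrow> 'i \<Rightarrow> ('r \<times> 'r) set \<Rightarrow> int" where
  "ghost v i = groth_extend \<Z> (v i)"

lemma int_minus: "x \<ominus>\<^bsub>\<Z>\<^esub> y = x - y"
  by (simp add: a_minus_def int_a_inv_eq)

text \<open>No associativity, commutativity or distributivity is assumed for \<open>R\<close>. The
  maps \<open>v i\<close> respect the operations and separate points, so every such law is inherited
  from the integers. In particular addition is cancellative, and a formal difference is determined
  by the integers \<open>v i a - v i b\<close>.\<close>

locale ghost_semiring =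
  fixes R :: "('r, 'm) ring_scheme" (structure)
    and I :: "'i set"
    and v :: "'i \<Rightarrow> 'r \<Rightarrow> int"
  assumes add_closed: "\<lbrakk>a \<in> carrier R; b \<in> carrier R\<rbrakk> \<Longrightarrow> a \<oplus> b \<in> carrier R"
    and mult_closed: "\<lbrakk>a \<in> carrier R; b \<in> carrier R\<rbrakk> \<Longrightarrow> a \<otimes> b \<in> carrier R"
    and zero_closed: "\<zero> \<in> carrier R"
    and one_closed: "\<one> \<in> carrier R"
    and v_add: "\<lbrakk>i \<in> I; a \<in> carrier R; b \<in> carrier R\<rbrakk> \<Longrightarrow> v i (a \<oplus> b) = v i a + v i b"
    and v_mult: "\<lbrakk>i \<in> I; a \<in> carrier R; b \<in> carrier R\<rbrakk> \<Longrightarrow> v i (a \<otimes> b) = v i a * v i b"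
    and v_zero: "i \<in> I \<Longrightarrow> v i \<zero> = 0"
    and v_one: "i \<in> I \<Longrightarrow> v i \<one> = 1"
    and v_inj: "\<lbrakk>a \<in> carrier R; b \<in> carrier R; \<And>i. i \<in> I \<Longrightarrow> v i a = v i b\<rbrakk> \<Longrightarrow> a = b"
begin

lemmas closed = add_closed mult_closed zero_closed one_closed

lemmas v_simps = v_add v_mult v_zero v_one

lemma groth_rel_iff:
  "((a, b), (c, d)) \<in> groth_rel R \<longleftrightarrow>
     a \<in> carrier R \<and> b \<in> carrier R \<and> c \<in> carrier R \<and> d \<in> carrier R \<and>
     (\<forall>i\<in>I. v i a - v i b = v i c - v i d)"
  (is "?L \<longleftrightarrow> ?R")
proof
  assume ?L
  then obtain k where mem: "a \<in> carrier R" "b \<in> carrier R" "c \<in> carrier R" "d \<in> carrier R"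
    "k \<in> carrier R" and eq: "(a \<oplus> d) \<oplus> k = (c \<oplus> b) \<oplus> k"
    by (auto simp: groth_rel_def)
  have "v i a + v i d + v i k = v i c + v i b + v i k" if "i \<in> I" for i
    using arg_cong[OF eq, of "v i"] mem that by (simp add: v_simps closed)
  then show ?R
    using mem by force
next
  assume R: ?R
  \<comment> \<open>Separation of points gives equality before anything is added, so
    \<open>\<zero>\<close> serves as the element \<open>k\<close> of the Grothendieck
    relation.\<close>
  have "a \<oplus> d = c \<oplus> b"
    using R by (intro v_inj) (auto simp: closed v_simps algebra_simps)
  then show ?L
    using R zero_closed by (auto simp: groth_rel_def)
qed

lemma groth_class_mem_iff:
  "(c, d) \<in> groth_class R a b \<longleftrightarrow>
     a \<in> carrier R \<and> b \<in> carrier R \<and> c \<in> carrier R \<and> d \<in> carrier R \<and>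
     (\<forall>i\<in>I. v i c - v i d = v i a - v i b)"
  by (auto simp: groth_class_def groth_rel_iff)

lemma groth_class_eqI:
  assumes "a \<in> carrier R" "b \<in> carrier R" "c \<in> carrier R" "d \<in> carrier R"
    and "\<And>i. i \<in> I \<Longrightarrow> v i a - v i b = v i c - v i d"
  shows "groth_class R a b = groth_class R c d"
  using assms by (auto simp: groth_class_mem_iff)

lemma groth_class_self: "\<lbrakk>a \<in> carrier R; b \<in> carrier R\<rbrakk> \<Longrightarrow> (a, b) \<in> groth_class R a b"
  by (simp add: groth_class_mem_iff)

lemma groth_carrierI:
  "\<lbrakk>a \<in> carrier R; b \<in> carrier R\<rbrakk> \<Longrightarrow> groth_class R a b \<in> carrier (groth_ring R)"
  by (auto simp: groth_ring_def groth_class_def quotient_def)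

lemma groth_carrierE:
  assumes "C \<in> carrier (groth_ring R)"
  obtains a b where "a \<in> carrier R" "b \<in> carrier R" "C = groth_class R a b"
  using assms by (auto simp: groth_ring_def groth_class_def quotient_def)

lemma groth_add:
  assumes "a \<in> carrier R" "b \<in> carrier R" "c \<in> carrier R" "d \<in> carrier R"
  shows "groth_class R a b \<oplus>\<^bsub>groth_ring R\<^esub> groth_class R c d = groth_class R (a \<oplus> c) (b \<oplus> d)"
proof -
  have "groth_class R (a' \<oplus> c') (b' \<oplus> d') = groth_class R (a \<oplus> c) (b \<oplus> d)"
    if "(a', b') \<in> groth_class R a b" "(c', d') \<in> groth_class R c d" for a' b' c' d'
  proof (rule groth_class_eqI)
    fix i assume "i \<in> I"
    have mem: "a \<in> carrier R" "b \<in> carrier R" "c \<in> carrier R" "d \<in> carrier R"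
      "a' \<in> carrier R" "b' \<in> carrier R" "c' \<in> carrier R" "d' \<in> carrier R"
      using that unfolding groth_class_mem_iff by auto
    have "v i a' - v i b' = v i a - v i b" "v i c' - v i d' = v i c - v i d"
      using that \<open>i \<in> I\<close> unfolding groth_class_mem_iff by auto
    then show "v i (a' \<oplus> c') - v i (b' \<oplus> d') = v i (a \<oplus> c) - v i (b \<oplus> d)"
      using mem \<open>i \<in> I\<close> by (simp add: v_simps)
  qed (use that in \<open>auto simp: groth_class_mem_iff closed\<close>)
  \<comment> \<open>The sum of classes is defined as a union over all pairs of representatives; it
    collapses to one class because all members of the union are equal and both index sets are
    nonempty.\<close>
  then show ?thesis
    unfolding groth_ring_def ring.simps monoid.simps
    by (rule UN_pairs_const[OF groth_class_self[OF assms(1,2)] groth_class_self[OF assms(3,4)]])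
qed

lemma groth_mult:
  assumes "a \<in> carrier R" "b \<in> carrier R" "c \<in> carrier R" "d \<in> carrier R"
  shows "groth_class R a b \<otimes>\<^bsub>groth_ring R\<^esub> groth_class R c d =
    groth_class R (a \<otimes> c \<oplus> b \<otimes> d) (a \<otimes> d \<oplus> b \<otimes> c)"
proof -
  have "groth_class R (a' \<otimes> c' \<oplus> b' \<otimes> d') (a' \<otimes> d' \<oplus> b' \<otimes> c') =
      groth_class R (a \<otimes> c \<oplus> b \<otimes> d) (a \<otimes> d \<oplus> b \<otimes> c)"
    if A: "(a', b') \<in> groth_class R a b" and B: "(c', d') \<in> groth_class R c d" for a' b' c' d'
  proof (rule groth_class_eqI)
    fix i assume i: "i \<in> I"
    have mem: "a \<in> carrier R" "b \<in> carrier R" "c \<in> carrier R" "d \<in> carrier R"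
      "a' \<in> carrier R" "b' \<in> carrier R" "c' \<in> carrier R" "d' \<in> carrier R"
      using A B unfolding groth_class_mem_iff by auto
    have "(v i a' - v i b') * (v i c' - v i d') = (v i a - v i b) * (v i c - v i d)"
      using A B i unfolding groth_class_mem_iff by auto
    then show "v i (a' \<otimes> c' \<oplus> b' \<otimes> d') - v i (a' \<otimes> d' \<oplus> b' \<otimes> c') =
        v i (a \<otimes> c \<oplus> b \<otimes> d) - v i (a \<otimes> d \<oplus> b \<otimes> c)"
      using mem i by (simp add: closed v_simps algebra_simps)
  qed (use A B in \<open>auto simp: groth_class_mem_iff closed\<close>)
  then show ?thesis
    unfolding groth_ring_def ring.simps monoid.simps
    by (rule UN_pairs_const[OF groth_class_self[OF assms(1,2)] groth_class_self[OF assms(3,4)]])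
qed

lemma ghost_class:
  assumes "i \<in> I" "a \<in> carrier R" "b \<in> carrier R"
  shows "ghost v i (groth_class R a b) = v i a - v i b"
proof -
  have "(\<lambda>(a, b). v i a \<ominus>\<^bsub>\<Z>\<^esub> v i b) ` groth_class R a b = {v i a - v i b}"
    unfolding int_minus using assms groth_class_self[OF assms(2,3)]
    by (auto simp: groth_class_mem_iff image_iff)
  then show ?thesis
    by (simp add: ghost_def groth_extend_def)
qed

lemma ghost_inj:
  assumes "C \<in> carrier (groth_ring R)" "D \<in> carrier (groth_ring R)"
    and "\<And>i. i \<in> I \<Longrightarrow> ghost v i C = ghost v i D"
  shows "C = D"
proof -
  obtain a b where C: "a \<in> carrier R" "b \<in> carrier R" "C = groth_class R a b"
    using assms(1) by (rule groth_carrierE)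
  obtain c d where D: "c \<in> carrier R" "d \<in> carrier R" "D = groth_class R c d"
    using assms(2) by (rule groth_carrierE)
  have "v i a - v i b = v i c - v i d" if "i \<in> I" for i
    using assms(3)[OF that] unfolding C(3) D(3) ghost_class[OF that C(1,2)] ghost_class[OF that D(1,2)] .
  then show ?thesis
    unfolding C(3) D(3) by (intro groth_class_eqI C D)
qed

lemma groth_closed:
  assumes "C \<in> carrier (groth_ring R)" "D \<in> carrier (groth_ring R)"
  shows "C \<oplus>\<^bsub>groth_ring R\<^esub> D \<in> carrier (groth_ring R)"
    "C \<otimes>\<^bsub>groth_ring R\<^esub> D \<in> carrier (groth_ring R)"
  using assms by (auto elim!: groth_carrierE simp: groth_add groth_mult closed intro!: groth_carrierI)

lemma groth_zero: "\<zero>\<^bsub>groth_ring R\<^esub> = groth_class R \<zero> \<zero>"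
  and groth_one: "\<one>\<^bsub>groth_ring R\<^esub> = groth_class R \<one> \<zero>"
  by (simp_all add: groth_ring_def)

lemma groth_zero_one_closed:
  "\<zero>\<^bsub>groth_ring R\<^esub> \<in> carrier (groth_ring R)" "\<one>\<^bsub>groth_ring R\<^esub> \<in> carrier (groth_ring R)"
  by (simp_all add: groth_zero groth_one groth_carrierI closed)

lemma ghost_simps:
  assumes "i \<in> I"
  shows "\<lbrakk>C \<in> carrier (groth_ring R); D \<in> carrier (groth_ring R)\<rbrakk> \<Longrightarrow>
      ghost v i (C \<oplus>\<^bsub>groth_ring R\<^esub> D) = ghost v i C + ghost v i D"
    and "\<lbrakk>C \<in> carrier (groth_ring R); D \<in> carrier (groth_ring R)\<rbrakk> \<Longrightarrow>
      ghost v i (C \<otimes>\<^bsub>groth_ring R\<^esub> D) = ghost v i C * ghost v i D"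
    and "ghost v i \<zero>\<^bsub>groth_ring R\<^esub> = 0"
    and "ghost v i \<one>\<^bsub>groth_ring R\<^esub> = 1"
  using assms
  by (auto elim!: groth_carrierE
      simp: groth_add groth_mult groth_zero groth_one ghost_class closed v_simps algebra_simps)

text \<open>Both sides of each axiom have the same coordinates, and coordinates separate the
  elements.\<close>

lemma cring_groth_ring: "cring (groth_ring R)"
proof (rule cringI)
  show "abelian_group (groth_ring R)"
  proof (rule abelian_groupI)
    fix C assume "C \<in> carrier (groth_ring R)"
    then obtain a b where C: "a \<in> carrier R" "b \<in> carrier R" "C = groth_class R a b"
      by (rule groth_carrierE)
    \<comment> \<open>Swapping the two entries of a formal difference negates it.\<close>
    have "groth_class R b a \<oplus>\<^bsub>groth_ring R\<^esub> C = \<zero>\<^bsub>groth_ring R\<^esub>"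
      using C by (simp add: groth_add groth_zero)
        (rule groth_class_eqI, simp_all add: closed v_simps)
    then show "\<exists>D\<in>carrier (groth_ring R). D \<oplus>\<^bsub>groth_ring R\<^esub> C = \<zero>\<^bsub>groth_ring R\<^esub>"
      using C groth_carrierI by blast
  qed ((rule ghost_inj)?; simp add: ghost_simps groth_closed groth_zero_one_closed)+
  show "comm_monoid (groth_ring R)"
    by (rule comm_monoidI; (rule ghost_inj)?; simp add: ghost_simps groth_closed groth_zero_one_closed)
qed (rule ghost_inj; simp add: ghost_simps groth_closed groth_zero_one_closed algebra_simps)

lemma ghost_a_inv:
  assumes "i \<in> I" "C \<in> carrier (groth_ring R)"
  shows "ghost v i (\<ominus>\<^bsub>groth_ring R\<^esub> C) = - ghost v i C"
proof -
  interpret cring "groth_ring R" by (rule cring_groth_ring)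
  have "ghost v i (\<ominus>\<^bsub>groth_ring R\<^esub> C \<oplus>\<^bsub>groth_ring R\<^esub> C) = 0"
    using assms by (simp add: l_neg ghost_simps)
  then show ?thesis
    using assms by (simp add: ghost_simps)
qed

lemma ghost_minus:
  assumes "i \<in> I" "C \<in> carrier (groth_ring R)" "D \<in> carrier (groth_ring R)"
  shows "ghost v i (C \<ominus>\<^bsub>groth_ring R\<^esub> D) = ghost v i C - ghost v i D"
proof -
  interpret cring "groth_ring R" by (rule cring_groth_ring)
  show ?thesis
    using assms by (simp add: a_minus_def ghost_simps ghost_a_inv)
qed

end

text \<open>The map \<open>h\<close> is controlled through coordinates alone: coordinate
  \<open>j\<close> of \<open>h c\<close> is coordinate \<open>k j\<close> of \<open>c\<close>. Since
  coordinates in the target separate points, this already makes the extension to formal differences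
  well defined. For restriction of actions, \<open>k\<close> sends a subgroup to its image.\<close>

lemma groth_extend_ghost:
  fixes R :: "('r, 'm) ring_scheme" and T :: "('t, 'n) ring_scheme"
  assumes R: "ghost_semiring R I v" and T: "ghost_semiring T J w"
    and h: "\<And>c. c \<in> carrier R \<Longrightarrow> h c \<in> carrier T"
    and k: "\<And>j. j \<in> J \<Longrightarrow> k j \<in> I"
    and wh: "\<And>j c. \<lbrakk>j \<in> J; c \<in> carrier R\<rbrakk> \<Longrightarrow> w j (h c) = v (k j) c"
    and C: "C \<in> carrier (groth_ring R)"
  defines "e \<equiv> groth_extend (groth_ring T) (\<lambda>c. groth_class T (h c) \<zero>\<^bsub>T\<^esub>)"
  shows "e C \<in> carrier (groth_ring T)"
    and "j \<in> J \<Longrightarrow> ghost w j (e C) = ghost v (k j) C"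
proof -
  interpret R: ghost_semiring R I v by (rule R)
  interpret T: ghost_semiring T J w by (rule T)
  interpret T: cring "groth_ring T" by (rule T.cring_groth_ring)
  obtain a b where ab: "a \<in> carrier R" "b \<in> carrier R" "C = groth_class R a b"
    using C by (rule R.groth_carrierE)
  define d where "d a b = groth_class T (h a) \<zero>\<^bsub>T\<^esub> \<ominus>\<^bsub>groth_ring T\<^esub> groth_class T (h b) \<zero>\<^bsub>T\<^esub>" for a b
  have d_closed: "d a b \<in> carrier (groth_ring T)" if "a \<in> carrier R" "b \<in> carrier R" for a b
    using that h unfolding d_def
    by (intro T.minus_closed T.groth_carrierI ghost_semiring.zero_closed[OF T]) auto
  have d_ghost: "ghost w j (d a b) = v (k j) a - v (k j) b"
    if "a \<in> carrier R" "b \<in> carrier R" "j \<in> J" for a b j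
    using that h wh unfolding d_def
    by (simp add: T.ghost_minus T.groth_carrierI T.ghost_class T.v_simps
        ghost_semiring.zero_closed[OF T])
  \<comment> \<open>The coordinates of \<open>d a b\<close> depend only on the coordinates of the
    class of \<open>(a, b)\<close>, so the image defining \<open>groth_extend\<close> is a
    singleton.\<close>
  have "d a' b' = d a b" if "(a', b') \<in> C" for a' b'
    using that ab k unfolding ab(3) R.groth_class_mem_iff
    by (intro T.ghost_inj d_closed) (auto simp: d_ghost)
  then have "(\<lambda>(a, b). d a b) ` C = (\<lambda>_. d a b) ` C"
    by (intro image_cong refl) (clarify, assumption)
  also have "\<dots> = {d a b}"
    using R.groth_class_self[OF ab(1,2)] ab(3) by auto
  finally have "(\<lambda>(a, b). d a b) ` C = {d a b}" .
  then have e: "e C = d a b"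
    by (simp add: e_def groth_extend_def d_def)
  show "e C \<in> carrier (groth_ring T)"
    unfolding e by (rule d_closed[OF ab(1,2)])
  show "ghost w j (e C) = ghost v (k j) C" if "j \<in> J"
    unfolding e d_ghost[OF ab(1,2) that] unfolding ab(3) R.ghost_class[OF k[OF that] ab(1,2)] ..
qed

section \<open>Finite group actions and their classes\<close>

text \<open>The notion \<open>gset\<close> asks for maps that are extensional on the underlying set.
  Sums and products formed with \<open>map_sum\<close> and \<open>map_prod\<close>, or translation
  of cosets, need not have that form; here only the values on \<open>E\<close> matter.\<close>

definition finite_action ::
  "('a, 'm) monoid_scheme \<Rightarrow> 'x set \<Rightarrow> ('a \<Rightarrow> 'x \<Rightarrow> 'x) \<Rightarrow> bool" where
  "finite_action G E \<alpha> \<longleftrightarrow> finite E \<and>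
     (\<forall>g\<in>carrier G. \<forall>x\<in>E. \<alpha> g x \<in> E) \<and> (\<forall>x\<in>E. \<alpha> \<one>\<^bsub>G\<^esub> x = x) \<and>
     (\<forall>g\<in>carrier G. \<forall>h\<in>carrier G. \<forall>x\<in>E. \<alpha> (g \<otimes>\<^bsub>G\<^esub> h) x = \<alpha> g (\<alpha> h x))"

lemma finite_actionD:
  assumes "finite_action G E \<alpha>"
  shows "finite E" "\<And>g x. \<lbrakk>g \<in> carrier G; x \<in> E\<rbrakk> \<Longrightarrow> \<alpha> g x \<in> E"
    "\<And>x. x \<in> E \<Longrightarrow> \<alpha> \<one>\<^bsub>G\<^esub> x = x"
    "\<And>g h x. \<lbrakk>g \<in> carrier G; h \<in> carrier G; x \<in> E\<rbrakk> \<Longrightarrow> \<alpha> (g \<otimes>\<^bsub>G\<^esub> h) x = \<alpha> g (\<alpha> h x)"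
  using assms by (auto simp: finite_action_def)

lemma gset_finite_action: "gset G E \<alpha> \<Longrightarrow> finite_action G E \<alpha>"
proof -
  assume "gset G E \<alpha>"
  then have fin: "finite E" and act: "group_action G E \<alpha>"
    by (auto simp: gset_def)
  interpret group_action G E \<alpha> by (rule act)
  have "\<alpha> \<one>\<^bsub>G\<^esub> x = x" if "x \<in> E" for x
    using that by (simp flip: id_eq_one)
  then show ?thesis
    using fin by (auto simp: finite_action_def composition_rule intro: element_image)
qed

lemma finite_action_inv:
  assumes "group G" "finite_action G E \<alpha>" "g \<in> carrier G" "x \<in> E"
  shows "\<alpha> (inv\<^bsub>G\<^esub> g) (\<alpha> g x) = x" "\<alpha> g (\<alpha> (inv\<^bsub>G\<^esub> g) x) = x"
proof -
  interpret group G by fact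
  show "\<alpha> (inv\<^bsub>G\<^esub> g) (\<alpha> g x) = x" "\<alpha> g (\<alpha> (inv\<^bsub>G\<^esub> g) x) = x"
    using finite_actionD(3)[OF assms(2,4)]
      finite_actionD(4)[OF assms(2) assms(3) inv_closed[OF assms(3)] assms(4)]
      finite_actionD(4)[OF assms(2) inv_closed[OF assms(3)] assms(3) assms(4)]
    by (auto simp: assms(3))
qed

lemma finite_action_bij:
  assumes "group G" "finite_action G E \<alpha>" "g \<in> carrier G"
  shows "bij_betw (\<alpha> g) E E"
proof -
  interpret group G by fact
  show ?thesis
    using assms finite_action_inv[OF assms] finite_actionD(2)[OF assms(2)]
    by (intro bij_betw_byWitness[where f' = "\<alpha> (inv\<^bsub>G\<^esub> g)"]) auto
qed

text \<open>Each element acts bijectively because its inverse does the reverse, and cutting the maps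
  down to \<open>E\<close> makes them members of \<open>Bij E\<close>.\<close>

lemma finite_action_gset:
  assumes "group G" "finite_action G E \<alpha>"
  shows "gset G E (\<lambda>g. \<lambda>x\<in>E. \<alpha> g x)"
proof -
  interpret group G by fact
  have bij: "(\<lambda>x\<in>E. \<alpha> g x) \<in> Bij E" if "g \<in> carrier G" for g
    using finite_action_bij[OF assms that] by (simp add: Bij_def cong: bij_betw_cong)
  have "(\<lambda>g. \<lambda>x\<in>E. \<alpha> g x) \<in> hom G (BijGroup E)"
  proof (rule homI)
    fix g h assume gh: "g \<in> carrier G" "h \<in> carrier G"
    have "(\<lambda>x\<in>E. \<alpha> (g \<otimes>\<^bsub>G\<^esub> h) x) = compose E (\<lambda>x\<in>E. \<alpha> g x) (\<lambda>x\<in>E. \<alpha> h x)"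
      using gh finite_actionD[OF assms(2)] by (auto simp: compose_def fun_eq_iff)
    then show "(\<lambda>x\<in>E. \<alpha> (g \<otimes>\<^bsub>G\<^esub> h) x) = (\<lambda>x\<in>E. \<alpha> g x) \<otimes>\<^bsub>BijGroup E\<^esub> (\<lambda>x\<in>E. \<alpha> h x)"
      by (simp add: BijGroup_def bij gh)
  qed (simp add: BijGroup_def bij)
  then show ?thesis
    using finite_actionD(1)[OF assms(2)]
    by (simp add: gset_def group_action_def group_hom_def group_hom_axioms_def group_BijGroup)
qed

lemma gset_iso_refl: "gset_iso G E \<alpha> E \<alpha>"
  by (auto simp: gset_iso_def intro!: exI[of _ id])

lemma gset_iso_restrict:
  assumes "finite_action G E \<alpha>"
  shows "gset_iso G E \<alpha> E (\<lambda>g. \<lambda>x\<in>E. \<alpha> g x)"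
  by (auto simp: gset_iso_def intro!: exI[of _ id])

lemma gset_iso_sym:
  assumes "finite_action G E \<alpha>" "gset_iso G E \<alpha> D \<beta>"
  shows "gset_iso G D \<beta> E \<alpha>"
proof -
  obtain h where h: "bij_betw h E D" "\<forall>g\<in>carrier G. \<forall>x\<in>E. h (\<alpha> g x) = \<beta> g (h x)"
    using assms(2) by (auto simp: gset_iso_def)
  have "inv_into E h (\<beta> g y) = \<alpha> g (inv_into E h y)" if "g \<in> carrier G" "y \<in> D" for g y
  proof -
    define x where "x = inv_into E h y"
    have x: "x \<in> E" "h x = y"
      using h(1) that unfolding x_def
      by (metis bij_betw_def inv_into_into, metis bij_betw_inv_into_right)
    have "inv_into E h (h (\<alpha> g x)) = \<alpha> g x"
      using x that h(1) finite_actionD(2)[OF assms(1)] by (meson bij_betw_inv_into_left)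
    then show ?thesis
      using h(2) x that by (simp flip: x_def)
  qed
  then show ?thesis
    using bij_betw_inv_into[OF h(1)] unfolding gset_iso_def by blast
qed

lemma gset_iso_trans:
  assumes "gset_iso G E \<alpha> D \<beta>" "gset_iso G D \<beta> C \<gamma>"
  shows "gset_iso G E \<alpha> C \<gamma>"
proof -
  obtain h k where h: "bij_betw h E D" "\<forall>g\<in>carrier G. \<forall>x\<in>E. h (\<alpha> g x) = \<beta> g (h x)"
    and k: "bij_betw k D C" "\<forall>g\<in>carrier G. \<forall>x\<in>D. k (\<beta> g x) = \<gamma> g (k x)"
    using assms by (auto simp: gset_iso_def)
  have "h x \<in> D" if "x \<in> E" for x
    using h(1) that by (auto simp: bij_betw_def)
  then show ?thesis
    using h k bij_betw_trans[OF h(1) k(1)]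
    unfolding gset_iso_def by (intro exI[of _ "k \<circ> h"]) auto
qed

lemma gset_class_eqI:
  assumes "finite_action G E \<alpha>" "gset_iso G E \<alpha> D \<beta>"
  shows "gset_class G E \<alpha> = gset_class G D \<beta>"
  using gset_iso_trans[OF gset_iso_sym[OF assms]] gset_iso_trans[OF assms(2)]
  by (auto simp: gset_class_def)

lemma gset_class_memD:
  assumes "(D, \<beta>) \<in> gset_class G E \<alpha>"
  shows "gset G D \<beta>" "finite_action G D \<beta>" "gset_iso G E \<alpha> D \<beta>"
  using assms by (auto simp: gset_class_def gset_finite_action)

text \<open>A class contains only actions on sets of natural numbers. To see that it is nonempty for
  an action on an arbitrary type, the action is transported along an enumeration of
  \<open>E\<close>.\<close>

lemma gset_class_rep:
  assumes "group G" "finite_action G E \<alpha>"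
  obtains D \<beta> where "(D, \<beta>) \<in> gset_class G E \<alpha>"
proof -
  obtain h where h: "bij_betw h E {0..<card E}"
    using ex_bij_betw_finite_nat[OF finite_actionD(1)[OF assms(2)]] by auto
  define \<beta> where "\<beta> g y = h (\<alpha> g (inv_into E h y))" for g y
  let ?D = "{0..<card E}"
  have h_inv: "inv_into E h y \<in> E" "h (inv_into E h y) = y" if "y \<in> ?D" for y
    using h that by (metis bij_betw_def inv_into_into, metis bij_betw_inv_into_right)
  have inv_h: "inv_into E h (h x) = x" "h x \<in> ?D" if "x \<in> E" for x
    using h that by (metis bij_betw_inv_into_left, auto simp: bij_betw_def)
  note actD = finite_actionD[OF assms(2)]
  have act: "finite_action G ?D \<beta>"
    unfolding finite_action_def \<beta>_def
    using actD h_inv inv_h by simp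
  have "gset_iso G E \<alpha> ?D \<beta>"
    unfolding gset_iso_def \<beta>_def using h inv_h by (intro exI[of _ h]) simp
  then have "gset_iso G E \<alpha> ?D (\<lambda>g. \<lambda>y\<in>?D. \<beta> g y)"
    using gset_iso_restrict[OF act] by (rule gset_iso_trans)
  then have "(?D, \<lambda>g. \<lambda>y\<in>?D. \<beta> g y) \<in> gset_class G E \<alpha>"
    using finite_action_gset[OF assms(1) act] by (simp add: gset_class_def)
  then show thesis by (rule that)
qed

section \<open>The semiring of isomorphism classes and its marks\<close>

lemma burnside_carrierI:
  assumes "group G" "finite_action G E \<alpha>"
  shows "gset_class G E \<alpha> \<in> carrier (burnside_semiring G)"
proof -
  obtain D \<beta> where D: "(D, \<beta>) \<in> gset_class G E \<alpha>"
    using gset_class_rep[OF assms] .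
  then have "gset_class G E \<alpha> = gset_class G D \<beta>"
    using gset_class_memD(3) by (intro gset_class_eqI assms)
  then show ?thesis
    using gset_class_memD(1)[OF D] by (auto simp: burnside_semiring_def)
qed

lemma burnside_carrierE:
  assumes "c \<in> carrier (burnside_semiring G)"
  obtains E :: "nat set" and \<alpha> where "gset G E \<alpha>" "finite_action G E \<alpha>" "c = gset_class G E \<alpha>"
  using assms that by (auto simp: burnside_semiring_def gset_finite_action)

text \<open>The mark on genuine sets, before extension to formal differences; isomorphism invariance
  of fixed-point counts makes the image a singleton.\<close>

definition gset_mark :: "'a set \<Rightarrow> 'a gset_class \<Rightarrow> int" where
  "gset_mark P c = the_elem ((\<lambda>(E, \<alpha>). int (card (fixed_points P E \<alpha>))) ` c)"

lemma card_fixed_points_iso: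
  assumes "finite_action G E \<alpha>" "gset_iso G E \<alpha> D \<beta>" "P \<subseteq> carrier G"
  shows "card (fixed_points P D \<beta>) = card (fixed_points P E \<alpha>)"
proof -
  obtain h where h: "bij_betw h E D" "\<forall>g\<in>carrier G. \<forall>x\<in>E. h (\<alpha> g x) = \<beta> g (h x)"
    using assms(2) by (auto simp: gset_iso_def)
  have inj: "inj_on h E" and im: "h ` E = D"
    using h(1) by (auto simp: bij_betw_def)
  have iff: "\<beta> g (h x) = h x \<longleftrightarrow> \<alpha> g x = x" if "g \<in> P" "x \<in> E" for g x
    using that assms(3) h(2) inj finite_actionD(2)[OF assms(1)]
    by (metis inj_on_eq_iff subsetD)
  have "h ` fixed_points P E \<alpha> = fixed_points P D \<beta>"
    using im iff by (auto simp: fixed_points_def)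
  moreover have "inj_on h (fixed_points P E \<alpha>)"
    using inj by (auto simp: fixed_points_def inj_on_def)
  ultimately show ?thesis
    by (metis card_image)
qed

lemma gset_mark_class:
  assumes "group G" "finite_action G E \<alpha>" "P \<subseteq> carrier G"
  shows "gset_mark P (gset_class G E \<alpha>) = int (card (fixed_points P E \<alpha>))"
proof -
  obtain D \<beta> where D: "(D, \<beta>) \<in> gset_class G E \<alpha>"
    using gset_class_rep[OF assms(1,2)] .
  have "card (fixed_points P D' \<beta>') = card (fixed_points P E \<alpha>)"
    if "(D', \<beta>') \<in> gset_class G E \<alpha>" for D' \<beta>'
    using card_fixed_points_iso[OF assms(2) gset_class_memD(3)[OF that] assms(3)] .
  then have "(\<lambda>(E, \<alpha>). int (card (fixed_points P E \<alpha>))) ` gset_class G E \<alpha> =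
      (\<lambda>_. int (card (fixed_points P E \<alpha>))) ` gset_class G E \<alpha>"
    by (intro image_cong refl) auto
  also have "\<dots> = {int (card (fixed_points P E \<alpha>))}"
    using D by auto
  finally show ?thesis
    by (simp add: gset_mark_def)
qed

lemma finite_action_Plus:
  assumes "finite_action G E \<alpha>" "finite_action G D \<beta>"
  shows "finite_action G (Sum_Type.Plus E D) (\<lambda>g. map_sum (\<alpha> g) (\<beta> g))"
  using finite_actionD[OF assms(1)] finite_actionD[OF assms(2)]
  by (auto simp: finite_action_def)

lemma finite_action_Times:
  assumes "finite_action G E \<alpha>" "finite_action G D \<beta>"
  shows "finite_action G (E \<times> D) (\<lambda>g. map_prod (\<alpha> g) (\<beta> g))"
  using finite_actionD[OF assms(1)] finite_actionD[OF assms(2)]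
  by (auto simp: finite_action_def)

lemma gset_iso_Plus:
  assumes "gset_iso G E \<alpha> E' \<alpha>'" "gset_iso G D \<beta> D' \<beta>'"
  shows "gset_iso G (Sum_Type.Plus E D) (\<lambda>g. map_sum (\<alpha> g) (\<beta> g)) (Sum_Type.Plus E' D') (\<lambda>g. map_sum (\<alpha>' g) (\<beta>' g))"
proof -
  obtain h where h: "bij_betw h E E'" "\<forall>g\<in>carrier G. \<forall>x\<in>E. h (\<alpha> g x) = \<alpha>' g (h x)"
    using assms(1) unfolding gset_iso_def by blast
  obtain k where k: "bij_betw k D D'" "\<forall>g\<in>carrier G. \<forall>x\<in>D. k (\<beta> g x) = \<beta>' g (k x)"
    using assms(2) unfolding gset_iso_def by blast
  have "bij_betw (map_sum h k) (Sum_Type.Plus E D) (Sum_Type.Plus E' D')"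
  proof (rule bij_betw_imageI)
    show "inj_on (map_sum h k) (Sum_Type.Plus E D)"
      using inj_onD[OF bij_betw_imp_inj_on[OF h(1)]] inj_onD[OF bij_betw_imp_inj_on[OF k(1)]]
      by (intro inj_onI) (auto elim!: PlusE)
    have "map_sum h k ` (Sum_Type.Plus E D) = Sum_Type.Plus (h ` E) (k ` D)"
      by (simp add: Plus_def image_Un image_image)
    then show "map_sum h k ` (Sum_Type.Plus E D) = Sum_Type.Plus E' D'"
      using h(1) k(1) by (simp add: bij_betw_def)
  qed
  then show ?thesis
    using h(2) k(2) unfolding gset_iso_def by (intro exI[of _ "map_sum h k"]) auto
qed

lemma gset_iso_Times:
  assumes "gset_iso G E \<alpha> E' \<alpha>'" "gset_iso G D \<beta> D' \<beta>'"
  shows "gset_iso G (E \<times> D) (\<lambda>g. map_prod (\<alpha> g) (\<beta> g)) (E' \<times> D') (\<lambda>g. map_prod (\<alpha>' g) (\<beta>' g))"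
proof -
  obtain h where h: "bij_betw h E E'" "\<forall>g\<in>carrier G. \<forall>x\<in>E. h (\<alpha> g x) = \<alpha>' g (h x)"
    using assms(1) unfolding gset_iso_def by blast
  obtain k where k: "bij_betw k D D'" "\<forall>g\<in>carrier G. \<forall>x\<in>D. k (\<beta> g x) = \<beta>' g (k x)"
    using assms(2) unfolding gset_iso_def by blast
  have "bij_betw (map_prod h k) (E \<times> D) (E' \<times> D')"
    using h(1) k(1) by (rule bij_betw_map_prod)
  then show ?thesis
    using h(2) k(2) unfolding gset_iso_def by (intro exI[of _ "map_prod h k"]) auto
qed

lemma burnside_add:
  assumes "group G" "finite_action G E \<alpha>" "finite_action G D \<beta>"
  shows "gset_class G E \<alpha> \<oplus>\<^bsub>burnside_semiring G\<^esub> gset_class G D \<beta> =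
    gset_class G (Sum_Type.Plus E D) (\<lambda>g. map_sum (\<alpha> g) (\<beta> g))"
proof -
  obtain E0 \<alpha>0 where E0: "(E0, \<alpha>0) \<in> gset_class G E \<alpha>"
    using gset_class_rep[OF assms(1,2)] .
  obtain D0 \<beta>0 where D0: "(D0, \<beta>0) \<in> gset_class G D \<beta>"
    using gset_class_rep[OF assms(1,3)] .
  show ?thesis
    unfolding burnside_semiring_def ring.simps monoid.simps
    by (rule UN_pairs_const[OF E0 D0])
      (intro gset_class_eqI[symmetric] finite_action_Plus gset_iso_Plus assms gset_class_memD(3))
qed

lemma burnside_mult:
  assumes "group G" "finite_action G E \<alpha>" "finite_action G D \<beta>"
  shows "gset_class G E \<alpha> \<otimes>\<^bsub>burnside_semiring G\<^esub> gset_class G D \<beta> =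
    gset_class G (E \<times> D) (\<lambda>g. map_prod (\<alpha> g) (\<beta> g))"
proof -
  obtain E0 \<alpha>0 where E0: "(E0, \<alpha>0) \<in> gset_class G E \<alpha>"
    using gset_class_rep[OF assms(1,2)] .
  obtain D0 \<beta>0 where D0: "(D0, \<beta>0) \<in> gset_class G D \<beta>"
    using gset_class_rep[OF assms(1,3)] .
  show ?thesis
    unfolding burnside_semiring_def ring.simps monoid.simps
    by (rule UN_pairs_const[OF E0 D0])
      (intro gset_class_eqI[symmetric] finite_action_Times gset_iso_Times assms gset_class_memD(3))
qed

lemma card_fixed_points_Plus:
  assumes "finite E" "finite D"
  shows "card (fixed_points P (Sum_Type.Plus E D) (\<lambda>g. map_sum (\<alpha> g) (\<beta> g))) =
    card (fixed_points P E \<alpha>) + card (fixed_points P D \<beta>)"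
proof -
  have "fixed_points P (Sum_Type.Plus E D) (\<lambda>g. map_sum (\<alpha> g) (\<beta> g)) =
      Sum_Type.Plus (fixed_points P E \<alpha>) (fixed_points P D \<beta>)"
    by (auto simp: fixed_points_def)
  then show ?thesis
    using assms by (simp add: card_Plus fixed_points_def)
qed

lemma card_fixed_points_Times:
  "card (fixed_points P (E \<times> D) (\<lambda>g. map_prod (\<alpha> g) (\<beta> g))) =
    card (fixed_points P E \<alpha>) * card (fixed_points P D \<beta>)"
proof -
  have "fixed_points P (E \<times> D) (\<lambda>g. map_prod (\<alpha> g) (\<beta> g)) =
      fixed_points P E \<alpha> \<times> fixed_points P D \<beta>"
    by (auto simp: fixed_points_def)
  then show ?thesis
    by (simp add: card_cartesian_product)
qed

section \<open>Marks determine finite group actions\<close>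

lemma finite_action_stabilizer:
  assumes "group G" "finite_action G E \<alpha>" "x \<in> E"
  shows "subgroup (stabilizer G \<alpha> x) G"
proof -
  interpret group G by fact
  note actD = finite_actionD[OF assms(2)]
  show ?thesis
  proof (rule subgroupI)
    show "stabilizer G \<alpha> x \<noteq> {}"
      using actD(3)[OF assms(3)] by (auto simp: stabilizer_def)
    fix g assume g: "g \<in> stabilizer G \<alpha> x"
    then have "\<alpha> (inv\<^bsub>G\<^esub> g) x = x"
      using finite_action_inv(1)[OF assms(1,2) _ assms(3), of g] by (auto simp: stabilizer_def)
    then show "inv\<^bsub>G\<^esub> g \<in> stabilizer G \<alpha> x"
      using g by (simp add: stabilizer_def)
    fix h assume "h \<in> stabilizer G \<alpha> x"
    then show "g \<otimes>\<^bsub>G\<^esub> h \<in> stabilizer G \<alpha> x"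
      using g actD(4) assms(3) by (simp add: stabilizer_def)
  qed (auto simp: stabilizer_def)
qed

lemma finite_action_eq_iff:
  assumes "group G" "finite_action G E \<alpha>" "x \<in> E" "g \<in> carrier G" "h \<in> carrier G"
  shows "\<alpha> g x = \<alpha> h x \<longleftrightarrow> inv\<^bsub>G\<^esub> h \<otimes>\<^bsub>G\<^esub> g \<in> stabilizer G \<alpha> x"
proof -
  interpret group G by fact
  note actD = finite_actionD[OF assms(2)]
  have "\<alpha> (inv\<^bsub>G\<^esub> h \<otimes>\<^bsub>G\<^esub> g) x = \<alpha> (inv\<^bsub>G\<^esub> h) (\<alpha> g x)"
    using assms actD(4) by simp
  then show ?thesis
    using assms finite_action_inv[OF assms(1,2,5)] actD(2)
    by (auto simp: stabilizer_def) metis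
qed

lemma finite_action_subset:
  assumes "finite_action G E \<alpha>" "A \<subseteq> E" "\<And>g x. \<lbrakk>g \<in> carrier G; x \<in> A\<rbrakk> \<Longrightarrow> \<alpha> g x \<in> A"
  shows "finite_action G A \<alpha>"
  using assms finite_subset[OF assms(2)] unfolding finite_action_def by (simp add: subset_iff)

lemma orbitI: "g \<in> carrier G \<Longrightarrow> \<alpha> g x \<in> orbit G \<alpha> x"
  by (auto simp: orbit_def)

lemma orbitE:
  assumes "z \<in> orbit G \<alpha> x"
  obtains g where "g \<in> carrier G" "z = \<alpha> g x"
  using assms by (auto simp: orbit_def)

lemma finite_action_orbit:
  assumes "group G" "finite_action G E \<alpha>" "x \<in> E"
  shows "orbit G \<alpha> x \<subseteq> E" "finite_action G (orbit G \<alpha> x) \<alpha>"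
    "finite_action G (E - orbit G \<alpha> x) \<alpha>" "x \<in> orbit G \<alpha> x"
proof -
  interpret group G by fact
  note actD = finite_actionD[OF assms(2)]
  show sub: "orbit G \<alpha> x \<subseteq> E"
    using actD(2)[OF _ assms(3)] by (auto simp: orbit_def)
  have cl: "\<alpha> g z \<in> orbit G \<alpha> x" if g: "g \<in> carrier G" and z: "z \<in> orbit G \<alpha> x" for g z
  proof -
    obtain h where h: "h \<in> carrier G" "z = \<alpha> h x"
      using z by (rule orbitE)
    then have "\<alpha> g z = \<alpha> (g \<otimes>\<^bsub>G\<^esub> h) x"
      using actD(4)[OF g h(1) assms(3)] by simp
    then show ?thesis
      using g h(1) by (simp add: orbitI)
  qed
  show "finite_action G (orbit G \<alpha> x) \<alpha>"
    using assms(2) sub cl by (rule finite_action_subset)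
  have cl': "\<alpha> g z \<notin> orbit G \<alpha> x" if "g \<in> carrier G" "z \<in> E - orbit G \<alpha> x" for g z
    using that cl[of "inv\<^bsub>G\<^esub> g" "\<alpha> g z"] finite_action_inv(1)[OF assms(1,2), of g z] by auto
  show "finite_action G (E - orbit G \<alpha> x) \<alpha>"
    by (rule finite_action_subset[OF assms(2)]) (auto simp: actD(2) cl')
  show "x \<in> orbit G \<alpha> x"
    using orbitI[of "\<one>\<^bsub>G\<^esub>" G \<alpha> x] actD(3)[OF assms(3)] by simp
qed

text \<open>Both orbits are copies of the coset space of the common stabilizer. The map sends
  \<alpha> g x to \<beta> g y.\<close>

lemma gset_iso_orbit:
  assumes "group G" "finite_action G E \<alpha>" "finite_action G D \<beta>" "x \<in> E" "y \<in> D"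
    and stab: "stabilizer G \<alpha> x = stabilizer G \<beta> y"
  shows "gset_iso G (orbit G \<alpha> x) \<alpha> (orbit G \<beta> y) \<beta>"
proof -
  interpret group G by fact
  \<comment> \<open>The group element is chosen arbitrarily; two choices differ by an element of the
    stabilizer of \<open>x\<close>, which also fixes \<open>y\<close>.\<close>
  define k where "k z = \<beta> (SOME g. g \<in> carrier G \<and> z = \<alpha> g x) y" for z
  have eq_iff: "\<alpha> g x = \<alpha> h x \<longleftrightarrow> \<beta> g y = \<beta> h y"
    if "g \<in> carrier G" "h \<in> carrier G" for g h
    using that finite_action_eq_iff[OF assms(1,2,4)] finite_action_eq_iff[OF assms(1,3,5)] stab
    by simp
  have k: "k (\<alpha> g x) = \<beta> g y" if "g \<in> carrier G" for g
  proof -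
    define h where "h = (SOME h. h \<in> carrier G \<and> \<alpha> g x = \<alpha> h x)"
    have "h \<in> carrier G \<and> \<alpha> g x = \<alpha> h x"
      unfolding h_def by (rule someI[where x = g]) (simp add: that)
    moreover have "k (\<alpha> g x) = \<beta> h y"
      by (simp add: k_def h_def)
    ultimately show ?thesis
      using that eq_iff[of g h] by simp
  qed
  have "bij_betw k (orbit G \<alpha> x) (orbit G \<beta> y)"
  proof (rule bij_betw_imageI)
    show "inj_on k (orbit G \<alpha> x)"
      by (rule inj_onI, elim orbitE) (simp add: k eq_iff)
    show "k ` orbit G \<alpha> x = orbit G \<beta> y"
    proof
      show "k ` orbit G \<alpha> x \<subseteq> orbit G \<beta> y"
        by (auto elim!: orbitE simp: k orbitI)
      show "orbit G \<beta> y \<subseteq> k ` orbit G \<alpha> x"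
      proof
        fix z assume "z \<in> orbit G \<beta> y"
        then obtain g where g: "g \<in> carrier G" "z = \<beta> g y"
          by (rule orbitE)
        show "z \<in> k ` orbit G \<alpha> x"
          using g by (intro image_eqI[of _ _ "\<alpha> g x"]) (simp_all add: k orbitI)
      qed
    qed
  qed
  moreover have "k (\<alpha> g z) = \<beta> g (k z)" if g: "g \<in> carrier G" and z: "z \<in> orbit G \<alpha> x" for g z
  proof -
    obtain h where h: "h \<in> carrier G" "z = \<alpha> h x"
      using z by (rule orbitE)
    then show ?thesis
      using k[OF m_closed[OF g h(1)]] k[OF h(1)] finite_actionD(4)[OF assms(2) g h(1) assms(4)]
        finite_actionD(4)[OF assms(3) g h(1) assms(5)] by simp
  qed
  ultimately show ?thesis
    unfolding gset_iso_def by blast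
qed

lemma gset_iso_Un:
  assumes h: "gset_iso G A \<alpha> A' \<beta>" and k: "gset_iso G B \<alpha> B' \<beta>"
    and A: "finite_action G A \<alpha>" and B: "finite_action G B \<alpha>"
    and "A \<inter> B = {}" "A' \<inter> B' = {}"
  shows "gset_iso G (A \<union> B) \<alpha> (A' \<union> B') \<beta>"
proof -
  obtain h where h: "bij_betw h A A'" "\<forall>g\<in>carrier G. \<forall>x\<in>A. h (\<alpha> g x) = \<beta> g (h x)"
    using h unfolding gset_iso_def by blast
  obtain k where k: "bij_betw k B B'" "\<forall>g\<in>carrier G. \<forall>x\<in>B. k (\<alpha> g x) = \<beta> g (k x)"
    using k unfolding gset_iso_def by blast
  define f where "f x = (if x \<in> A then h x else k x)" for x
  have f: "f x = h x" if "x \<in> A" for x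
    using that by (simp add: f_def)
  have f': "f x = k x" if "x \<in> B" for x
    using that assms(5) by (auto simp: f_def)
  have "bij_betw f A A'" "bij_betw f B B'"
    using h(1) k(1) f f' by (simp_all cong: bij_betw_cong)
  then have "bij_betw f (A \<union> B) (A' \<union> B')"
    using assms(6) by (rule bij_betw_combine)
  moreover have "f (\<alpha> g x) = \<beta> g (f x)" if "g \<in> carrier G" "x \<in> A \<union> B" for g x
    using that h(2) k(2) f f' finite_actionD(2)[OF A] finite_actionD(2)[OF B] by auto
  ultimately show ?thesis
    unfolding gset_iso_def by blast
qed

lemma card_fixed_points_Diff:
  assumes "finite E" "A \<subseteq> E"
  shows "card (fixed_points P (E - A) \<alpha>) + card (fixed_points P A \<alpha>) = card (fixed_points P E \<alpha>)"
proof -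
  have "fixed_points P E \<alpha> = fixed_points P (E - A) \<alpha> \<union> fixed_points P A \<alpha>"
    using assms(2) by (auto simp: fixed_points_def)
  moreover have "fixed_points P (E - A) \<alpha> \<inter> fixed_points P A \<alpha> = {}"
    by (auto simp: fixed_points_def)
  moreover have "finite (fixed_points P (E - A) \<alpha>)" "finite (fixed_points P A \<alpha>)"
    using assms finite_subset[OF assms(2)] by (auto simp: fixed_points_def)
  ultimately show ?thesis
    by (simp add: card_Un_disjoint)
qed

text \<open>
  A point \<open>x\<close> whose stabilizer has maximal order forces a point with the same stabilizer in the
  other set; the orbits of the two points are isomorphic and can be removed.
\<close>

lemma gset_iso_if_marks_eq:
  assumes "group G" "finite (carrier G)"
    and "finite_action G E \<alpha>" "finite_action G D \<beta>"
    and "\<And>P. subgroup P G \<Longrightarrow> card (fixed_points P E \<alpha>) = card (fixed_points P D \<beta>)"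
  shows "gset_iso G E \<alpha> D \<beta>"
  using assms(3-)
proof (induction "card E" arbitrary: E D rule: less_induct)
  case less
  interpret group G by fact
  have fin: "finite E" "finite D"
    using less.prems finite_actionD(1) by auto
  have one: "fixed_points {\<one>\<^bsub>G\<^esub>} E \<alpha> = E" "fixed_points {\<one>\<^bsub>G\<^esub>} D \<beta> = D"
    using finite_actionD(3)[OF less.prems(1)] finite_actionD(3)[OF less.prems(2)]
    by (auto simp: fixed_points_def)
  \<comment> \<open>The mark at the trivial subgroup counts all points.\<close>
  have card_eq: "card E = card D"
    using less.prems(3)[OF triv_subgroup] one by simp
  show ?case
  proof (cases "E = {}")
    case True
    then have "D = {}"
      using card_eq fin by simp
    then show ?thesis
      using True by (simp add: gset_iso_def bij_betw_def)
  next
    case False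
    let ?s = "\<lambda>x. card (stabilizer G \<alpha> x)"
    obtain x where x: "x \<in> E" and max: "\<And>z. z \<in> E \<Longrightarrow> ?s z \<le> ?s x"
    proof -
      have "Max (?s ` E) \<in> ?s ` E"
        using fin False by simp
      then obtain x where "x \<in> E" "?s x = Max (?s ` E)"
        by auto
      then show thesis
        using that fin by (metis Max_ge finite_imageI image_eqI)
    qed
    define H where "H = stabilizer G \<alpha> x"
    have H: "subgroup H G"
      unfolding H_def by (rule finite_action_stabilizer[OF assms(1) less.prems(1) x])
    have "x \<in> fixed_points H E \<alpha>"
      using x by (auto simp: H_def fixed_points_def stabilizer_def)
    then have "card (fixed_points H D \<beta>) > 0"
      using fin unfolding less.prems(3)[OF H, symmetric]
      by (subst card_gt_0_iff) (auto simp: fixed_points_def)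
    then obtain y where y: "y \<in> fixed_points H D \<beta>"
      by (auto simp: card_gt_0_iff)
    then have yD: "y \<in> D"
      by (simp add: fixed_points_def)
    define K where "K = stabilizer G \<beta> y"
    have K: "subgroup K G"
      unfolding K_def by (rule finite_action_stabilizer[OF assms(1) less.prems(2) yD])
    have HK: "H \<subseteq> K"
      using y subgroup.subset[OF H] by (auto simp: K_def fixed_points_def stabilizer_def)
    have "y \<in> fixed_points K D \<beta>"
      using yD by (auto simp: K_def fixed_points_def stabilizer_def)
    then have "card (fixed_points K E \<alpha>) > 0"
      using fin unfolding less.prems(3)[OF K]
      by (subst card_gt_0_iff) (auto simp: fixed_points_def)
    then obtain z where z: "z \<in> fixed_points K E \<alpha>"
      by (auto simp: card_gt_0_iff)
    have "K \<subseteq> stabilizer G \<alpha> z"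
      using z subgroup.subset[OF K] by (auto simp: fixed_points_def stabilizer_def)
    then have "card K \<le> ?s z"
      using assms(2) by (intro card_mono) (auto simp: stabilizer_def)
    also have "\<dots> \<le> card H"
      unfolding H_def using z by (intro max) (simp add: fixed_points_def)
    \<comment> \<open>\<open>K\<close> lies in the stabilizer of \<open>z\<close>, whose order is at
      most that of \<open>H\<close> by maximality; since \<open>H\<close> lies in \<open>K\<close>,
      they coincide.\<close>
    finally have "H = K"
      using HK assms(2) by (intro card_seteq) (auto simp: K_def stabilizer_def)
    then have iso: "gset_iso G (orbit G \<alpha> x) \<alpha> (orbit G \<beta> y) \<beta>"
      unfolding H_def K_def by (rule gset_iso_orbit[OF assms(1) less.prems(1,2) x yD])
    note Ox = finite_action_orbit[OF assms(1) less.prems(1) x]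
    note Oy = finite_action_orbit[OF assms(1) less.prems(2) yD]
    have "gset_iso G (E - orbit G \<alpha> x) \<alpha> (D - orbit G \<beta> y) \<beta>"
    proof (rule less.hyps[OF _ Ox(3) Oy(3)])
      show "card (E - orbit G \<alpha> x) < card E"
        using x Ox(4) fin(1) by (intro psubset_card_mono) auto
      fix P assume P: "subgroup P G"
      have "card (fixed_points P (orbit G \<beta> y) \<beta>) = card (fixed_points P (orbit G \<alpha> x) \<alpha>)"
        using Ox(2) iso subgroup.subset[OF P] by (rule card_fixed_points_iso)
      then show "card (fixed_points P (E - orbit G \<alpha> x) \<alpha>) = card (fixed_points P (D - orbit G \<beta> y) \<beta>)"
        using less.prems(3)[OF P] card_fixed_points_Diff[OF fin(1) Ox(1), of P \<alpha>]
          card_fixed_points_Diff[OF fin(2) Oy(1), of P \<beta>] by simp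
    qed
    then have "gset_iso G (orbit G \<alpha> x \<union> (E - orbit G \<alpha> x)) \<alpha>
        (orbit G \<beta> y \<union> (D - orbit G \<beta> y)) \<beta>"
      by (intro gset_iso_Un iso Ox) auto
    then show ?thesis
      using Ox(1) Oy(1) by (simp add: Un_absorb1)
  qed
qed

section \<open>The Burnside ring embedded by its marks\<close>

lemma burnside_zero: "\<zero>\<^bsub>burnside_semiring G\<^esub> = gset_class G ({} :: nat set) (\<lambda>g x. x)"
  and burnside_one: "\<one>\<^bsub>burnside_semiring G\<^esub> = gset_class G {()} (\<lambda>g x. x)"
  by (simp_all add: burnside_semiring_def)

lemma finite_action_trivial: "finite E \<Longrightarrow> finite_action G E (\<lambda>g x. x)"
  by (simp add: finite_action_def)

text \<open>Marks are additive and multiplicative, and they separate isomorphism classes by the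
  preceding classification. The group is arbitrary finite, so the result serves both the ambient
  group and each of its subgroups.\<close>

lemma burnside_ghost_semiring:
  assumes "group G" "finite (carrier G)"
  shows "ghost_semiring (burnside_semiring G) {P. subgroup P G} gset_mark"
proof
  note mark = gset_mark_class[OF assms(1)] and carrierI = burnside_carrierI[OF assms(1)]
  show "\<zero>\<^bsub>burnside_semiring G\<^esub> \<in> carrier (burnside_semiring G)"
    "\<one>\<^bsub>burnside_semiring G\<^esub> \<in> carrier (burnside_semiring G)"
    unfolding burnside_zero burnside_one by (intro carrierI finite_action_trivial; simp)+
  fix P assume "P \<in> {P. subgroup P G}"
  then have P: "P \<subseteq> carrier G"
    by (simp add: subgroup.subset)
  show "gset_mark P \<zero>\<^bsub>burnside_semiring G\<^esub> = 0" "gset_mark P \<one>\<^bsub>burnside_semiring G\<^esub> = 1"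
    unfolding burnside_zero burnside_one
    by (subst mark[OF finite_action_trivial P]; simp add: fixed_points_def)+
next
  note mark = gset_mark_class[OF assms(1)] and carrierI = burnside_carrierI[OF assms(1)]
  fix a b assume a: "a \<in> carrier (burnside_semiring G)" and b: "b \<in> carrier (burnside_semiring G)"
  obtain E :: "nat set" and \<alpha> where E: "finite_action G E \<alpha>" "a = gset_class G E \<alpha>"
    using a by (rule burnside_carrierE)
  obtain D :: "nat set" and \<beta> where D: "finite_action G D \<beta>" "b = gset_class G D \<beta>"
    using b by (rule burnside_carrierE)
  note Plus = finite_action_Plus[OF E(1) D(1)] and Times = finite_action_Times[OF E(1) D(1)]
  show "a \<oplus>\<^bsub>burnside_semiring G\<^esub> b \<in> carrier (burnside_semiring G)"
    unfolding E(2) D(2) burnside_add[OF assms(1) E(1) D(1)] using Plus by (rule carrierI)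
  show "a \<otimes>\<^bsub>burnside_semiring G\<^esub> b \<in> carrier (burnside_semiring G)"
    unfolding E(2) D(2) burnside_mult[OF assms(1) E(1) D(1)] using Times by (rule carrierI)
  {
    fix P assume "P \<in> {P. subgroup P G}"
    then have P: "P \<subseteq> carrier G"
      by (simp add: subgroup.subset)
    show "gset_mark P (a \<oplus>\<^bsub>burnside_semiring G\<^esub> b) = gset_mark P a + gset_mark P b"
      unfolding E(2) D(2) burnside_add[OF assms(1) E(1) D(1)] mark[OF E(1) P] mark[OF D(1) P]
        mark[OF Plus P] using finite_actionD(1)[OF E(1)] finite_actionD(1)[OF D(1)]
      by (simp add: card_fixed_points_Plus)
    show "gset_mark P (a \<otimes>\<^bsub>burnside_semiring G\<^esub> b) = gset_mark P a * gset_mark P b"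
      unfolding E(2) D(2) burnside_mult[OF assms(1) E(1) D(1)] mark[OF E(1) P] mark[OF D(1) P]
        mark[OF Times P] by (simp add: card_fixed_points_Times)
  }
  assume eq: "\<And>P. P \<in> {P. subgroup P G} \<Longrightarrow> gset_mark P a = gset_mark P b"
  have "card (fixed_points P E \<alpha>) = card (fixed_points P D \<beta>)" if "subgroup P G" for P
    using eq[of P] that subgroup.subset[OF that] unfolding E(2) D(2)
    by (simp add: mark[OF E(1)] mark[OF D(1)])
  then have "gset_iso G E \<alpha> D \<beta>"
    by (rule gset_iso_if_marks_eq[OF assms E(1) D(1)])
  then show "a = b"
    unfolding E(2) D(2) by (rule gset_class_eqI[OF E(1)])
qed

lemma mark_eq_ghost: "mark P = ghost gset_mark P"
  unfolding mark_def ghost_def gset_mark_def ..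

section \<open>Restriction and the Cauchy-Frobenius congruence\<close>

lemma fixed_points_image: "fixed_points R E (\<lambda>g. \<alpha> (\<phi> g)) = fixed_points (\<phi> ` R) E \<alpha>"
  by (simp add: fixed_points_def)

context group
begin

lemma finite_action_hom:
  assumes "finite_action G E \<alpha>" "group H" "\<phi> \<in> hom H G"
  shows "finite_action H E (\<lambda>g. \<alpha> (\<phi> g))"
proof -
  interpret \<phi>: group_hom H G \<phi>
    using assms(2,3) by (simp add: group_hom_def group_hom_axioms_def group_axioms)
  show ?thesis
    using finite_actionD[OF assms(1)] by (simp add: finite_action_def)
qed

context
  fixes P \<phi>
  assumes finite: "finite (carrier G)" and P: "subgroup P G"
    and \<phi>: "\<phi> \<in> hom (G\<lparr>carrier := P\<rparr>) G"
begin

lemma group_restricted: "group (G\<lparr>carrier := P\<rparr>)"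
  using P by (rule subgroup_imp_group)

lemma finite_restricted: "finite (carrier (G\<lparr>carrier := P\<rparr>))"
  using finite_subset[OF subgroup.subset[OF P] finite] by simp

lemma subgroup_image:
  assumes "subgroup R (G\<lparr>carrier := P\<rparr>)"
  shows "subgroup (\<phi> ` R) G"
proof -
  interpret \<phi>: group_hom "G\<lparr>carrier := P\<rparr>" G \<phi>
    using \<phi> group_restricted by (simp add: group_hom_def group_hom_axioms_def group_axioms)
  show ?thesis
    using assms by (rule \<phi>.subgroup_img_is_subgroup)
qed

lemma restrict_gset_class_eq:
  assumes "finite_action G E \<alpha>"
  shows "restrict_gset_class G P \<phi> (gset_class G E \<alpha>) = gset_class (G\<lparr>carrier := P\<rparr>) E (\<lambda>g. \<alpha> (\<phi> g))"
proof -
  have "gset_class (G\<lparr>carrier := P\<rparr>) D (\<lambda>g. \<beta> (\<phi> g)) = gset_class (G\<lparr>carrier := P\<rparr>) E (\<lambda>g. \<alpha> (\<phi> g))"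
    if D: "(D, \<beta>) \<in> gset_class G E \<alpha>" for D \<beta>
  proof (rule gset_class_eqI[symmetric])
    show "finite_action (G\<lparr>carrier := P\<rparr>) E (\<lambda>g. \<alpha> (\<phi> g))"
      using assms group_restricted \<phi> by (rule finite_action_hom)
    obtain h where h: "bij_betw h E D" "\<forall>g\<in>carrier G. \<forall>x\<in>E. h (\<alpha> g x) = \<beta> g (h x)"
      using gset_class_memD(3)[OF D] unfolding gset_iso_def by blast
    have "\<phi> g \<in> carrier G" if "g \<in> P" for g
      using \<phi> that by (auto simp: hom_def)
    then show "gset_iso (G\<lparr>carrier := P\<rparr>) E (\<lambda>g. \<alpha> (\<phi> g)) D (\<lambda>g. \<beta> (\<phi> g))"
      using h unfolding gset_iso_def by (intro exI[of _ h]) auto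
  qed
  then have "restrict_gset_class G P \<phi> (gset_class G E \<alpha>) =
      (\<Union>c\<in>gset_class G E \<alpha>. gset_class (G\<lparr>carrier := P\<rparr>) E (\<lambda>g. \<alpha> (\<phi> g)))"
    unfolding restrict_gset_class_def by (intro SUP_cong refl) auto
  moreover obtain D \<beta> where "(D, \<beta>) \<in> gset_class G E \<alpha>"
    using gset_class_rep[OF group_axioms assms] .
  ultimately show ?thesis
    by auto
qed

lemma restrict_gset_class_closed:
  assumes "c \<in> carrier (burnside_semiring G)"
  shows "restrict_gset_class G P \<phi> c \<in> carrier (burnside_semiring (G\<lparr>carrier := P\<rparr>))"
proof -
  obtain E :: "nat set" and \<alpha> where E: "finite_action G E \<alpha>" "c = gset_class G E \<alpha>"
    using assms by (rule burnside_carrierE)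
  show ?thesis
    unfolding E(2) restrict_gset_class_eq[OF E(1)]
    by (rule burnside_carrierI[OF group_restricted finite_action_hom[OF E(1) group_restricted \<phi>]])
qed

lemma gset_mark_restrict:
  assumes "c \<in> carrier (burnside_semiring G)" and R: "subgroup R (G\<lparr>carrier := P\<rparr>)"
  shows "gset_mark R (restrict_gset_class G P \<phi> c) = gset_mark (\<phi> ` R) c"
proof -
  obtain E :: "nat set" and \<alpha> where E: "finite_action G E \<alpha>" "c = gset_class G E \<alpha>"
    using assms(1) by (rule burnside_carrierE)
  show ?thesis
    unfolding E(2) restrict_gset_class_eq[OF E(1)]
      gset_mark_class[OF group_restricted finite_action_hom[OF E(1) group_restricted \<phi>] subgroup.subset[OF R]]
      gset_mark_class[OF group_axioms E(1) subgroup.subset[OF subgroup_image[OF R]]]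
    by (simp add: fixed_points_image)
qed

text \<open>Restriction along \<phi> reindexes marks by R \<mapsto> \<phi>(R) on genuine sets, which
  is the compatibility required for extending it to formal differences.\<close>

lemma
  assumes "x \<in> carrier (burnside_ring G)"
  shows burnside_restrict_closed: "burnside_restrict G P \<phi> x \<in> carrier (burnside_ring (G\<lparr>carrier := P\<rparr>))"
    and mark_restrict: "subgroup R (G\<lparr>carrier := P\<rparr>) \<Longrightarrow>
      mark R (burnside_restrict G P \<phi> x) = mark (\<phi> ` R) x"
  unfolding burnside_restrict_def burnside_ring_def mark_eq_ghost
  using assms unfolding burnside_ring_def
  by (intro groth_extend_ghost[OF burnside_ghost_semiring[OF group_axioms finite]
        burnside_ghost_semiring[OF group_restricted finite_restricted], where k = "(`) \<phi>"];
      simp add: restrict_gset_class_closed gset_mark_restrict subgroup_image)+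

end

text \<open>Marks separate the elements of the Burnside ring of \<open>P\<close>. This is what turns
  stability, an equation between restrictions, into equations between integers.\<close>

lemma burnside_restrict_eq_iff:
  assumes "finite (carrier G)" "subgroup P G"
    and "\<phi> \<in> hom (G\<lparr>carrier := P\<rparr>) G" "\<psi> \<in> hom (G\<lparr>carrier := P\<rparr>) G"
    and x: "x \<in> carrier (burnside_ring G)"
  shows "burnside_restrict G P \<phi> x = burnside_restrict G P \<psi> x \<longleftrightarrow>
    (\<forall>R. subgroup R (G\<lparr>carrier := P\<rparr>) \<longrightarrow> mark (\<phi> ` R) x = mark (\<psi> ` R) x)"
    (is "?L \<longleftrightarrow> ?R")
proof
  note \<phi> = mark_restrict[OF assms(1,2,3) x] burnside_restrict_closed[OF assms(1,2,3) x]
  note \<psi> = mark_restrict[OF assms(1,2,4) x] burnside_restrict_closed[OF assms(1,2,4) x]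
  show ?R if ?L
  proof (intro allI impI)
    fix R assume R: "subgroup R (G\<lparr>carrier := P\<rparr>)"
    show "mark (\<phi> ` R) x = mark (\<psi> ` R) x"
      using \<phi>(1)[OF R] \<psi>(1)[OF R] that by simp
  qed
  interpret ghost_semiring "burnside_semiring (G\<lparr>carrier := P\<rparr>)"
      "{R. subgroup R (G\<lparr>carrier := P\<rparr>)}" gset_mark
    using group_restricted[OF assms(1-3)] finite_restricted[OF assms(1-3)] by (rule burnside_ghost_semiring)
  show ?L if ?R
    by (rule ghost_inj[folded burnside_ring_def, OF \<phi>(2) \<psi>(2)])
      (use that \<phi>(1) \<psi>(1) in \<open>simp flip: mark_eq_ghost\<close>)
qed

section \<open>Fixed-point congruences of Cauchy-Frobenius type\<close>

lemma fixed_points_generate: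
  assumes "finite_action G E \<alpha>" "A \<subseteq> carrier G"
  shows "fixed_points (generate G A) E \<alpha> = fixed_points A E \<alpha>"
proof
  show "fixed_points (generate G A) E \<alpha> \<subseteq> fixed_points A E \<alpha>"
    using generate.incl[of _ A G] by (auto simp: fixed_points_def)
  show "fixed_points A E \<alpha> \<subseteq> fixed_points (generate G A) E \<alpha>"
  proof
    fix x assume x: "x \<in> fixed_points A E \<alpha>"
    then have "A \<subseteq> stabilizer G \<alpha> x"
      using assms(2) by (auto simp: fixed_points_def stabilizer_def)
    then have "generate G A \<subseteq> stabilizer G \<alpha> x"
      using finite_action_stabilizer[OF group_axioms assms(1)] x
      by (intro generate_subgroup_incl) (auto simp: fixed_points_def)
    then show "x \<in> fixed_points (generate G A) E \<alpha>"
      using x by (auto simp: fixed_points_def stabilizer_def)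
  qed
qed

text \<open>The sum counts pairs of a group element and a point it fixes. Counted by points, each
  orbit contributes exactly |G| by the orbit-stabilizer theorem.\<close>

lemma order_dvd_sum_fixed_points:
  assumes "finite (carrier G)" "finite_action G E \<alpha>"
  shows "order G dvd (\<Sum>g\<in>carrier G. card (fixed_points {g} E \<alpha>))"
proof -
  define \<phi> where "\<phi> g = (\<lambda>x\<in>E. \<alpha> g x)" for g
  have "gset G E \<phi>"
    unfolding \<phi>_def using group_axioms assms(2) by (rule finite_action_gset)
  then have fin: "finite E" and act: "group_action G E \<phi>"
    by (simp_all add: gset_def)
  interpret group_action G E \<phi> by (rule act)
  have "(\<Sum>g\<in>carrier G. card (fixed_points {g} E \<alpha>)) =
      (\<Sum>g\<in>carrier G. \<Sum>x\<in>E. if \<phi> g x = x then 1 else 0)"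
  proof (rule sum.cong[OF refl])
    fix g
    have "fixed_points {g} E \<alpha> = {x \<in> E. \<phi> g x = x}"
      by (auto simp: fixed_points_def \<phi>_def)
    then show "card (fixed_points {g} E \<alpha>) = (\<Sum>x\<in>E. if \<phi> g x = x then 1 else 0)"
      using fin by (simp add: sum.If_cases Int_def)
  qed
  also have "\<dots> = (\<Sum>x\<in>E. card (stabilizer G \<phi> x))"
    by (subst sum.swap, rule sum.cong)
      (use assms(1) in \<open>auto simp: sum.If_cases stabilizer_def Int_def\<close>)
  also have "\<dots> = (\<Sum>orb\<in>orbits G E \<phi>. \<Sum>x\<in>orb. card (stabilizer G \<phi> x))"
    by (rule disjoint_sum[OF fin, symmetric])
  also have "\<dots> = (\<Sum>orb\<in>orbits G E \<phi>. order G)"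
  proof (rule sum.cong[OF refl])
    fix orb assume "orb \<in> orbits G E \<phi>"
    then obtain x where x: "x \<in> E" "orb = orbit G \<phi> x"
      by (auto simp: orbits_def)
    have sub: "orb \<subseteq> E"
      using x element_image by (auto simp: orbit_def)
    have orb_eq: "orbit G \<phi> y = orb" if "y \<in> orb" for y
    proof -
      have y: "y \<in> E" "orbit G \<phi> y \<in> orbits G E \<phi>"
        using that sub by (auto simp: orbits_def)
      have "y \<in> orbit G \<phi> y \<inter> orb"
        using that orbit_refl[OF y(1)] by simp
      then show ?thesis
        using disjoint_union[OF y(2) \<open>orb \<in> orbits G E \<phi>\<close>] by auto
    qed
    \<comment> \<open>Multiplying by the orbit length avoids a division: each summand becomes |G|,
      and the positive factor is cancelled afterwards.\<close>
    have "card orb * (\<Sum>y\<in>orb. card (stabilizer G \<phi> y)) = (\<Sum>y\<in>orb. order G)"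
      unfolding sum_distrib_left
      using orbit_stabilizer_theorem orb_eq sub by (intro sum.cong refl) (auto simp: subset_iff)
    moreover have "card orb > 0"
      using x orbit_refl[OF x(1)] finite_subset[OF sub fin] by (auto simp: card_gt_0_iff)
    ultimately show "(\<Sum>y\<in>orb. card (stabilizer G \<phi> y)) = order G"
      by simp
  qed
  finally show ?thesis
    by simp
qed

text \<open>Normality lets G act on the points fixed by K, and the preceding count is applied to
  that action. The summand is constant on cosets of K, so this is |K| times the congruence for G/K,
  stated without forming the quotient.\<close>

lemma order_dvd_sum_fixed_points_normal:
  assumes "finite (carrier G)" "finite_action G E \<alpha>" "K \<lhd> G"
  shows "order G dvd (\<Sum>g\<in>carrier G. card (fixed_points (insert g K) E \<alpha>))"
proof -
  interpret K: normal K G by fact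
  note actD = finite_actionD[OF assms(2)]
  have "finite_action G (fixed_points K E \<alpha>) \<alpha>"
  proof (rule finite_action_subset[OF assms(2)])
    fix g x assume g: "g \<in> carrier G" and "x \<in> fixed_points K E \<alpha>"
    then have x: "x \<in> E" and fx: "\<And>k. k \<in> K \<Longrightarrow> \<alpha> k x = x"
      by (auto simp: fixed_points_def)
    have "\<alpha> k (\<alpha> g x) = \<alpha> g x" if k: "k \<in> K" for k
    proof -
      have kc: "k \<in> carrier G"
        using K.subset k by auto
      have cl: "inv g \<otimes> k \<otimes> g \<in> K"
        using K.inv_op_closed1[OF g k] .
      have "k \<otimes> g = g \<otimes> (inv g \<otimes> k \<otimes> g)"
        using g kc by (simp flip: m_assoc)
      then have "\<alpha> k (\<alpha> g x) = \<alpha> (g \<otimes> (inv g \<otimes> k \<otimes> g)) x"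
        using actD(4)[OF kc g x] by simp
      also have "\<dots> = \<alpha> g (\<alpha> (inv g \<otimes> k \<otimes> g) x)"
        using g kc x by (intro actD(4)) auto
      finally show ?thesis
        using fx[OF cl] by simp
    qed
    then show "\<alpha> g x \<in> fixed_points K E \<alpha>"
      using actD(2)[OF g x] by (simp add: fixed_points_def)
  qed (auto simp: fixed_points_def)
  then have "order G dvd (\<Sum>g\<in>carrier G. card (fixed_points {g} (fixed_points K E \<alpha>) \<alpha>))"
    by (rule order_dvd_sum_fixed_points[OF assms(1)])
  moreover have "fixed_points {g} (fixed_points K E \<alpha>) \<alpha> = fixed_points (insert g K) E \<alpha>" for g
    by (auto simp: fixed_points_def)
  ultimately show ?thesis
    by simp
qed

end

section \<open>Normalizers, coset actions and Sylow conjugation\<close>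

context group
begin

lemma rcoset_eq_iff:
  assumes "subgroup H G" "a \<in> carrier G" "b \<in> carrier G"
  shows "H #> a = H #> b \<longleftrightarrow> a \<otimes> inv b \<in> H"
  using subgroup.rcos_module[OF assms(1) group_axioms assms(3,2)]
    rcos_self[OF assms(2,1)] repr_independence[OF _ assms(3,1), of a]
  by auto

lemma rcoset_fixed_iff:
  assumes "subgroup H G" "g \<in> carrier G" "k \<in> carrier G"
  shows "(H #> g) #> inv k = H #> g \<longleftrightarrow> g \<otimes> k \<otimes> inv g \<in> H"
proof -
  have "(H #> g) #> inv k = H #> (g \<otimes> inv k)"
    using assms subgroup.subset[OF assms(1)] by (simp add: coset_mult_assoc)
  then have "(H #> g) #> inv k = H #> g \<longleftrightarrow> g \<otimes> inv k \<otimes> inv g \<in> H"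
    using assms by (simp add: rcoset_eq_iff)
  also have "\<dots> \<longleftrightarrow> inv (g \<otimes> inv k \<otimes> inv g) \<in> H"
    using assms subgroup.m_inv_closed[OF assms(1)] by (metis inv_closed inv_inv m_closed)
  also have "inv (g \<otimes> inv k \<otimes> inv g) = g \<otimes> k \<otimes> inv g"
    using assms by (simp add: inv_mult_group m_assoc)
  finally show ?thesis .
qed

text \<open>Inversion turns right cosets into left cosets and identifies this with the usual action
  on G/H by left translation.\<close>

lemma finite_action_rcosets:
  assumes "finite (carrier G)" "subgroup H G"
  shows "finite_action G (rcosets H) (\<lambda>g C. C #> inv g)"
proof -
  have sub: "H \<subseteq> carrier G"
    by (rule subgroup.subset[OF assms(2)])
  have E: "C \<in> rcosets H \<longleftrightarrow> (\<exists>a\<in>carrier G. C = H #> a)" for C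
    by (auto simp: RCOSETS_def)
  have mult: "(H #> a) #> b = H #> (a \<otimes> b)" if "a \<in> carrier G" "b \<in> carrier G" for a b
    using that sub by (simp add: coset_mult_assoc)
  have "finite (rcosets H)"
    using assms(1) by (auto simp: RCOSETS_def)
  moreover have "(H #> a) #> inv g \<in> rcosets H" if "g \<in> carrier G" "a \<in> carrier G" for g a
    unfolding E using that by (intro bexI[of _ "a \<otimes> inv g"]) (simp_all add: mult)
  moreover have "(H #> a) #> inv (g \<otimes> h) = ((H #> a) #> inv h) #> inv g"
    if "g \<in> carrier G" "h \<in> carrier G" "a \<in> carrier G" for g h a
    using that by (simp add: mult inv_mult_group m_assoc)
  ultimately show ?thesis
    unfolding finite_action_def Ball_def E by (auto simp: mult)
qed

lemma fixed_points_rcosets: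
  assumes "subgroup H G" "K \<subseteq> carrier G"
  shows "fixed_points K (rcosets H) (\<lambda>g C. C #> inv g) =
    (#>) H ` {g \<in> carrier G. \<forall>k\<in>K. g \<otimes> k \<otimes> inv g \<in> H}"
proof -
  have "fixed_points K (rcosets H) (\<lambda>g C. C #> inv g) =
      (#>) H ` {g \<in> carrier G. \<forall>k\<in>K. (H #> g) #> inv k = H #> g}"
    unfolding fixed_points_def RCOSETS_def by blast
  moreover have "(\<forall>k\<in>K. (H #> g) #> inv k = H #> g) \<longleftrightarrow> (\<forall>k\<in>K. g \<otimes> k \<otimes> inv g \<in> H)"
    if "g \<in> carrier G" for g
    using assms(2) by (intro ball_cong refl rcoset_fixed_iff[OF assms(1) that]) blast
  ultimately show ?thesis
    by (simp cong: conj_cong)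
qed

lemma inj_on_conjugation:
  assumes "g \<in> carrier G" "P \<subseteq> carrier G"
  shows "inj_on (\<lambda>x. g \<otimes> x \<otimes> inv g) P"
  using assms by (auto intro!: inj_onI simp: subset_iff)

text \<open>Conjugation is injective and \<open>P\<close> is finite, so mapping \<open>P\<close>
  into itself already means mapping it onto itself.\<close>

lemma normalizer_iff:
  assumes "finite (carrier G)" "subgroup P G"
  shows "g \<in> normalizer G P \<longleftrightarrow> g \<in> carrier G \<and> (\<forall>x\<in>P. g \<otimes> x \<otimes> inv g \<in> P)"
proof -
  have sub: "P \<subseteq> carrier G"
    by (rule subgroup.subset[OF assms(2)])
  then have fin: "finite P"
    using assms(1) finite_subset by blast
  have eq: "g <# P #> inv g = (\<lambda>x. g \<otimes> x \<otimes> inv g) ` P"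
    by (auto simp: l_coset_def r_coset_def)
  have "g <# P #> inv g = P \<longleftrightarrow> (\<forall>x\<in>P. g \<otimes> x \<otimes> inv g \<in> P)" if "g \<in> carrier G"
    unfolding eq using endo_inj_surj[OF fin _ inj_on_conjugation[OF that sub]] by blast
  then show ?thesis
    using sub by (auto simp: normalizer_def stabilizer_def)
qed

lemma normalizer_subgroup: "subgroup P G \<Longrightarrow> subgroup (normalizer G P) G"
  by (rule normalizer_imp_subgroup[OF subgroup.subset])

lemma subgroup_subset_normalizer:
  assumes "finite (carrier G)" "subgroup P G"
  shows "P \<subseteq> normalizer G P"
  using assms subgroup.subset[OF assms(2)]
  by (auto simp: normalizer_iff subgroup.m_closed subgroup.m_inv_closed)

lemma normal_in_normalizer:
  assumes "finite (carrier G)" "subgroup P G"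
  shows "P \<lhd> G\<lparr>carrier := normalizer G P\<rparr>"
proof (rule group.normal_invI[OF subgroup_imp_group[OF normalizer_subgroup[OF assms(2)]]])
  show "subgroup P (G\<lparr>carrier := normalizer G P\<rparr>)"
    using subgroup_incl[OF assms(2) normalizer_subgroup[OF assms(2)]]
      subgroup_subset_normalizer[OF assms] by blast
  fix x h assume x: "x \<in> carrier (G\<lparr>carrier := normalizer G P\<rparr>)" and "h \<in> P"
  then show "x \<otimes>\<^bsub>G\<lparr>carrier := normalizer G P\<rparr>\<^esub> h \<otimes>\<^bsub>G\<lparr>carrier := normalizer G P\<rparr>\<^esub>
      inv\<^bsub>G\<lparr>carrier := normalizer G P\<rparr>\<^esub> x \<in> P"
    using m_inv_consistent[OF normalizer_subgroup[OF assms(2)]] normalizer_iff[OF assms] by simp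
qed

lemma card_normalizer:
  assumes "finite (carrier G)" "subgroup P G"
  shows "card (normalizer G P) = order (weyl_group G P) * card P"
proof -
  interpret N: group "G\<lparr>carrier := normalizer G P\<rparr>"
    by (rule subgroup_imp_group[OF normalizer_subgroup[OF assms(2)]])
  show ?thesis
    using N.lagrange[OF normal_imp_subgroup[OF normal_in_normalizer[OF assms]]]
    by (simp add: weyl_group_def FactGroup_def order_def)
qed

text \<open>Since \<open>u\<close> is constant on each coset, \<open>the_elem\<close> picks out that
  constant. This links sums over a group with the sum over cosets in the definition of
  \<open>psi\<close>.\<close>

lemma sum_rcosets:
  fixes u :: "'a \<Rightarrow> int"
  assumes fin: "finite (carrier G)" and H: "subgroup H G"
    and u: "\<And>h g. \<lbrakk>h \<in> H; g \<in> carrier G\<rbrakk> \<Longrightarrow> u (h \<otimes> g) = u g"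
  shows "(\<Sum>g\<in>carrier G. u g) = int (card H) * (\<Sum>C\<in>rcosets H. the_elem (u ` C))"
proof -
  have finH: "finite C" if "C \<in> rcosets H" for C
    using that rcosets_part_G[OF H] fin by (metis Union_upper finite_subset)
  have "(\<Sum>g\<in>carrier G. u g) = (\<Sum>C\<in>rcosets H. sum u C)"
    using sum.Union_disjoint[of "rcosets H" u] finH rcos_disjoint[OF H] rcosets_part_G[OF H]
    by (auto simp: pairwise_def disjnt_def)
  also have "\<dots> = (\<Sum>C\<in>rcosets H. int (card H) * the_elem (u ` C))"
  proof (rule sum.cong[OF refl])
    fix C assume C: "C \<in> rcosets H"
    then obtain a where a: "a \<in> carrier G" "C = H #> a"
      by (auto simp: RCOSETS_def)
    have const: "u x = u a" if "x \<in> C" for x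
      using that a u by (auto simp: r_coset_def)
    have "a \<in> C"
      using rcos_self[OF a(1) H] a(2) by simp
    have "u ` C = (\<lambda>_. u a) ` C"
      by (rule image_cong[OF refl const])
    also have "\<dots> = {u a}"
      using \<open>a \<in> C\<close> by auto
    finally have "u ` C = {u a}" .
    moreover have "sum u C = (\<Sum>x\<in>C. u a)"
      by (rule sum.cong[OF refl const])
    moreover have "card C = card H"
      using card_cosets_equal[OF C subgroup.subset[OF H]] by (auto dest: bij_betw_same_card)
    ultimately show "sum u C = int (card H) * the_elem (u ` C)"
      by simp
  qed
  finally show ?thesis
    by (simp add: sum_distrib_left)
qed

text \<open>The coset of g is fixed by \<open>P\<close> exactly when g normalizes \<open>P\<close>.
  This is the diagonal entry of the table of marks, hence the modulus in every congruence
  below.\<close>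

lemma card_fixed_points_rcosets_self:
  assumes "finite (carrier G)" "subgroup P G"
  shows "card (fixed_points P (rcosets P) (\<lambda>g C. C #> inv g)) = order (weyl_group G P)"
proof -
  have "{g \<in> carrier G. \<forall>k\<in>P. g \<otimes> k \<otimes> inv g \<in> P} = normalizer G P"
    using normalizer_iff[OF assms] by auto
  moreover have "carrier (weyl_group G P) = (#>) P ` normalizer G P"
    by (auto simp: weyl_group_def carrier_FactGroup)
  ultimately show ?thesis
    by (simp add: fixed_points_rcosets[OF assms(2) subgroup.subset[OF assms(2)]] order_def)
qed

section \<open>Conjugation into a Sylow subgroup\<close>

lemma fixed_points_rcosets_nonempty:
  assumes "fixed_points K (rcosets H) (\<lambda>g C. C #> inv g) \<noteq> {}" "subgroup H G" "K \<subseteq> carrier G"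
  obtains g where "g \<in> carrier G" "(\<lambda>x. g \<otimes> x \<otimes> inv g) ` K \<subseteq> H"
  using assms(1) unfolding fixed_points_rcosets[OF assms(2,3)] by (auto intro: that)

text \<open>The p-group \<open>L\<close> acts through \<kappa> on the cosets of \<open>H\<close>.
  Their number is prime to p while orbit lengths are powers of p, so some coset is fixed, and a
  representative of it conjugates the image of \<kappa> into \<open>H\<close>.\<close>

lemma sylow_conjugation:
  assumes "finite (carrier G)" "Factorial_Ring.prime p"
    and H: "sylow_subgroup p G H" and L: "group L" "order L = p ^ m" "\<kappa> \<in> hom L G"
  obtains g where "g \<in> carrier G" "\<And>l. l \<in> carrier L \<Longrightarrow> g \<otimes> \<kappa> l \<otimes> inv g \<in> H"
proof -
  have subH: "subgroup H G" and cardH: "card H = p ^ multiplicity p (order G)"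
    using H by (auto simp: sylow_subgroup_def)
  have act: "finite_action L (rcosets H) (\<lambda>l C. C #> inv (\<kappa> l))"
    using finite_action_rcosets[OF assms(1) subH] L(1,3) by (rule finite_action_hom)
  define \<phi> where "\<phi> l = (\<lambda>C\<in>rcosets H. C #> inv (\<kappa> l))" for l
  have "gset L (rcosets H) \<phi>"
    unfolding \<phi>_def by (rule finite_action_gset[OF L(1) act])
  then have fin: "finite (rcosets H)" and act: "group_action L (rcosets H) \<phi>"
    by (simp_all add: gset_def)
  interpret A: group_action L "rcosets H" \<phi>
    by (rule act)
  have order: "order G \<noteq> 0"
    using assms(1) by (simp add: order_gt_0_iff_finite)
  have lag: "card (rcosets H) * p ^ multiplicity p (order G) = order G"
    using lagrange[OF subH] cardH by simp
  have "\<not> p dvd card (rcosets H)"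
  proof
    assume "p dvd card (rcosets H)"
    then have "p ^ Suc (multiplicity p (order G)) dvd order G"
      unfolding power_Suc using mult_dvd_mono[OF _ dvd_refl] lag by metis
    then have "Suc (multiplicity p (order G)) \<le> multiplicity p (order G)"
      using order assms(2) by (intro multiplicity_geI) (auto simp: not_prime_unit)
    then show False
      by simp
  qed
  moreover have "card (rcosets H) = (\<Sum>orb\<in>orbits L (rcosets H) \<phi>. card orb)"
    using A.disjoint_sum[OF fin, of "\<lambda>_. 1 :: nat"] by simp
  ultimately obtain orb where orb: "orb \<in> orbits L (rcosets H) \<phi>" "\<not> p dvd card orb"
    using dvd_sum[of "orbits L (rcosets H) \<phi>" p card] by auto
  then obtain C where C: "C \<in> rcosets H" "orb = orbit L \<phi> C"
    by (auto simp: orbits_def)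
  have "card orb dvd p ^ m"
    unfolding L(2)[symmetric] C(2)
    by (rule dvdI[OF A.orbit_stabilizer_theorem[OF C(1), symmetric]])
  then obtain j where "card orb = p ^ j"
    using assms(2) by (auto simp: divides_primepow_nat)
  then have "card orb = 1"
    using orb(2) by (cases j) auto
  then obtain D where D: "orb = {D}"
    by (rule card_1_singletonE)
  have "\<phi> l C = C" if "l \<in> carrier L" for l
  proof -
    have "\<phi> l C \<in> orb" "C \<in> orb"
      using that A.orbit_refl[OF C(1)] C(2) by (auto simp: orbit_def)
    then show ?thesis
      using D by simp
  qed
  then have "C \<in> fixed_points (\<kappa> ` carrier L) (rcosets H) (\<lambda>g C. C #> inv g)"
    using C(1) by (auto simp: fixed_points_def \<phi>_def)
  then have "fixed_points (\<kappa> ` carrier L) (rcosets H) (\<lambda>g C. C #> inv g) \<noteq> {}"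
    by blast
  moreover have "\<kappa> ` carrier L \<subseteq> carrier G"
    using L(3) by (auto simp: hom_def)
  ultimately obtain g where "g \<in> carrier G" "(\<lambda>x. g \<otimes> x \<otimes> inv g) ` \<kappa> ` carrier L \<subseteq> H"
    by (rule fixed_points_rcosets_nonempty[OF _ subH])
  then show thesis
    by (intro that) auto
qed

end

section \<open>Fusion systems\<close>

context fusion_system
begin

lemma subgroup_finite: "subgroup P S \<Longrightarrow> finite P"
  using finite_carrier finite_subset subgroup.subset by blast

lemma morphismD:
  assumes "subgroup P S" "subgroup Q S" "\<phi> \<in> F P Q"
  shows "inj_on \<phi> P" "\<phi> \<in> extensional P" "\<phi> ` P \<subseteq> Q" "\<phi> \<in> hom (S\<lparr>carrier := P\<rparr>) S"
    "\<And>x y. \<lbrakk>x \<in> P; y \<in> P\<rbrakk> \<Longrightarrow> \<phi> (x \<otimes> y) = \<phi> x \<otimes> \<phi> y"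
  using morphism[OF assms] subgroup.subset[OF assms(2)] by (auto simp: hom_def)

lemma morphism_image_subgroup:
  assumes "subgroup P S" "subgroup Q S" "\<phi> \<in> F P Q" "subgroup R S" "R \<subseteq> P"
  shows "subgroup (\<phi> ` R) S"
  using subgroup_image[OF finite_carrier assms(1) morphismD(4)[OF assms(1-3)]]
    subgroup_incl[OF assms(4,1,5)] .

lemma inclusion:
  assumes "subgroup P S" "subgroup Q S" "P \<subseteq> Q"
  shows "(\<lambda>x\<in>P. x) \<in> F P Q"
proof -
  have "conj_map S P \<one> = (\<lambda>x\<in>P. x)"
    using subgroup.subset[OF assms(1)] by (auto simp: conj_map_def restrict_def fun_eq_iff)
  then show ?thesis
    using conj[OF assms(1,2) one_closed] assms(3) by auto
qed

lemma restrict_morphism: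
  assumes "subgroup P S" "subgroup Q S" "\<phi> \<in> F P Q" "subgroup R S" "R \<subseteq> P"
  shows "restrict \<phi> R \<in> F R Q"
proof -
  have "compose R \<phi> (\<lambda>x\<in>R. x) = restrict \<phi> R"
    by (auto simp: compose_def restrict_def fun_eq_iff)
  then show ?thesis
    using comp[OF assms(4,1,2) inclusion[OF assms(4,1,5)] assms(3)] by simp
qed

lemma change_codomain:
  assumes "subgroup P S" "subgroup Q S" "\<phi> \<in> F P Q" "subgroup R S" "\<phi> ` P \<subseteq> R"
  shows "\<phi> \<in> F P R"
proof -
  have sub: "subgroup (\<phi> ` P) S"
    by (rule morphism_image_subgroup[OF assms(1-3,1) subset_refl])
  have "compose P (\<lambda>x\<in>\<phi> ` P. x) \<phi> = \<phi>"
    using morphismD(2)[OF assms(1-3)]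
    by (auto simp: compose_def restrict_def fun_eq_iff extensional_def)
  then show ?thesis
    using comp[OF assms(1) sub assms(4) onto_image[OF assms(1-3)] inclusion[OF sub assms(4,5)]]
    by simp
qed

text \<open>The axiom \<open>inverse\<close> makes every morphism with image \<open>Q\<close> an
  isomorphism onto \<open>Q\<close>, so exhibiting one such morphism is enough.\<close>

lemma fusion_conj_class_iff:
  assumes "subgroup P S"
  shows "Q \<in> fusion_conj_class S F P \<longleftrightarrow> subgroup Q S \<and> (\<exists>\<phi>\<in>F P Q. \<phi> ` P = Q)"
proof (intro iffI conjI; (elim conjE)?)
  assume "Q \<in> fusion_conj_class S F P"
  then obtain \<phi> \<psi> where Q: "subgroup Q S" and \<phi>: "\<phi> \<in> F P Q" "\<psi> \<in> F Q P"
    and eq: "compose Q \<phi> \<psi> = (\<lambda>x\<in>Q. x)"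
    by (auto simp: fusion_conj_class_def)
  show "subgroup Q S" by (rule Q)
  have "x \<in> \<phi> ` P" if "x \<in> Q" for x
    using fun_cong[OF eq, of x] that morphismD(3)[OF Q assms \<phi>(2)]
    by (auto simp: compose_def intro!: image_eqI[of x \<phi> "\<psi> x"])
  then show "\<exists>\<phi>\<in>F P Q. \<phi> ` P = Q"
    using \<phi>(1) morphismD(3)[OF assms Q \<phi>(1)] by (intro bexI[of _ \<phi>]) auto
next
  assume Q: "subgroup Q S" and "\<exists>\<phi>\<in>F P Q. \<phi> ` P = Q"
  then obtain \<phi> where \<phi>: "\<phi> \<in> F P Q" "\<phi> ` P = Q"
    by blast
  let ?\<psi> = "restrict (inv_into P \<phi>) Q"
  have inj: "inj_on \<phi> P"
    by (rule morphismD(1)[OF assms Q \<phi>(1)])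
  have "?\<psi> \<in> F Q P"
    using inverse[OF assms Q \<phi>(1)] \<phi>(2) by simp
  moreover have "compose P ?\<psi> \<phi> = (\<lambda>x\<in>P. x)"
    using inj \<phi>(2) by (auto simp: compose_def restrict_def fun_eq_iff)
  moreover have "compose Q \<phi> ?\<psi> = (\<lambda>x\<in>Q. x)"
    using \<phi>(2) by (auto simp: compose_def restrict_def fun_eq_iff f_inv_into_f)
  ultimately show "Q \<in> fusion_conj_class S F P"
    using Q \<phi>(1) unfolding fusion_conj_class_def by blast
qed

lemma fusion_conj_class_subgroup: "Q \<in> fusion_conj_class S F P \<Longrightarrow> subgroup Q S"
  by (simp add: fusion_conj_class_def)

lemma fusion_conj_class_self:
  assumes "subgroup P S"
  shows "P \<in> fusion_conj_class S F P"
  unfolding fusion_conj_class_iff[OF assms]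
  using assms inclusion[OF assms assms subset_refl]
  by (intro conjI bexI[of _ "\<lambda>x\<in>P. x"]) auto

lemma fusion_conj_class_sym:
  assumes "subgroup P S" "Q \<in> fusion_conj_class S F P"
  shows "P \<in> fusion_conj_class S F Q"
  using assms unfolding fusion_conj_class_def by blast

lemma fusion_conj_class_trans:
  assumes P: "subgroup P S" and Q: "Q \<in> fusion_conj_class S F P" and R: "R \<in> fusion_conj_class S F Q"
  shows "R \<in> fusion_conj_class S F P"
proof -
  note subQ = fusion_conj_class_subgroup[OF Q] and subR = fusion_conj_class_subgroup[OF R]
  obtain \<phi> where \<phi>: "\<phi> \<in> F P Q" "\<phi> ` P = Q"
    using Q unfolding fusion_conj_class_iff[OF P] by blast
  obtain \<psi> where \<psi>: "\<psi> \<in> F Q R" "\<psi> ` Q = R"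
    using R unfolding fusion_conj_class_iff[OF subQ] by blast
  have "compose P \<psi> \<phi> ` P = R"
    using \<phi>(2) \<psi>(2) by (auto simp: compose_def image_image[symmetric])
  then show ?thesis
    unfolding fusion_conj_class_iff[OF P] using subR comp[OF P subQ subR \<phi>(1) \<psi>(1)] by blast
qed

lemma fusion_conj_class_eq:
  assumes "subgroup P S" "Q \<in> fusion_conj_class S F P"
  shows "fusion_conj_class S F Q = fusion_conj_class S F P"
  using fusion_conj_class_trans[OF assms] fusion_conj_class_sym[OF assms]
    fusion_conj_class_trans[OF fusion_conj_class_subgroup[OF assms(2)]]
  by blast

lemma fusion_conj_class_card:
  assumes "subgroup P S" "Q \<in> fusion_conj_class S F P"
  shows "card Q = card P"
  using assms morphismD(1)[OF assms(1) fusion_conj_class_subgroup[OF assms(2)]]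
  unfolding fusion_conj_class_iff[OF assms(1)] by (metis card_image)

lemma morphism_image_class:
  assumes "subgroup P S" "subgroup Q S" "\<phi> \<in> F P Q" "subgroup R S" "R \<subseteq> P"
  shows "\<phi> ` R \<in> fusion_conj_class S F R"
proof -
  have r: "restrict \<phi> R \<in> F R (\<phi> ` R)"
    using onto_image[OF assms(4,2) restrict_morphism[OF assms]] by simp
  show ?thesis
    unfolding fusion_conj_class_iff[OF assms(4)]
    using morphism_image_subgroup[OF assms] r by (intro conjI bexI[of _ "restrict \<phi> R"]) auto
qed

text \<open>Conjugation in S belongs to the fusion system, so functions on fusion classes are in
  particular constant on S-conjugacy classes.\<close>

lemma conj_image_class:
  assumes "subgroup P S" "g \<in> carrier S"
  shows "(\<lambda>x. g \<otimes> x \<otimes> inv g) ` P \<in> fusion_conj_class S F P"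
proof -
  have "conj_map S P g ` P \<subseteq> carrier S"
    using assms subgroup.subset[OF assms(1)] by (auto simp: conj_map_def)
  then have "conj_map S P g \<in> F P (carrier S)"
    by (rule conj[OF assms(1) subgroup_self assms(2)])
  from morphism_image_class[OF assms(1) subgroup_self this assms(1) subset_refl]
  show ?thesis
    by (simp add: conj_map_def)
qed

text \<open>An injective endomorphism of a finite group is bijective, so the endomorphisms in
  \<open>F\<close> form a subgroup of the finite group of permutations of \<open>P\<close>. This
  prepares the use of Sylow's theorem there.\<close>

lemma Aut_F_group:
  assumes P: "subgroup P S"
  shows "group (Aut_F F P)" "F P P \<subseteq> Bij P" "\<And>\<phi>. \<phi> \<in> F P P \<Longrightarrow> \<phi> ` P = P" "finite (F P P)"
proof -
  show im: "\<phi> ` P = P" if "\<phi> \<in> F P P" for \<phi>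
    using endo_inj_surj[OF subgroup_finite[OF P]] morphismD(1,3)[OF P P that] by blast
  show sub: "F P P \<subseteq> Bij P"
    using im morphismD(1,2)[OF P P] by (auto simp: Bij_def bij_betw_def)
  have "F P P \<subseteq> P \<rightarrow>\<^sub>E P"
    using morphismD(2,3)[OF P P] by (auto simp: PiE_def)
  then show "finite (F P P)"
    using finite_PiE[OF subgroup_finite[OF P]] subgroup_finite[OF P] by (meson finite_subset)
  have "subgroup (F P P) (BijGroup P)"
  proof (rule group.subgroupI[OF group_BijGroup])
    show "F P P \<subseteq> carrier (BijGroup P)" "F P P \<noteq> {}"
      using sub inclusion[OF P P subset_refl] by (auto simp: BijGroup_def)
    fix \<phi> assume \<phi>: "\<phi> \<in> F P P"
    then show "inv\<^bsub>BijGroup P\<^esub> \<phi> \<in> F P P"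
      using inverse[OF P P \<phi>] sub im[OF \<phi>] by (simp add: inv_BijGroup subset_iff)
    fix \<psi> assume "\<psi> \<in> F P P"
    then show "\<phi> \<otimes>\<^bsub>BijGroup P\<^esub> \<psi> \<in> F P P"
      using \<phi> comp[OF P P P] sub by (simp add: BijGroup_def subset_iff)
  qed
  then show "group (Aut_F F P)"
    unfolding Aut_F_def by (rule group.subgroup_imp_group[OF group_BijGroup])
qed

lemma Aut_F_mult:
  assumes "subgroup P S" "\<phi> \<in> F P P" "\<psi> \<in> F P P"
  shows "\<phi> \<otimes>\<^bsub>Aut_F F P\<^esub> \<psi> = compose P \<phi> \<psi>"
  using assms Aut_F_group(2)[OF assms(1)] by (simp add: Aut_F_def BijGroup_def subset_iff)

lemma Aut_F_carrier: "carrier (Aut_F F P) = F P P"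
  by (simp add: Aut_F_def)

lemma order_subgroup_prime_power:
  assumes "subgroup P S"
  obtains m where "card P = p ^ m"
proof -
  obtain n where "order S = p ^ n"
    using p_group by blast
  then have "card P dvd p ^ n"
    using lagrange[OF assms] by (metis dvd_triv_right)
  then show thesis
    using that prime_p by (auto simp: divides_primepow_nat)
qed

end

context saturated_fusion_system
begin

text \<open>
  Transport conjugation by \<open>N\<^sub>S(Q)\<close> to \<open>P\<close> along some isomorphism \<open>\<psi>\<close>. By Sylow's theorem an
  automorphism \<open>\<alpha>\<close> of \<open>P\<close> moves the resulting \<open>p\<close>-group into \<open>Aut\<^sub>S(P)\<close>, so that the
  extension axiom applies to \<open>\<alpha> \<circ> \<psi>\<close> on all of \<open>N\<^sub>S(Q)\<close>.
\<close>

lemma normalizer_morphism: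
  assumes P: "fully_normalized S F P" and Q: "Q \<in> fusion_conj_class S F P"
  obtains \<phi> where "\<phi> \<in> F (normalizer S Q) (carrier S)" "\<phi> ` Q = P"
    "\<phi> ` normalizer S Q \<subseteq> normalizer S P"
proof -
  have subP: "subgroup P S"
    using P by (simp add: fully_normalized_def)
  have subQ: "subgroup Q S"
    by (rule fusion_conj_class_subgroup[OF Q])
  let ?N = "normalizer S Q"
  have subN: "subgroup ?N S" and QN: "Q \<subseteq> ?N"
    using normalizer_subgroup[OF subQ] subgroup_subset_normalizer[OF finite_carrier subQ] by auto
  have centr: "fully_centralized S F P" and syl: "sylow_subgroup p (Aut_F F P) (Aut_S S P)"
    using fully_normalized_sylow[OF subP P] by auto
  interpret A: group "Aut_F F P"
    by (rule Aut_F_group(1)[OF subP])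
  obtain \<psi> where \<psi>: "\<psi> \<in> F Q P" "\<psi> ` Q = P"
    using fusion_conj_class_sym[OF subP Q] unfolding fusion_conj_class_iff[OF subQ] by blast
  define \<psi>' where "\<psi>' = restrict (inv_into Q \<psi>) P"
  have \<psi>': "\<psi>' \<in> F P Q"
    using inverse[OF subQ subP \<psi>(1)] \<psi>(2) by (simp add: \<psi>'_def)
  have \<psi>'\<psi>: "\<psi>' (\<psi> x) = x" "\<psi> x \<in> P" if "x \<in> Q" for x
    using that \<psi>(2) morphismD(1)[OF subQ subP \<psi>(1)] by (auto simp: \<psi>'_def)
  have \<psi>\<psi>': "\<psi> (\<psi>' x) = x" "\<psi>' x \<in> Q" if "x \<in> P" for x
    using that \<psi>(2) by (auto simp: \<psi>'_def f_inv_into_f inv_into_into)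
  have conjQ: "s \<otimes> x \<otimes> inv s \<in> Q" if "s \<in> ?N" "x \<in> Q" for s x
    using that normalizer_iff[OF finite_carrier subQ] by simp
  have Nc: "s \<in> carrier S" if "s \<in> ?N" for s
    using that subgroup.subset[OF subN] by auto
  have Qc: "x \<in> carrier S" if "x \<in> Q" for x
    using that subgroup.subset[OF subQ] by auto
  \<comment> \<open>This is \<psi> c_s \<psi>^-1, regarded as a homomorphism from N(Q), whose order
    is a power of p.\<close>
  define \<kappa> where "\<kappa> s = compose P \<psi> (compose P (conj_map S Q s) \<psi>')" for s
  have \<kappa>_apply: "\<kappa> s x = \<psi> (s \<otimes> \<psi>' x \<otimes> inv s)" if "x \<in> P" for s x
    using that \<psi>\<psi>' by (simp add: \<kappa>_def compose_def conj_map_def)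
  have \<kappa>_closed: "\<kappa> s \<in> F P P" if "s \<in> ?N" for s
  proof -
    have "conj_map S Q s \<in> F Q Q"
      using that conjQ Nc by (intro conj[OF subQ subQ]) (auto simp: conj_map_def)
    then show ?thesis
      unfolding \<kappa>_def by (intro comp[OF subP subQ subP] comp[OF subP subQ subQ] \<psi>' \<psi>(1))
  qed
  have \<kappa>_hom: "\<kappa> \<in> hom (S\<lparr>carrier := ?N\<rparr>) (Aut_F F P)"
  proof (rule homI)
    fix s t assume "s \<in> carrier (S\<lparr>carrier := ?N\<rparr>)" "t \<in> carrier (S\<lparr>carrier := ?N\<rparr>)"
    then have st: "s \<in> ?N" "t \<in> ?N"
      by auto
    have "\<kappa> (s \<otimes> t) x = \<kappa> s (\<kappa> t x)" if x: "x \<in> P" for x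
    proof -
      have q: "\<psi>' x \<in> Q"
        by (rule \<psi>\<psi>'(2)[OF x])
      have "s \<otimes> t \<otimes> \<psi>' x \<otimes> inv (s \<otimes> t) = s \<otimes> (t \<otimes> \<psi>' x \<otimes> inv t) \<otimes> inv s"
        using Nc[OF st(1)] Nc[OF st(2)] Qc[OF q] by (simp add: inv_mult_group m_assoc)
      then show ?thesis
        using conjQ[OF st(2) q] by (simp add: \<kappa>_apply x \<psi>'\<psi>)
    qed
    then have "\<kappa> (s \<otimes> t) = compose P (\<kappa> s) (\<kappa> t)"
      using morphismD(2)[OF subP subP \<kappa>_closed[OF subgroup.m_closed[OF subN st]]]
      by (auto simp: fun_eq_iff compose_def extensional_def)
    then show "\<kappa> (s \<otimes>\<^bsub>S\<lparr>carrier := ?N\<rparr>\<^esub> t) = \<kappa> s \<otimes>\<^bsub>Aut_F F P\<^esub> \<kappa> t"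
      by (simp add: Aut_F_mult[OF subP \<kappa>_closed[OF st(1)] \<kappa>_closed[OF st(2)]])
  qed (simp add: Aut_F_carrier \<kappa>_closed)
  obtain m where m: "order (S\<lparr>carrier := ?N\<rparr>) = p ^ m"
    using order_subgroup_prime_power[OF subN] by (auto simp: order_def)
  have "finite (carrier (Aut_F F P))"
    using Aut_F_group(4)[OF subP] by (simp add: Aut_F_carrier)
  from A.sylow_conjugation[OF this prime_p syl subgroup_imp_group[OF subN] m \<kappa>_hom]
  obtain \<alpha> where \<alpha>: "\<alpha> \<in> F P P"
    and \<alpha>\<kappa>: "\<And>s. s \<in> ?N \<Longrightarrow> \<alpha> \<otimes>\<^bsub>Aut_F F P\<^esub> \<kappa> s \<otimes>\<^bsub>Aut_F F P\<^esub> inv\<^bsub>Aut_F F P\<^esub> \<alpha> \<in> Aut_S S P"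
    by (auto simp: Aut_F_carrier)
  define \<chi> where "\<chi> = compose Q \<alpha> \<psi>"
  have \<chi>: "\<chi> \<in> F Q P"
    unfolding \<chi>_def by (rule comp[OF subQ subP subP \<psi>(1) \<alpha>])
  have \<chi>Q: "\<chi> ` Q = P"
    using Aut_F_group(3)[OF subP \<alpha>] \<psi>(2) by (auto simp: \<chi>_def compose_def image_image[symmetric])
  have "\<exists>y\<in>carrier S. compose Q \<chi> (conj_map S Q s) = compose Q (conj_map S (\<chi> ` Q) y) \<chi>"
    if s: "s \<in> ?N" for s
  proof -
    obtain y where y: "y \<in> normalizer S P"
      "\<alpha> \<otimes>\<^bsub>Aut_F F P\<^esub> \<kappa> s \<otimes>\<^bsub>Aut_F F P\<^esub> inv\<^bsub>Aut_F F P\<^esub> \<alpha> = conj_map S P y"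
      using \<alpha>\<kappa>[OF s] by (auto simp: Aut_S_def)
    have yS: "y \<in> carrier S" and "conj_map S P y ` P \<subseteq> P"
      using y(1) normalizer_iff[OF finite_carrier subP] by (auto simp: conj_map_def)
    then have yP: "conj_map S P y \<in> F P P"
      by (rule conj[OF subP subP])
    \<comment> \<open>Removing the inverse of \<alpha> and evaluating at \<psi> x yields \<chi> c_s
      = c_y \<chi>, which is the membership condition of the extender for s.\<close>
    have "\<alpha> \<otimes>\<^bsub>Aut_F F P\<^esub> \<kappa> s = conj_map S P y \<otimes>\<^bsub>Aut_F F P\<^esub> \<alpha>"
      unfolding y(2)[symmetric]
      using \<alpha>[folded Aut_F_carrier] \<kappa>_closed[OF s, folded Aut_F_carrier]
      by (simp add: A.m_assoc)
    then have eq: "compose P \<alpha> (\<kappa> s) = compose P (conj_map S P y) \<alpha>"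
      using Aut_F_mult[OF subP \<alpha> \<kappa>_closed[OF s]] Aut_F_mult[OF subP yP \<alpha>] by simp
    have "\<chi> (s \<otimes> x \<otimes> inv s) = conj_map S P y (\<chi> x)" if x: "x \<in> Q" for x
      using fun_cong[OF eq, of "\<psi> x"] \<psi>'\<psi>[OF x] conjQ[OF s x] x
      by (simp add: compose_def \<chi>_def \<kappa>_apply)
    then have "compose Q \<chi> (conj_map S Q s) = compose Q (conj_map S (\<chi> ` Q) y) \<chi>"
      unfolding \<chi>Q by (auto simp: compose_def conj_map_def restrict_def fun_eq_iff)
    then show ?thesis
      using yS by blast
  qed
  then have ext: "extender S Q \<chi> = ?N"
    by (auto simp: extender_def)
  have "\<chi> \<in> F Q (carrier S)"
    by (rule change_codomain[OF subQ subP \<chi> subgroup_self])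
      (use \<chi>Q subgroup.subset[OF subP] in auto)
  moreover have "fully_centralized S F (\<chi> ` Q)"
    using centr \<chi>Q by simp
  ultimately have "\<exists>\<phi>\<in>F ?N (carrier S). \<forall>x\<in>Q. \<phi> x = \<chi> x"
    unfolding ext[symmetric] by (rule extension[OF subQ])
  then obtain \<phi> where \<phi>: "\<phi> \<in> F ?N (carrier S)" "\<forall>x\<in>Q. \<phi> x = \<chi> x"
    by blast
  have \<phi>Q: "\<phi> ` Q = P"
    using \<phi>(2) \<chi>Q by (metis image_cong)
  note \<phi>D = morphismD[OF subN subgroup_self \<phi>(1)]
  interpret \<phi>: group_hom "S\<lparr>carrier := ?N\<rparr>" S \<phi>
    using \<phi>D(4) subgroup_imp_group[OF subN]
    by (simp add: group_hom_def group_hom_axioms_def group_axioms)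
  \<comment> \<open>An s normalizing \<open>Q\<close> has an image normalizing the image of
    \<open>Q\<close>, which is \<open>P\<close>.\<close>
  have "\<phi> s \<in> normalizer S P" if s: "s \<in> ?N" for s
  proof -
    have "\<phi> s \<otimes> x \<otimes> inv (\<phi> s) \<in> P" if x: "x \<in> P" for x
    proof -
      obtain q where q: "q \<in> Q" "x = \<phi> q"
        using \<phi>Q x by blast
      have "\<phi> (s \<otimes> q \<otimes> inv s) = \<phi> s \<otimes> \<phi> q \<otimes> \<phi> (inv s)"
        using s q QN subgroup.m_closed[OF subN] subgroup.m_inv_closed[OF subN]
        by (simp add: \<phi>D(5) subset_iff)
      also have "\<phi> (inv s) = inv (\<phi> s)"
        using \<phi>.hom_inv[of s] s m_inv_consistent[OF subN s] by simp
      finally show ?thesis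
        using imageI[OF conjQ[OF s q(1)], of \<phi>] q(2) \<phi>Q by simp
    qed
    then show ?thesis
      using \<phi>D(3) s by (auto simp: normalizer_iff[OF finite_carrier subP])
  qed
  then show thesis
    using that \<phi>(1) \<phi>Q by blast
qed

end

section \<open>Marks in the Burnside ring\<close>

context group
begin

context
  assumes finite: "finite (carrier G)"
begin

interpretation A: ghost_semiring "burnside_semiring G" "{P. subgroup P G}" gset_mark
  by (rule burnside_ghost_semiring[OF group_axioms finite])

lemma cring_burnside_ring: "cring (burnside_ring G)"
  unfolding burnside_ring_def by (rule A.cring_groth_ring)

lemma mark_simps:
  assumes "subgroup P G"
  shows "\<lbrakk>x \<in> carrier (burnside_ring G); y \<in> carrier (burnside_ring G)\<rbrakk> \<Longrightarrow>
      mark P (x \<oplus>\<^bsub>burnside_ring G\<^esub> y) = mark P x + mark P y"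
    and "\<lbrakk>x \<in> carrier (burnside_ring G); y \<in> carrier (burnside_ring G)\<rbrakk> \<Longrightarrow>
      mark P (x \<otimes>\<^bsub>burnside_ring G\<^esub> y) = mark P x * mark P y"
    and "x \<in> carrier (burnside_ring G) \<Longrightarrow> mark P (\<ominus>\<^bsub>burnside_ring G\<^esub> x) = - mark P x"
    and "mark P \<zero>\<^bsub>burnside_ring G\<^esub> = 0"
    and "mark P \<one>\<^bsub>burnside_ring G\<^esub> = 1"
  using assms unfolding mark_eq_ghost burnside_ring_def
  by (simp_all add: A.ghost_simps A.ghost_a_inv)

lemma mark_inj:
  assumes "x \<in> carrier (burnside_ring G)" "y \<in> carrier (burnside_ring G)"
    and "\<And>P. subgroup P G \<Longrightarrow> mark P x = mark P y"
  shows "x = y"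
  using A.ghost_inj[of x y] assms unfolding mark_eq_ghost burnside_ring_def by simp

lemma burnside_ringE:
  assumes "x \<in> carrier (burnside_ring G)"
  obtains a b where "a \<in> carrier (burnside_semiring G)" "b \<in> carrier (burnside_semiring G)"
    "\<And>P. subgroup P G \<Longrightarrow> mark P x = gset_mark P a - gset_mark P b"
proof -
  obtain a b where ab: "a \<in> carrier (burnside_semiring G)" "b \<in> carrier (burnside_semiring G)"
    "x = groth_class (burnside_semiring G) a b"
    using assms unfolding burnside_ring_def by (rule A.groth_carrierE)
  show thesis
    using ab(1,2) by (rule that) (simp add: mark_eq_ghost ab(3) A.ghost_class ab(1,2))
qed

text \<open>The element is the class of the transitive set G/Q, the building block for realizing
  prescribed marks.\<close>

lemma mark_rcosets:
  assumes "subgroup Q G"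
  obtains x where "x \<in> carrier (burnside_ring G)"
    "\<And>P. subgroup P G \<Longrightarrow>
      mark P x = int (card (fixed_points P (rcosets Q) (\<lambda>g C. C #> inv g)))"
proof -
  note act = finite_action_rcosets[OF finite assms]
  let ?a = "gset_class G (rcosets Q) (\<lambda>g C. C #> inv g)"
  let ?x = "groth_class (burnside_semiring G) ?a \<zero>\<^bsub>burnside_semiring G\<^esub>"
  have a: "?a \<in> carrier (burnside_semiring G)"
    by (rule burnside_carrierI[OF group_axioms act])
  have "?x \<in> carrier (burnside_ring G)"
    unfolding burnside_ring_def by (rule A.groth_carrierI[OF a A.zero_closed])
  moreover have "mark P ?x = int (card (fixed_points P (rcosets Q) (\<lambda>g C. C #> inv g)))"
    if "subgroup P G" for P
    using that gset_mark_class[OF group_axioms act subgroup.subset[OF that]]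
    by (simp add: mark_eq_ghost A.ghost_class a A.zero_closed A.v_zero)
  ultimately show thesis
    by (rule that)
qed

lemma mark_multiple:
  assumes "x \<in> carrier (burnside_ring G)"
  obtains y where "y \<in> carrier (burnside_ring G)" "\<And>P. subgroup P G \<Longrightarrow> mark P y = k * mark P x"
proof -
  interpret R: cring "burnside_ring G" by (rule cring_burnside_ring)
  have nat: "\<exists>y\<in>carrier (burnside_ring G). \<forall>P. subgroup P G \<longrightarrow> mark P y = int n * mark P x" for n
  proof (induction n)
    case 0
    then show ?case
      using mark_simps(4) by (intro bexI[of _ "\<zero>\<^bsub>burnside_ring G\<^esub>"]) auto
  next
    case (Suc n)
    then obtain y where y: "y \<in> carrier (burnside_ring G)"
      "\<forall>P. subgroup P G \<longrightarrow> mark P y = int n * mark P x"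
      by blast
    then show ?case
      using assms mark_simps(1)
      by (intro bexI[of _ "y \<oplus>\<^bsub>burnside_ring G\<^esub> x"]) (auto simp: algebra_simps)
  qed
  obtain y where y: "y \<in> carrier (burnside_ring G)"
    "\<forall>P. subgroup P G \<longrightarrow> mark P y = int (nat \<bar>k\<bar>) * mark P x"
    using nat by blast
  show thesis
  proof (cases "k \<ge> 0")
    case True
    then show thesis
      using y by (intro that[of y]) auto
  next
    case False
    then show thesis
      using y mark_simps(3) by (intro that[of "\<ominus>\<^bsub>burnside_ring G\<^esub> y"]) auto
  qed
qed

text \<open>Translation by g carries the points fixed by \<open>P\<close> bijectively onto those
  fixed by its conjugate; the equality then passes to formal differences.\<close>

lemma mark_conjugate:
  assumes x: "x \<in> carrier (burnside_ring G)" and P: "subgroup P G" and g: "g \<in> carrier G"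
    and Q: "subgroup ((\<lambda>x. g \<otimes> x \<otimes> inv g) ` P) G"
  shows "mark ((\<lambda>x. g \<otimes> x \<otimes> inv g) ` P) x = mark P x"
proof -
  let ?Q = "(\<lambda>x. g \<otimes> x \<otimes> inv g) ` P"
  have Pc: "h \<in> carrier G" if "h \<in> P" for h
    using that subgroup.subset[OF P] by auto
  have eq: "gset_mark ?Q c = gset_mark P c" if c: "c \<in> carrier (burnside_semiring G)" for c
  proof -
    obtain E :: "nat set" and \<alpha> where E: "finite_action G E \<alpha>" "c = gset_class G E \<alpha>"
      using c by (rule burnside_carrierE)
    note actD = finite_actionD[OF E(1)]
    have 1: "\<alpha> g z \<in> fixed_points ?Q E \<alpha>" if "z \<in> fixed_points P E \<alpha>" for z
    proof -
      have z: "z \<in> E" "\<And>h. h \<in> P \<Longrightarrow> \<alpha> h z = z"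
        using that by (auto simp: fixed_points_def)
      have "\<alpha> (g \<otimes> h \<otimes> inv g) (\<alpha> g z) = \<alpha> g z" if h: "h \<in> P" for h
      proof -
        have "\<alpha> (g \<otimes> h \<otimes> inv g) (\<alpha> g z) = \<alpha> (g \<otimes> h) z"
          using g Pc[OF h] z(1) finite_action_inv(1)[OF group_axioms E(1) g z(1)] actD(2)[OF g z(1)]
            actD(4)[of "g \<otimes> h" "inv g" "\<alpha> g z"] by simp
        then show ?thesis
          using actD(4)[OF g Pc[OF h] z(1)] z(2)[OF h] by simp
      qed
      then show ?thesis
        using actD(2)[OF g z(1)] by (auto simp: fixed_points_def)
    qed
    have 2: "\<alpha> (inv g) z \<in> fixed_points P E \<alpha>" if "z \<in> fixed_points ?Q E \<alpha>" for z
    proof -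
      have z: "z \<in> E" "\<And>h. h \<in> P \<Longrightarrow> \<alpha> (g \<otimes> h \<otimes> inv g) z = z"
        using that by (auto simp: fixed_points_def)
      have "\<alpha> h (\<alpha> (inv g) z) = \<alpha> (inv g) z" if h: "h \<in> P" for h
      proof -
        have "h \<otimes> inv g = inv g \<otimes> (g \<otimes> h \<otimes> inv g)"
          using g Pc[OF h] by (simp flip: m_assoc)
        then have "\<alpha> h (\<alpha> (inv g) z) = \<alpha> (inv g \<otimes> (g \<otimes> h \<otimes> inv g)) z"
          using actD(4)[OF Pc[OF h] inv_closed[OF g] z(1)] by simp
        also have "\<dots> = \<alpha> (inv g) (\<alpha> (g \<otimes> h \<otimes> inv g) z)"
          using g Pc[OF h] z(1) by (intro actD(4)) auto
        finally show ?thesis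
          using z(2)[OF h] by simp
      qed
      then show ?thesis
        using actD(2)[OF inv_closed[OF g] z(1)] by (auto simp: fixed_points_def)
    qed
    have "bij_betw (\<alpha> g) (fixed_points P E \<alpha>) (fixed_points ?Q E \<alpha>)"
      using 1 2 finite_action_inv[OF group_axioms E(1) g]
      by (intro bij_betw_byWitness[where f' = "\<alpha> (inv g)"]) (auto simp: fixed_points_def)
    then show ?thesis
      unfolding E(2) gset_mark_class[OF group_axioms E(1) subgroup.subset[OF P]]
        gset_mark_class[OF group_axioms E(1) subgroup.subset[OF Q]]
      by (simp add: bij_betw_same_card)
  qed
  obtain a b where ab: "a \<in> carrier (burnside_semiring G)" "b \<in> carrier (burnside_semiring G)"
    "\<And>P. subgroup P G \<Longrightarrow> mark P x = gset_mark P a - gset_mark P b"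
    using burnside_ringE[OF x] by blast
  show ?thesis
    by (simp add: ab(3)[OF P] ab(3)[OF Q] eq[OF ab(1)] eq[OF ab(2)])
qed

text \<open>A point is fixed by s and K exactly when it is fixed by the subgroup they generate. The
  Cauchy-Frobenius congruence for sets thus becomes one for marks, and it passes to differences by
  linearity.\<close>

lemma order_dvd_sum_marks:
  assumes K: "K \<lhd> G" and x: "x \<in> carrier (burnside_ring G)"
  shows "int (order G) dvd (\<Sum>s\<in>carrier G. mark (generate G (insert s K)) x)"
proof -
  have sub: "insert s K \<subseteq> carrier G" if "s \<in> carrier G" for s
    using that subgroup.subset[OF normal_imp_subgroup[OF K]] by simp
  have eq: "int (order G) dvd (\<Sum>s\<in>carrier G. gset_mark (generate G (insert s K)) c)"
    if c: "c \<in> carrier (burnside_semiring G)" for c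
  proof -
    obtain E :: "nat set" and \<alpha> where E: "finite_action G E \<alpha>" "c = gset_class G E \<alpha>"
      using c by (rule burnside_carrierE)
    have "gset_mark (generate G (insert s K)) c = int (card (fixed_points (insert s K) E \<alpha>))"
      if "s \<in> carrier G" for s
      unfolding E(2) gset_mark_class[OF group_axioms E(1) generate_incl[OF sub[OF that]]]
        fixed_points_generate[OF E(1) sub[OF that]] ..
    then have "(\<Sum>s\<in>carrier G. gset_mark (generate G (insert s K)) c) =
        int (\<Sum>s\<in>carrier G. card (fixed_points (insert s K) E \<alpha>))"
      by simp
    then show ?thesis
      using order_dvd_sum_fixed_points_normal[OF finite E(1) K] by (simp only: int_dvd_int_iff)
  qed
  obtain a b where ab: "a \<in> carrier (burnside_semiring G)" "b \<in> carrier (burnside_semiring G)"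
    "\<And>P. subgroup P G \<Longrightarrow> mark P x = gset_mark P a - gset_mark P b"
    using burnside_ringE[OF x] by blast
  have "(\<Sum>s\<in>carrier G. mark (generate G (insert s K)) x) =
      (\<Sum>s\<in>carrier G. gset_mark (generate G (insert s K)) a) -
      (\<Sum>s\<in>carrier G. gset_mark (generate G (insert s K)) b)"
    unfolding sum_subtractf[symmetric]
    by (intro sum.cong refl ab(3) generate_is_subgroup sub)
  then show ?thesis
    using eq[OF ab(1)] eq[OF ab(2)] by simp
qed

end

text \<open>The congruence is applied in the Burnside ring of \<open>N\<close> to the pullback of
  \<open>x\<close>. It is used for the inclusion of a normalizer and for the morphism from N(Q)
  supplied by saturation.\<close>

lemma card_dvd_sum_marks_hom:
  assumes "finite (carrier G)" and N: "subgroup N G" and K: "K \<lhd> G\<lparr>carrier := N\<rparr>"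
    and \<phi>: "\<phi> \<in> hom (G\<lparr>carrier := N\<rparr>) G" and x: "x \<in> carrier (burnside_ring G)"
  shows "int (card N) dvd (\<Sum>s\<in>N. mark (\<phi> ` generate G (insert s K)) x)"
proof -
  interpret N: group "G\<lparr>carrier := N\<rparr>"
    by (rule group_restricted[OF assms(1) N \<phi>])
  have sub: "insert s K \<subseteq> N" if "s \<in> N" for s
    using that subgroup.subset[OF normal_imp_subgroup[OF K]] by simp
  have "mark (generate (G\<lparr>carrier := N\<rparr>) (insert s K)) (burnside_restrict G N \<phi> x) =
      mark (\<phi> ` generate G (insert s K)) x" if "s \<in> N" for s
    using mark_restrict[OF assms(1) N \<phi> x N.generate_is_subgroup[of "insert s K"]] sub[OF that]
    unfolding generate_consistent[OF sub[OF that] N] by simp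
  then show ?thesis
    using N.order_dvd_sum_marks[OF finite_restricted[OF assms(1) N \<phi>] K
        burnside_restrict_closed[OF assms(1) N \<phi> x]]
    by (simp add: order_def)
qed

text \<open>
  An element with prescribed marks is built from the large subgroups downwards: adding a multiple
  of the class of \<open>G/Q\<close> changes the mark at \<open>Q\<close> by a multiple of \<open>|W(Q)|\<close>, and otherwise
  affects only conjugates of \<open>Q\<close> and smaller subgroups.
\<close>

lemma exists_with_marks:
  fixes h :: "'a set \<Rightarrow> int"
  assumes finite: "finite (carrier G)"
    and h: "\<And>P g. \<lbrakk>subgroup P G; g \<in> carrier G; subgroup ((\<lambda>x. g \<otimes> x \<otimes> inv g) ` P) G\<rbrakk> \<Longrightarrow>
      h ((\<lambda>x. g \<otimes> x \<otimes> inv g) ` P) = h P"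
    and cong: "\<And>Q x. \<lbrakk>subgroup Q G; x \<in> carrier (burnside_ring G);
      \<And>R. \<lbrakk>subgroup R G; card Q < card R\<rbrakk> \<Longrightarrow> mark R x = h R\<rbrakk> \<Longrightarrow>
      int (order (weyl_group G Q)) dvd h Q - mark Q x"
  obtains x where "x \<in> carrier (burnside_ring G)" "\<And>R. subgroup R G \<Longrightarrow> mark R x = h R"
proof -
  interpret R: cring "burnside_ring G"
    by (rule cring_burnside_ring[OF finite])
  note ms = mark_simps[OF finite]
  have fin_sub: "finite P" if "subgroup P G" for P
    using finite_subset[OF subgroup.subset[OF that] finite] .
  \<comment> \<open>The bound says |R| > |G| - d without subtraction on naturals: vacuous for d = 0,
    and satisfied by every subgroup for d = |G| + 1.\<close>
  have "\<exists>x\<in>carrier (burnside_ring G). \<forall>R. subgroup R G \<longrightarrow> order G < card R + d \<longrightarrow> mark R x = h R" for d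
  proof (induction d)
    case 0
    have "\<not> order G < card R" if "subgroup R G" for R
      unfolding order_def using card_mono[OF finite subgroup.subset[OF that]] by simp
    then show ?case
      by (intro bexI[of _ "\<zero>\<^bsub>burnside_ring G\<^esub>"]) auto
  next
    case (Suc d)
    \<comment> \<open>Subgroups of the same order are treated one at a time; \<open>T\<close>
      collects those already settled.\<close>
    have "\<exists>x\<in>carrier (burnside_ring G).
        \<forall>R. subgroup R G \<longrightarrow> order G < card R + d \<or> R \<in> T \<longrightarrow> mark R x = h R"
      if "finite T" "T \<subseteq> {R. subgroup R G \<and> card R + d = order G}" for T
      using that
    proof (induction T rule: finite_induct)
      case empty
      then show ?case using Suc by simp
    next
      case (insert Q T)
      then obtain x where x: "x \<in> carrier (burnside_ring G)"
        "\<And>R. \<lbrakk>subgroup R G; order G < card R + d \<or> R \<in> T\<rbrakk> \<Longrightarrow> mark R x = h R"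
        by auto
      have Q: "subgroup Q G" "card Q + d = order G"
        using insert.prems by auto
      show ?case
      \<comment> \<open>The mark at \<open>Q\<close> is already correct whenever a conjugate of
        \<open>Q\<close> lies in \<open>T\<close>. In the other case no member of \<open>T\<close>
        is conjugate to \<open>Q\<close>, so a correction by G/Q leaves the settled marks
        alone.\<close>
      proof (cases "mark Q x = h Q")
        case True
        then show ?thesis
          using x by auto
      next
        case False
        have "int (order (weyl_group G Q)) dvd h Q - mark Q x"
          using Q by (intro cong x) auto
        then obtain k where k: "h Q - mark Q x = int (order (weyl_group G Q)) * k"
          by blast
        obtain y where y: "y \<in> carrier (burnside_ring G)" "\<And>P. subgroup P G \<Longrightarrow>
            mark P y = int (card (fixed_points P (rcosets Q) (\<lambda>g C. C #> inv g)))"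
          using mark_rcosets[OF finite Q(1)] by blast
        obtain z where z: "z \<in> carrier (burnside_ring G)"
          "\<And>P. subgroup P G \<Longrightarrow> mark P z = k * mark P y"
          using mark_multiple[OF finite y(1)] by blast
        have zQ: "mark Q z = h Q - mark Q x"
          by (simp add: z(2)[OF Q(1)] y(2)[OF Q(1)] k card_fixed_points_rcosets_self[OF finite Q(1)])
        have z0: "mark R z = 0" if R: "subgroup R G" and "order G < card R + d \<or> R \<in> T" for R
        proof (rule ccontr)
          assume "mark R z \<noteq> 0"
          then have "fixed_points R (rcosets Q) (\<lambda>g C. C #> inv g) \<noteq> {}"
            using z(2)[OF R] y(2)[OF R] by auto
          then obtain g where g: "g \<in> carrier G" "(\<lambda>x. g \<otimes> x \<otimes> inv g) ` R \<subseteq> Q"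
            using fixed_points_rcosets_nonempty[OF _ Q(1) subgroup.subset[OF R]] by blast
          have card: "card ((\<lambda>x. g \<otimes> x \<otimes> inv g) ` R) = card R"
            using inj_on_conjugation[OF g(1) subgroup.subset[OF R]] by (rule card_image)
          then have "card R \<le> card Q"
            using card_mono[OF fin_sub[OF Q(1)] g(2)] by simp
          then have "R \<in> T"
            using that(2) Q(2) by auto
          then have "card R = card Q"
            using insert.prems Q(2) by auto
          then have RQ: "(\<lambda>x. g \<otimes> x \<otimes> inv g) ` R = Q"
            using card card_subset_eq[OF fin_sub[OF Q(1)] g(2)] by simp
          then have "mark Q x = mark R x" "h Q = h R"
            using mark_conjugate[OF finite x(1) R g(1)] h[OF R g(1)] Q(1) by auto
          then show False
            using False x(2)[OF R] \<open>R \<in> T\<close> by simp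
        qed
        have "mark R (x \<oplus>\<^bsub>burnside_ring G\<^esub> z) = h R"
          if "subgroup R G" "order G < card R + d \<or> R \<in> insert Q T" for R
        proof (cases "R = Q")
          case True
          then show ?thesis
            using ms(1)[OF Q(1) x(1) z(1)] zQ by simp
        next
          case False
          then show ?thesis
            using that ms(1)[OF that(1) x(1) z(1)] z0[OF that(1)] x(2)[OF that(1)] by auto
        qed
        then show ?thesis
          using x(1) z(1) by (intro bexI[of _ "x \<oplus>\<^bsub>burnside_ring G\<^esub> z"]) auto
      qed
    qed
    moreover have "finite {R. subgroup R G \<and> card R + d = order G}"
      by (rule finite_subset[of _ "Pow (carrier G)"]) (auto simp: finite dest: subgroup.subset)
    ultimately obtain x where x: "x \<in> carrier (burnside_ring G)"
      "\<forall>R. subgroup R G \<longrightarrow> order G < card R + d \<or> R \<in> {R. subgroup R G \<and> card R + d = order G} \<longrightarrow>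
        mark R x = h R"
      by blast
    then show ?case
      by (intro bexI[of _ x]) auto
  qed
  from this[of "Suc (order G)"] show thesis
    using that by auto
qed

end

section \<open>The congruences\<close>

lemma cring_product_int_ring: "cring (product_ring I (\<lambda>_. \<Z>))"
proof (rule cringI)
  show "abelian_group (product_ring I (\<lambda>_. \<Z>))"
  proof (rule abelian_groupI)
    fix x assume "x \<in> carrier (product_ring I (\<lambda>_. \<Z>))"
    then show "\<exists>y\<in>carrier (product_ring I (\<lambda>_. \<Z>)).
        y \<oplus>\<^bsub>product_ring I (\<lambda>_. \<Z>)\<^esub> x = \<zero>\<^bsub>product_ring I (\<lambda>_. \<Z>)\<^esub>"
      by (intro bexI[of _ "\<lambda>i\<in>I. - x i"]) (auto simp: product_ring_def fun_eq_iff)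
  qed (auto simp: product_ring_def PiE_def extensional_def restrict_def fun_eq_iff)
  show "comm_monoid (product_ring I (\<lambda>_. \<Z>))"
    by (rule comm_monoidI) (auto simp: product_ring_def PiE_def extensional_def restrict_def fun_eq_iff)
qed (auto simp: product_ring_def restrict_def fun_eq_iff algebra_simps)

lemma comm_group_product_group:
  assumes "\<And>i. i \<in> I \<Longrightarrow> comm_group (G i)"
  shows "comm_group (product_group I G)"
proof (rule group.group_comm_groupI)
  show "group (product_group I G)"
    using assms comm_group.axioms(2) by (intro product_group) blast
  fix x y assume xy: "x \<in> carrier (product_group I G)" "y \<in> carrier (product_group I G)"
  have "x i \<otimes>\<^bsub>G i\<^esub> y i = y i \<otimes>\<^bsub>G i\<^esub> x i" if "i \<in> I" for i
    using xy that comm_monoid.m_comm[OF comm_group.axioms(1)[OF assms[OF that]]]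
    by (auto simp: PiE_def Pi_def)
  then show "x \<otimes>\<^bsub>product_group I G\<^esub> y = y \<otimes>\<^bsub>product_group I G\<^esub> x"
    by (auto intro!: restrict_ext)
qed

text \<open>For \<open>h\<close> induced by a class function this is |P| times the integer that
  \<open>psi\<close> reduces. Summing over the normalizer removes cosets and \<open>the_elem\<close>
  from the arguments below.\<close>

definition weyl_sum :: "('a, 'm) monoid_scheme \<Rightarrow> 'a set \<Rightarrow> ('a set \<Rightarrow> int) \<Rightarrow> int" where
  "weyl_sum G P h = (\<Sum>s\<in>normalizer G P. h (generate G (insert s P)))"

section \<open>Sums over normalizers\<close>

context group
begin

context
  fixes P
  assumes finite: "finite (carrier G)" and P: "subgroup P G"
begin

lemma generate_insert_in:
  assumes "s \<in> P"
  shows "generate G (insert s P) = P"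
proof -
  have "insert s P = P"
    using assms by auto
  then show ?thesis
    using generateI[OF P] generate_subgroup_incl[OF subset_refl P] generate.incl[of _ P G] by auto
qed

lemma generate_insert_notin:
  assumes "s \<in> carrier G" "s \<notin> P"
  shows "subgroup (generate G (insert s P)) G" "card P < card (generate G (insert s P))"
proof -
  have sub: "insert s P \<subseteq> carrier G"
    using assms subgroup.subset[OF P] by auto
  then show gen: "subgroup (generate G (insert s P)) G"
    by (rule generate_is_subgroup)
  have "P \<subset> generate G (insert s P)"
    using assms(2) generate.incl[of _ "insert s P" G] by auto
  then show "card P < card (generate G (insert s P))"
    using finite finite_subset[OF subgroup.subset[OF gen]] by (intro psubset_card_mono) auto
qed

lemma generate_insert_mult:
  assumes "x \<in> P" "s \<in> carrier G"
  shows "generate G (insert (x \<otimes> s) P) = generate G (insert s P)"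
proof
  have x: "x \<in> carrier G"
    using assms(1) subgroup.subset[OF P] by auto
  have sub: "insert s P \<subseteq> carrier G" "insert (x \<otimes> s) P \<subseteq> carrier G"
    using assms x subgroup.subset[OF P] by auto
  have "x \<otimes> s \<in> generate G (insert s P)"
    using assms(1) by (intro generate.eng generate.incl) auto
  then show "generate G (insert (x \<otimes> s) P) \<subseteq> generate G (insert s P)"
    by (intro generate_subgroup_incl generate_is_subgroup sub) (auto intro: generate.incl)
  have "inv x \<otimes> (x \<otimes> s) \<in> generate G (insert (x \<otimes> s) P)"
    using subgroup.m_inv_closed[OF P assms(1)] by (intro generate.eng generate.incl) auto
  then have "s \<in> generate G (insert (x \<otimes> s) P)"
    using x assms(2) by (simp add: m_assoc[symmetric])
  then show "generate G (insert s P) \<subseteq> generate G (insert (x \<otimes> s) P)"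
    by (intro generate_subgroup_incl generate_is_subgroup sub) (auto intro: generate.incl)
qed

text \<open>Changing s by a factor from \<open>P\<close> does not change the subgroup generated by s
  and \<open>P\<close>, so the summand is constant on cosets.\<close>

lemma weyl_sum_cosets:
  "weyl_sum G P h = int (card P) *
    (\<Sum>C\<in>carrier (weyl_group G P). the_elem ((\<lambda>s. h (generate G (insert s P))) ` C))"
proof -
  interpret N: group "G\<lparr>carrier := normalizer G P\<rparr>"
    by (rule subgroup_imp_group[OF normalizer_subgroup[OF P]])
  have Nc: "s \<in> carrier G" if "s \<in> normalizer G P" for s
    using that subgroup.subset[OF normalizer_subgroup[OF P]] by auto
  have "finite (carrier (G\<lparr>carrier := normalizer G P\<rparr>))"
    using finite_subset[OF subgroup.subset[OF normalizer_subgroup[OF P]] finite] by simp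
  then show ?thesis
    using N.sum_rcosets[OF _ normal_imp_subgroup[OF normal_in_normalizer[OF finite P]],
        of "\<lambda>s. h (generate G (insert s P))"]
    by (simp add: weyl_sum_def weyl_group_def FactGroup_def generate_insert_mult Nc)
qed

text \<open>Only s in \<open>P\<close> contribute, each giving the subgroup \<open>P\<close> itself;
  any other s generates with \<open>P\<close> a subgroup of larger order. This is the triangularity
  behind both surjectivity and the congruence at \<open>Q\<close>.\<close>

lemma weyl_sum_diff:
  assumes "\<And>R. \<lbrakk>subgroup R G; card P < card R\<rbrakk> \<Longrightarrow> h R = k R"
  shows "weyl_sum G P h - weyl_sum G P k = int (card P) * (h P - k P)"
proof -
  let ?N = "normalizer G P"
  have fin: "finite ?N" and PN: "P \<subseteq> ?N"
    using finite_subset[OF subgroup.subset[OF normalizer_subgroup[OF P]] finite]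
      subgroup_subset_normalizer[OF finite P] by auto
  have "h (generate G (insert s P)) = k (generate G (insert s P))" if "s \<in> ?N - P" for s
    using that subgroup.subset[OF normalizer_subgroup[OF P]]
    by (intro assms generate_insert_notin) auto
  then have "weyl_sum G P h - weyl_sum G P k =
      (\<Sum>s\<in>P. h (generate G (insert s P)) - k (generate G (insert s P)))"
    unfolding weyl_sum_def sum_subtractf[symmetric]
    by (intro sum.mono_neutral_right fin PN) auto
  also have "\<dots> = (\<Sum>s\<in>P. h P - k P)"
    by (intro sum.cong refl) (simp add: generate_insert_in)
  finally show ?thesis
    by simp
qed

lemma order_weyl_group_pos: "order (weyl_group G P) > 0"
proof -
  have "card (normalizer G P) > 0"
    using subgroup.one_closed[OF normalizer_subgroup[OF P]]
      finite_subset[OF subgroup.subset[OF normalizer_subgroup[OF P]] finite]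
    by (auto simp: card_gt_0_iff)
  then show ?thesis
    by (simp add: card_normalizer[OF finite P])
qed

lemma card_subgroup_pos: "card P > 0"
  using subgroup.one_closed[OF P] finite_subset[OF subgroup.subset[OF P] finite]
  by (auto simp: card_gt_0_iff)

text \<open>The pullback congruence for the inclusion of the normalizer; for stable elements it says
  that \<Psi> vanishes on the image of \<Phi>.\<close>

lemma card_dvd_weyl_sum_marks:
  assumes "x \<in> carrier (burnside_ring G)"
  shows "int (card (normalizer G P)) dvd weyl_sum G P (\<lambda>R. mark R x)"
proof -
  have "(\<lambda>s. s) \<in> hom (G\<lparr>carrier := normalizer G P\<rparr>) G"
    using subgroup.subset[OF normalizer_subgroup[OF P]] by (auto simp: hom_def)
  from card_dvd_sum_marks_hom[OF finite normalizer_subgroup[OF P] normal_in_normalizer[OF finite P]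
      this assms]
  show ?thesis
    by (simp add: weyl_sum_def)
qed

end

end

section \<open>The map \<open>psi\<close> through normalizer sums, and stability through
  marks\<close>

context fusion_system
begin

lemma psi_eq:
  assumes "subgroup P S"
  shows "psi S F P f = (weyl_sum S P (\<lambda>R. f (fusion_conj_class S F R)) div int (card P))
    mod int (order (weyl_group S P))"
    and "int (card P) dvd weyl_sum S P (\<lambda>R. f (fusion_conj_class S F R))"
  using card_subgroup_pos[OF finite_carrier assms]
    weyl_sum_cosets[OF finite_carrier assms, of "\<lambda>R. f (fusion_conj_class S F R)"]
  by (simp_all add: psi_def)

text \<open>Multiplication by |P| turns the modulus |W(P)| into |N(P)|.\<close>

lemma psi_eq_0_iff:
  assumes "subgroup P S"
  shows "psi S F P f = 0 \<longleftrightarrow>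
    int (card (normalizer S P)) dvd weyl_sum S P (\<lambda>R. f (fusion_conj_class S F R))"
proof -
  let ?w = "weyl_sum S P (\<lambda>R. f (fusion_conj_class S F R))"
  obtain v where v: "?w = int (card P) * v"
    using psi_eq(2)[OF assms] by blast
  show ?thesis
    using card_subgroup_pos[OF finite_carrier assms]
    unfolding psi_eq(1)[OF assms] v card_normalizer[OF finite_carrier assms]
    by (simp add: mult.commute[of "int (card P)"] mod_eq_0_iff_dvd)
qed

text \<open>Division by |P| is exact on these sums, hence additive.\<close>

lemma psi_add:
  assumes "subgroup P S"
  shows "psi S F P (\<lambda>c\<in>fusion_classes S F. f c + g c) =
    (psi S F P f + psi S F P g) mod int (order (weyl_group S P))"
proof -
  have cl: "fusion_conj_class S F R \<in> fusion_classes S F" if "subgroup R S" for R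
    using that by (auto simp: fusion_classes_def)
  have sub: "subgroup (generate S (insert s P)) S" if "s \<in> normalizer S P" for s
    using that subgroup.subset[OF normalizer_subgroup[OF assms]] subgroup.subset[OF assms]
    by (intro generate_is_subgroup) auto
  have "weyl_sum S P (\<lambda>R. (\<lambda>c\<in>fusion_classes S F. f c + g c) (fusion_conj_class S F R)) =
      weyl_sum S P (\<lambda>R. f (fusion_conj_class S F R)) + weyl_sum S P (\<lambda>R. g (fusion_conj_class S F R))"
    unfolding weyl_sum_def sum.distrib[symmetric]
    by (intro sum.cong refl) (simp add: cl sub)
  then show ?thesis
    unfolding psi_eq(1)[OF assms] using psi_eq(2)[OF assms, of f]
    by (simp add: div_plus_div_distrib_dvd_left mod_add_eq)
qed

lemma psi_range:
  assumes "subgroup P S"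
  shows "psi S F P f \<in> carrier (integer_mod_group (order (weyl_group S P)))"
  using order_weyl_group_pos[OF finite_carrier assms]
  by (simp add: carrier_integer_mod_group psi_def)

lemma image_generate:
  assumes "subgroup N S" "\<phi> \<in> F N (carrier S)" "A \<subseteq> N"
  shows "\<phi> ` generate S A = generate S (\<phi> ` A)" "generate S A \<subseteq> N"
proof -
  interpret \<phi>: group_hom "S\<lparr>carrier := N\<rparr>" S \<phi>
    using morphismD(4)[OF assms(1) subgroup_self assms(2)] subgroup_imp_group[OF assms(1)]
    by (simp add: group_hom_def group_hom_axioms_def group_axioms)
  show "\<phi> ` generate S A = generate S (\<phi> ` A)"
    using \<phi>.generate_img[of A] assms(3) generate_consistent[OF assms(3,1)] by simp
  show "generate S A \<subseteq> N"
    using assms(3,1) by (rule generate_subgroup_incl)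
qed

text \<open>Restrictions to \<open>P\<close> agree when the marks at R and \<phi>(R) agree for all R
  in \<open>P\<close>, and such pairs are conjugate. Conversely, a conjugate of \<open>P\<close> is
  the image of a morphism on \<open>P\<close>, and R = P gives the equation.\<close>

lemma fusion_stable_iff:
  assumes "x \<in> carrier (burnside_ring S)"
  shows "fusion_stable S F x \<longleftrightarrow>
    (\<forall>P Q. subgroup P S \<longrightarrow> Q \<in> fusion_conj_class S F P \<longrightarrow> mark Q x = mark P x)"
proof -
  have id: "(\<lambda>g\<in>P. g) \<in> hom (S\<lparr>carrier := P\<rparr>) S" if "subgroup P S" for P
    using that subgroup.subset[OF that] subgroup.m_closed[OF that] by (auto simp: hom_def)
  have sub: "subgroup R (S\<lparr>carrier := P\<rparr>) \<longleftrightarrow> subgroup R S \<and> R \<subseteq> P" if "subgroup P S" for P R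
    using that subgroup_incl incl_subgroup[OF that] subgroup.subset[of R "S\<lparr>carrier := P\<rparr>"] by auto
  have iff: "burnside_restrict S P \<phi> x = burnside_restrict S P (\<lambda>g\<in>P. g) x \<longleftrightarrow>
      (\<forall>R. subgroup R S \<and> R \<subseteq> P \<longrightarrow> mark (\<phi> ` R) x = mark R x)"
    if P: "subgroup P S" and \<phi>: "\<phi> \<in> F P (carrier S)" for P \<phi>
  proof -
    have "(\<lambda>g\<in>P. g) ` R = R" if "R \<subseteq> P" for R
      using that by (auto simp: image_iff subset_iff)
    then show ?thesis
      unfolding burnside_restrict_eq_iff[OF finite_carrier P
          morphismD(4)[OF P subgroup_self \<phi>] id[OF P] assms] sub[OF P]
      by auto
  qed
  show ?thesis
  proof
    assume st: "fusion_stable S F x"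
    show "\<forall>P Q. subgroup P S \<longrightarrow> Q \<in> fusion_conj_class S F P \<longrightarrow> mark Q x = mark P x"
    proof (intro allI impI)
      fix P Q assume P: "subgroup P S" and "Q \<in> fusion_conj_class S F P"
      then obtain \<phi> where Q: "subgroup Q S" and \<phi>: "\<phi> \<in> F P Q" "\<phi> ` P = Q"
        unfolding fusion_conj_class_iff[OF P] by blast
      have \<phi>S: "\<phi> \<in> F P (carrier S)"
        using change_codomain[OF P Q \<phi>(1) subgroup_self] \<phi>(2) subgroup.subset[OF Q] by simp
      then have "burnside_restrict S P \<phi> x = burnside_restrict S P (\<lambda>g\<in>P. g) x"
        using st P by (simp add: fusion_stable_def)
      then show "mark Q x = mark P x"
        using P \<phi>(2) unfolding iff[OF P \<phi>S] by blast
    qed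
  next
    assume cl: "\<forall>P Q. subgroup P S \<longrightarrow> Q \<in> fusion_conj_class S F P \<longrightarrow> mark Q x = mark P x"
    show "fusion_stable S F x"
      unfolding fusion_stable_def
    proof (intro allI impI ballI)
      fix P \<phi> assume P: "subgroup P S" and \<phi>: "\<phi> \<in> F P (carrier S)"
      show "burnside_restrict S P \<phi> x = burnside_restrict S P (\<lambda>g\<in>P. g) x"
        unfolding iff[OF P \<phi>] using cl morphism_image_class[OF P subgroup_self \<phi>] by blast
    qed
  qed
qed

lemma carrier_fusion_burnside_ring:
  "carrier (fusion_burnside_ring S F) = {x \<in> carrier (burnside_ring S).
    \<forall>P Q. subgroup P S \<longrightarrow> Q \<in> fusion_conj_class S F P \<longrightarrow> mark Q x = mark P x}"
  unfolding fusion_burnside_ring_def using fusion_stable_iff by auto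

lemma subring_fusion_burnside_ring:
  "subring (carrier (fusion_burnside_ring S F)) (burnside_ring S)"
proof -
  interpret A: cring "burnside_ring S"
    by (rule cring_burnside_ring[OF finite_carrier])
  show ?thesis
    unfolding carrier_fusion_burnside_ring
    using mark_simps[OF finite_carrier] fusion_conj_class_subgroup
    by (intro A.subringI) auto
qed

lemma cring_fusion_burnside_ring: "cring (fusion_burnside_ring S F)"
proof -
  interpret A: cring "burnside_ring S"
    by (rule cring_burnside_ring[OF finite_carrier])
  have "cring (burnside_ring S\<lparr>carrier := carrier (fusion_burnside_ring S F)\<rparr>)"
    using A.subcringI'[OF subring_fusion_burnside_ring] A.subcring_iff
      subringE(1)[OF subring_fusion_burnside_ring] by blast
  then show ?thesis
    by (simp add: fusion_burnside_ring_def)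
qed

end

section \<open>Transport of congruences between conjugate subgroups\<close>

context saturated_fusion_system
begin

text \<open>This supplies the congruence needed to correct the mark at \<open>Q\<close>. Every
  comparison is a divisibility by |N(Q)| carrying the common factor |P| = |Q|, which is cancelled
  only at the end.\<close>

lemma card_dvd_weyl_sum_diff:
  assumes P: "fully_normalized S F P" and Q: "Q \<in> fusion_conj_class S F P"
    and x: "x \<in> carrier (burnside_ring S)"
    and h: "\<And>R R'. \<lbrakk>subgroup R S; R' \<in> fusion_conj_class S F R\<rbrakk> \<Longrightarrow> h R' = h R"
    and eq: "\<And>R. \<lbrakk>subgroup R S; card Q < card R\<rbrakk> \<Longrightarrow> mark R x = h R"
    and dvd: "int (card (normalizer S P)) dvd weyl_sum S P h"
  shows "int (order (weyl_group S Q)) dvd h Q - mark Q x"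
proof -
  have subP: "subgroup P S" and subQ: "subgroup Q S" and card: "card Q = card P"
    using P fusion_conj_class_subgroup[OF Q] fusion_conj_class_card[OF _ Q]
    by (auto simp: fully_normalized_def)
  let ?N = "normalizer S Q"
  have subN: "subgroup ?N S"
    by (rule normalizer_subgroup[OF subQ])
  obtain \<phi> where \<phi>: "\<phi> \<in> F ?N (carrier S)" "\<phi> ` Q = P" "\<phi> ` ?N \<subseteq> normalizer S P"
    using normalizer_morphism[OF P Q] .
  note \<phi>D = morphismD[OF subN subgroup_self \<phi>(1)]
  have "subgroup (\<phi> ` ?N) (S\<lparr>carrier := normalizer S P\<rparr>)"
    using morphism_image_subgroup[OF subN subgroup_self \<phi>(1) subN subset_refl]
      normalizer_subgroup[OF subP] \<phi>(3) by (rule subgroup_incl)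
  then have "card (\<phi> ` ?N) dvd order (S\<lparr>carrier := normalizer S P\<rparr>)"
    using group.lagrange[OF subgroup_imp_group[OF normalizer_subgroup[OF subP]], symmetric] by simp
  then have "card (\<phi> ` ?N) dvd card (normalizer S P)"
    by (simp add: order_def)
  \<comment> \<open>Since \<phi> is injective, N(Q) is isomorphic to a subgroup of N(P), and
    Lagrange's theorem applies.\<close>
  then have N_dvd: "int (card ?N) dvd int (card (normalizer S P))"
    using card_image[OF \<phi>D(1)] by simp
  have "weyl_sum S P (\<lambda>R. mark R x) - weyl_sum S P h = int (card P) * (mark P x - h P)"
    using eq card by (intro weyl_sum_diff finite_carrier subP) auto
  then have 1: "int (card ?N) dvd int (card P) * (mark P x - h P)"
    using dvd_trans[OF N_dvd dvd_diff[OF card_dvd_weyl_sum_marks[OF finite_carrier subP x] dvd]]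
    by simp
  have "weyl_sum S Q (\<lambda>R. mark (\<phi> ` R) x) = (\<Sum>s\<in>?N. mark (\<phi> ` generate S (insert s Q)) x)"
    by (simp add: weyl_sum_def)
  then have dvd\<phi>: "int (card ?N) dvd weyl_sum S Q (\<lambda>R. mark (\<phi> ` R) x)"
    using card_dvd_sum_marks_hom[OF finite_carrier subN normal_in_normalizer[OF finite_carrier subQ]
        \<phi>D(4) x] by simp
  have QN: "Q \<subseteq> ?N"
    by (rule subgroup_subset_normalizer[OF finite_carrier subQ])
  \<comment> \<open>Outside N(Q) the morphism \<phi> has no meaningful values. The default
    \<open>h R\<close> makes the comparison with \<open>mark R x\<close> valid for all larger R,
    while the sum only evaluates subgroups inside N(Q).\<close>
  have restr: "weyl_sum S Q (\<lambda>R. mark (\<phi> ` R) x) =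
      weyl_sum S Q (\<lambda>R. if R \<subseteq> ?N then mark (\<phi> ` R) x else h R)"
    unfolding weyl_sum_def using image_generate(2)[OF subN \<phi>(1)] QN
    by (intro sum.cong refl) simp
  have "weyl_sum S Q (\<lambda>R. if R \<subseteq> ?N then mark (\<phi> ` R) x else h R) -
      weyl_sum S Q (\<lambda>R. mark R x) =
      int (card Q) * ((if Q \<subseteq> ?N then mark (\<phi> ` Q) x else h Q) - mark Q x)"
  proof (rule weyl_sum_diff[OF finite_carrier subQ])
    fix R assume R: "subgroup R S" "card Q < card R"
    show "(if R \<subseteq> ?N then mark (\<phi> ` R) x else h R) = mark R x"
    proof (cases "R \<subseteq> ?N")
      case True
      note cl = morphism_image_class[OF subN subgroup_self \<phi>(1) R(1) True]
      have "mark (\<phi> ` R) x = h (\<phi> ` R)"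
        using R(2) fusion_conj_class_card[OF R(1) cl] fusion_conj_class_subgroup[OF cl]
        by (intro eq) auto
      then show ?thesis
        using True h[OF R(1) cl] eq[OF R] by simp
    next
      case False
      then show ?thesis
        using eq[OF R] by simp
    qed
  qed
  then have diff: "weyl_sum S Q (\<lambda>R. mark (\<phi> ` R) x) - weyl_sum S Q (\<lambda>R. mark R x) =
      int (card Q) * (mark P x - mark Q x)"
    using QN \<phi>(2) restr by simp
  have "int (card ?N) dvd int (card Q) * (mark P x - mark Q x)"
    unfolding diff[symmetric]
    by (rule dvd_diff[OF dvd\<phi> card_dvd_weyl_sum_marks[OF finite_carrier subQ x]])
  \<comment> \<open>The unknown mark at \<open>P\<close> drops out of the difference, and
    \<open>h P = h Q\<close> by invariance of \<open>h\<close>.\<close>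
  from dvd_diff[OF this 1] have "int (card ?N) dvd int (card Q) * (h Q - mark Q x)"
    using h[OF subP Q] card by (simp add: algebra_simps)
  then show ?thesis
    using card_subgroup_pos[OF finite_carrier subQ]
    by (simp add: card_normalizer[OF finite_carrier subQ] mult.commute[of "int (card Q)"])
qed

text \<open>The normalizers have equal order, so the morphism between them is bijective. It
  reindexes the sum and carries each generated subgroup to a conjugate one, where \<open>f\<close>
  has the same value.\<close>

lemma psi_fully_normalized_eq:
  assumes P: "fully_normalized S F P" and P': "fully_normalized S F P'"
    and cl: "P' \<in> fusion_conj_class S F P"
  shows "order (weyl_group S P) = order (weyl_group S P')" "psi S F P f = psi S F P' f"
proof -
  have subP: "subgroup P S" and subP': "subgroup P' S"
    using P P' by (auto simp: fully_normalized_def)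
  let ?N = "normalizer S P"
  have card: "card P' = card P"
    by (rule fusion_conj_class_card[OF subP cl])
  have cl': "P \<in> fusion_conj_class S F P'"
    by (rule fusion_conj_class_sym[OF subP cl])
  have cardN: "card ?N = card (normalizer S P')"
    using P P' cl cl' by (auto simp: fully_normalized_def intro: antisym)
  then show order: "order (weyl_group S P) = order (weyl_group S P')"
    using card card_subgroup_pos[OF finite_carrier subP]
    by (simp add: card_normalizer[OF finite_carrier] subP subP')
  have subN: "subgroup ?N S"
    by (rule normalizer_subgroup[OF subP])
  obtain \<phi> where \<phi>: "\<phi> \<in> F ?N (carrier S)" "\<phi> ` P = P'" "\<phi> ` ?N \<subseteq> normalizer S P'"
    using normalizer_morphism[OF P' cl'] .
  have inj: "inj_on \<phi> ?N"
    by (rule morphismD(1)[OF subN subgroup_self \<phi>(1)])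
  have im: "\<phi> ` ?N = normalizer S P'"
    using card_subset_eq[OF subgroup_finite[OF normalizer_subgroup[OF subP']] \<phi>(3)]
      card_image[OF inj] cardN by simp
  let ?h = "\<lambda>R. f (fusion_conj_class S F R)"
  have "?h (generate S (insert (\<phi> s) P')) = ?h (generate S (insert s P))" if "s \<in> ?N" for s
  proof -
    have sub: "insert s P \<subseteq> ?N"
      using that subgroup_subset_normalizer[OF finite_carrier subP] by auto
    have gen: "subgroup (generate S (insert s P)) S"
      using sub subgroup.subset[OF subN] by (intro generate_is_subgroup) auto
    have "generate S (insert (\<phi> s) P') = \<phi> ` generate S (insert s P)"
      using image_generate(1)[OF subN \<phi>(1) sub] \<phi>(2) by simp
    also have "\<dots> \<in> fusion_conj_class S F (generate S (insert s P))"
      by (rule morphism_image_class[OF subN subgroup_self \<phi>(1) gen image_generate(2)[OF subN \<phi>(1) sub]])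
    finally show ?thesis
      using fusion_conj_class_eq[OF gen] by simp
  qed
  then have "weyl_sum S P' ?h = weyl_sum S P ?h"
    unfolding weyl_sum_def im[symmetric] by (simp add: sum.reindex[OF inj])
  then show "psi S F P f = psi S F P' f"
    by (simp add: psi_eq(1) subP subP' order card)
qed

end

section \<open>Exactness\<close>

context saturated_fusion_system
begin

lemma fusion_classesI: "subgroup P S \<Longrightarrow> fusion_conj_class S F P \<in> fusion_classes S F"
  by (auto simp: fusion_classes_def)

context
  fixes rep :: "'a set set \<Rightarrow> 'a set"
  assumes rep: "\<And>c. c \<in> fusion_classes S F \<Longrightarrow> rep c \<in> c \<and> fully_normalized S F (rep c)"
begin

lemma rep_props:
  assumes "c \<in> fusion_classes S F"
  shows "subgroup (rep c) S" "fusion_conj_class S F (rep c) = c" "fully_normalized S F (rep c)"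
  using assms rep[OF assms] fusion_conj_class_eq
  by (auto simp: fully_normalized_def fusion_classes_def)

lemma rep_class:
  assumes "subgroup P S"
  shows "rep (fusion_conj_class S F P) \<in> fusion_conj_class S F P"
  using rep[OF fusion_classesI[OF assms]] by blast

lemma psi_rep:
  assumes "fully_normalized S F P"
  shows "psi S F (rep (fusion_conj_class S F P)) f = psi S F P f"
  using assms rep_class rep_props(3)[OF fusion_classesI]
  by (intro psi_fully_normalized_eq(2)[symmetric]) (auto simp: fully_normalized_def)

text \<open>The value of \<open>psi\<close> at a class is \<open>f\<close> there, with coefficient
  1, plus terms from classes of larger subgroups. Classes of one order do not influence each other
  and can be corrected simultaneously, going down in order.\<close>

lemma psi_surj:
  assumes t: "\<And>c. c \<in> fusion_classes S F \<Longrightarrow> t c \<in> {0..<int (order (weyl_group S (rep c)))}"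
  obtains f where "f \<in> carrier (ghost_ring S F)"
    "\<And>c. c \<in> fusion_classes S F \<Longrightarrow> psi S F (rep c) f = t c"
proof -
  have "\<exists>f\<in>carrier (ghost_ring S F). \<forall>c\<in>fusion_classes S F.
      order S < card (rep c) + d \<longrightarrow> psi S F (rep c) f = t c" for d
  proof (induction d)
    case 0
    have "\<not> order S < card (rep c)" if "c \<in> fusion_classes S F" for c
      unfolding order_def
      using card_mono[OF finite_carrier subgroup.subset[OF rep_props(1)[OF that]]] by simp
    then show ?case
      by (intro bexI[of _ "\<lambda>c\<in>fusion_classes S F. 0"]) (auto simp: ghost_ring_def product_ring_def)
  next
    case (Suc d)
    then obtain f where f: "\<And>c. \<lbrakk>c \<in> fusion_classes S F; order S < card (rep c) + d\<rbrakk> \<Longrightarrow>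
        psi S F (rep c) f = t c"
      by blast
    \<comment> \<open>The correction is the exact defect: altering \<open>f c\<close> by an integer
      alters \<open>psi\<close> by the same integer modulo |W|.\<close>
    define f' where "f' = (\<lambda>c\<in>fusion_classes S F.
      if order S = card (rep c) + d then f c + (t c - psi S F (rep c) f) else f c)"
    have "psi S F (rep c) f' = t c" if c: "c \<in> fusion_classes S F" and d: "order S \<le> card (rep c) + d" for c
    proof -
      note P = rep_props(1)[OF c]
      let ?w = "\<lambda>f. weyl_sum S (rep c) (\<lambda>R. f (fusion_conj_class S F R))" and ?n = "int (card (rep c))"
      have "f' (fusion_conj_class S F R) = f (fusion_conj_class S F R)"
        if R: "subgroup R S" "card (rep c) < card R" for R
        using d R(2) fusion_conj_class_card[OF R(1) rep_class[OF R(1)]]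
        by (simp add: f'_def fusion_classesI[OF R(1)])
      then have "?w f' - ?w f = ?n * (f' c - f c)"
        using weyl_sum_diff[OF finite_carrier P, of "\<lambda>R. f' (fusion_conj_class S F R)"
            "\<lambda>R. f (fusion_conj_class S F R)"] rep_props(2)[OF c] by simp
      then have "?w f' = ?w f + ?n * (f' c - f c)"
        by simp
      then have "?w f' div ?n = ?w f div ?n + (f' c - f c)"
        using card_subgroup_pos[OF finite_carrier P] by simp
      then have *: "psi S F (rep c) f' =
          (psi S F (rep c) f + (f' c - f c)) mod int (order (weyl_group S (rep c)))"
        unfolding psi_eq(1)[OF P] by (simp add: mod_add_left_eq)
      show ?thesis
      proof (cases "order S = card (rep c) + d")
        case True
        \<comment> \<open>The target \<open>t c\<close> is already a reduced residue, so the final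
          reduction leaves it unchanged.\<close>
        then show ?thesis
          using * c t[OF c] by (simp add: f'_def)
      next
        case False
        then show ?thesis
          using * c d f[OF c] t[OF c] by (simp add: f'_def)
      qed
    qed
    moreover have "f' \<in> carrier (ghost_ring S F)"
      by (auto simp: f'_def ghost_ring_def product_ring_def)
    ultimately show ?case
      by (intro bexI[of _ f']) auto
  qed
  from this[of "Suc (order S)"] show thesis
    using that by auto
qed

text \<open>Vanishing of \<open>psi\<close> at the representative provides the congruence at each
  member of its class. Stability follows once all marks are realized, since they come from a
  function on fusion classes.\<close>

lemma exists_stable_with_marks:
  assumes f: "f \<in> carrier (ghost_ring S F)"
    and psi: "\<And>c. c \<in> fusion_classes S F \<Longrightarrow> psi S F (rep c) f = 0"
  obtains x where "x \<in> carrier (fusion_burnside_ring S F)"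
    "\<And>R. subgroup R S \<Longrightarrow> mark R x = f (fusion_conj_class S F R)"
proof -
  let ?h = "\<lambda>R. f (fusion_conj_class S F R)"
  have h: "?h R' = ?h R" if "subgroup R S" "R' \<in> fusion_conj_class S F R" for R R'
    using fusion_conj_class_eq[OF that] by simp
  obtain x where x: "x \<in> carrier (burnside_ring S)" "\<And>R. subgroup R S \<Longrightarrow> mark R x = ?h R"
  proof (rule exists_with_marks[OF finite_carrier, of ?h])
    fix P g assume "subgroup P S" "g \<in> carrier S"
    then show "?h ((\<lambda>x. g \<otimes> x \<otimes> inv g) ` P) = ?h P"
      using h conj_image_class by blast
  next
    fix Q x assume Q: "subgroup Q S" and x: "x \<in> carrier (burnside_ring S)"
      and eq: "\<And>R. \<lbrakk>subgroup R S; card Q < card R\<rbrakk> \<Longrightarrow> mark R x = ?h R"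
    let ?c = "fusion_conj_class S F Q"
    note c = fusion_classesI[OF Q]
    have "Q \<in> fusion_conj_class S F (rep ?c)"
      using fusion_conj_class_sym[OF Q rep_class[OF Q]] .
    then show "int (order (weyl_group S Q)) dvd ?h Q - mark Q x"
      using card_dvd_weyl_sum_diff[OF rep_props(3)[OF c] _ x, where h = ?h] h eq psi[OF c]
      unfolding psi_eq_0_iff[OF rep_props(1)[OF c]] by blast
  qed (use that in blast)
  have "x \<in> carrier (fusion_burnside_ring S F)"
    unfolding carrier_fusion_burnside_ring using x h fusion_conj_class_subgroup by simp
  then show thesis
    using x(2) by (rule that)
qed

section \<open>The maps of the exact sequence\<close>

definition mark_map where
  "mark_map x = (\<lambda>c\<in>fusion_classes S F. mark (rep c) x)"

lemma mark_map_class: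
  assumes "x \<in> carrier (fusion_burnside_ring S F)" "subgroup P S"
  shows "mark_map x (fusion_conj_class S F P) = mark P x"
  using assms rep_class[OF assms(2)]
  by (simp add: mark_map_def carrier_fusion_burnside_ring fusion_classesI)

definition psi_map where
  "psi_map f = (\<lambda>c\<in>fusion_classes S F. psi S F (rep c) f)"

lemma ring_hom_mark_map: "ring_hom_cring (fusion_burnside_ring S F) (ghost_ring S F) mark_map"
proof -
  have closed: "x \<in> carrier (burnside_ring S)" if "x \<in> carrier (fusion_burnside_ring S F)" for x
    using that by (simp add: fusion_burnside_ring_def)
  have ops: "monoid.mult (fusion_burnside_ring S F) = monoid.mult (burnside_ring S)"
    "ring.add (fusion_burnside_ring S F) = ring.add (burnside_ring S)"
    "monoid.one (fusion_burnside_ring S F) = monoid.one (burnside_ring S)"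
    by (simp_all add: fusion_burnside_ring_def)
  have "mark_map \<in> ring_hom (fusion_burnside_ring S F) (ghost_ring S F)"
    by (rule ring_hom_memI)
      (auto simp: mark_map_def ghost_ring_def product_ring_def ops fun_eq_iff rep_props(1)
        mark_simps[OF finite_carrier] closed)
  then show ?thesis
    using cring_fusion_burnside_ring cring_product_int_ring
    by (simp add: ring_hom_cring_def ring_hom_cring_axioms_def ghost_ring_def)
qed

lemma psi_map_hom: "psi_map \<in> hom (add_monoid (ghost_ring S F)) (obstruction_group S F rep)"
proof (rule homI)
  fix f g
  show "psi_map f \<in> carrier (obstruction_group S F rep)"
    by (auto simp: psi_map_def obstruction_group_def psi_range rep_props(1))
  show "psi_map (f \<otimes>\<^bsub>add_monoid (ghost_ring S F)\<^esub> g) =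
      psi_map f \<otimes>\<^bsub>obstruction_group S F rep\<^esub> psi_map g"
    by (auto simp: psi_map_def obstruction_group_def ghost_ring_def product_ring_def fun_eq_iff
        psi_add rep_props(1))
qed

lemma mark_map_kernel:
  "mark_map ` carrier (fusion_burnside_ring S F) =
    kernel (add_monoid (ghost_ring S F)) (obstruction_group S F rep) psi_map"
proof -
  have ker: "f \<in> kernel (add_monoid (ghost_ring S F)) (obstruction_group S F rep) psi_map \<longleftrightarrow>
      f \<in> carrier (ghost_ring S F) \<and> (\<forall>c\<in>fusion_classes S F. psi S F (rep c) f = 0)" for f
    by (auto simp: kernel_def psi_map_def obstruction_group_def fun_eq_iff)
  have closed: "mark_map x \<in> carrier (ghost_ring S F)" for x
    by (auto simp: mark_map_def ghost_ring_def product_ring_def)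
  show ?thesis
  proof (intro equalityI subsetI)
    fix f assume "f \<in> mark_map ` carrier (fusion_burnside_ring S F)"
    then obtain x where x: "x \<in> carrier (fusion_burnside_ring S F)" "f = mark_map x"
      by blast
    have "psi S F (rep c) f = 0" if c: "c \<in> fusion_classes S F" for c
    proof -
      note P = rep_props(1)[OF c]
      have gen: "subgroup (generate S (insert s (rep c))) S" if "s \<in> normalizer S (rep c)" for s
        using that subgroup.subset[OF normalizer_subgroup[OF P]] subgroup.subset[OF P]
        by (intro generate_is_subgroup) auto
      \<comment> \<open>Stability makes the coordinate of \<Phi> at a class equal to the mark at any
        member, in particular at the generated subgroups in the sum.\<close>
      have "weyl_sum S (rep c) (\<lambda>R. f (fusion_conj_class S F R)) = weyl_sum S (rep c) (\<lambda>R. mark R x)"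
        unfolding weyl_sum_def x(2) using mark_map_class[OF x(1) gen] by (intro sum.cong refl)
      then show ?thesis
        using card_dvd_weyl_sum_marks[OF finite_carrier P] x(1)
        by (simp add: psi_eq_0_iff[OF P] carrier_fusion_burnside_ring)
    qed
    then show "f \<in> kernel (add_monoid (ghost_ring S F)) (obstruction_group S F rep) psi_map"
      unfolding ker using closed x(2) by simp
  next
    fix f assume "f \<in> kernel (add_monoid (ghost_ring S F)) (obstruction_group S F rep) psi_map"
    then have f: "f \<in> carrier (ghost_ring S F)" "\<And>c. c \<in> fusion_classes S F \<Longrightarrow> psi S F (rep c) f = 0"
      unfolding ker by blast+
    obtain x where x: "x \<in> carrier (fusion_burnside_ring S F)"
      "\<And>R. subgroup R S \<Longrightarrow> mark R x = f (fusion_conj_class S F R)"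
      using exists_stable_with_marks[OF f] by blast
    have "mark_map x = f"
    proof (rule extensionalityI)
      show "mark_map x \<in> extensional (fusion_classes S F)" "f \<in> extensional (fusion_classes S F)"
        using f(1) by (auto simp: mark_map_def ghost_ring_def product_ring_def PiE_def)
      show "mark_map x c = f c" if "c \<in> fusion_classes S F" for c
        using x(2)[OF rep_props(1)[OF that]] rep_props(2)[OF that] that by (simp add: mark_map_def)
    qed
    then show "f \<in> mark_map ` carrier (fusion_burnside_ring S F)"
      using x(1) by blast
  qed
qed

lemma inj_on_mark_map: "inj_on mark_map (carrier (fusion_burnside_ring S F))"
proof (rule inj_onI)
  fix x y assume x: "x \<in> carrier (fusion_burnside_ring S F)"
    and y: "y \<in> carrier (fusion_burnside_ring S F)" and eq: "mark_map x = mark_map y"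
  show "x = y"
  proof (rule mark_inj[OF finite_carrier])
    show "x \<in> carrier (burnside_ring S)" "y \<in> carrier (burnside_ring S)"
      using x y by (simp_all add: carrier_fusion_burnside_ring)
    fix P assume "subgroup P S"
    then show "mark P x = mark P y"
      using mark_map_class[OF x] mark_map_class[OF y] eq by metis
  qed
qed

lemma psi_map_surj: "psi_map ` carrier (ghost_ring S F) = carrier (obstruction_group S F rep)"
proof (intro equalityI subsetI)
  fix t assume "t \<in> carrier (obstruction_group S F rep)"
  then have t: "t \<in> (\<Pi>\<^sub>E c\<in>fusion_classes S F. carrier (integer_mod_group (order (weyl_group S (rep c)))))"
    by (simp add: obstruction_group_def)
  have "t c \<in> {0..<int (order (weyl_group S (rep c)))}" if "c \<in> fusion_classes S F" for c
    using PiE_mem[OF t that] order_weyl_group_pos[OF finite_carrier rep_props(1)[OF that]]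
    by (simp add: carrier_integer_mod_group)
  then obtain f where f: "f \<in> carrier (ghost_ring S F)"
    "\<And>c. c \<in> fusion_classes S F \<Longrightarrow> psi S F (rep c) f = t c"
    using psi_surj by blast
  have "psi_map f = t"
    using f(2) PiE_arb[OF t] by (auto simp: psi_map_def fun_eq_iff)
  then show "t \<in> psi_map ` carrier (ghost_ring S F)"
    using f(1) by blast
qed (auto simp: psi_map_def obstruction_group_def psi_range rep_props(1))

lemma comm_group_obstruction_group: "comm_group (obstruction_group S F rep)"
  unfolding obstruction_group_def by (rule comm_group_product_group) simp

lemma short_exact_mark_psi:
  "short_exact (add_monoid (fusion_burnside_ring S F)) (add_monoid (ghost_ring S F))
    (obstruction_group S F rep) mark_map psi_map"
proof -
  interpret \<Phi>: ring_hom_cring "fusion_burnside_ring S F" "ghost_ring S F" mark_map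
    by (rule ring_hom_mark_map)
  have "mark_map \<in> hom (add_monoid (fusion_burnside_ring S F)) (add_monoid (ghost_ring S F))"
    by (rule homI) auto
  then show ?thesis
    using \<Phi>.R.a_comm_group \<Phi>.S.a_comm_group comm_group_obstruction_group inj_on_mark_map
      psi_map_hom psi_map_surj mark_map_kernel
    by (simp add: short_exact_def mon_def epi_def)
qed

lemma group_hom_psi_map:
  "group_hom (add_monoid (ghost_ring S F)) (obstruction_group S F rep) psi_map"
proof -
  interpret \<Phi>: ring_hom_cring "fusion_burnside_ring S F" "ghost_ring S F" mark_map
    by (rule ring_hom_mark_map)
  show ?thesis
    using \<Phi>.S.a_group comm_group.axioms(2)[OF comm_group_obstruction_group] psi_map_hom
    by (simp add: group_hom_def group_hom_axioms_def)
qed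

end

end

theorem theorem2:
  fixes p :: nat
    and S :: "('a, 'm) monoid_scheme"
    and F :: "'a set \<Rightarrow> 'a set \<Rightarrow> ('a \<Rightarrow> 'a) set"
    and rep :: "'a set set \<Rightarrow> 'a set"
  assumes "saturated_fusion_system p S F"
    and "\<And>c. c \<in> fusion_classes S F \<Longrightarrow> rep c \<in> c \<and> fully_normalized S F (rep c)"
  shows "subring (carrier (fusion_burnside_ring S F)) (burnside_ring S) \<and>
    (\<exists>\<Phi> \<Psi>.
       ring_hom_cring (fusion_burnside_ring S F) (ghost_ring S F) \<Phi> \<and>
       group_hom (add_monoid (ghost_ring S F)) (obstruction_group S F rep) \<Psi> \<and>
       short_exact (add_monoid (fusion_burnside_ring S F)) (add_monoid (ghost_ring S F))
         (obstruction_group S F rep) \<Phi> \<Psi> \<and>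
       (\<forall>x\<in>carrier (fusion_burnside_ring S F). \<forall>P. subgroup P S \<longrightarrow>
          \<Phi> x (fusion_conj_class S F P) = mark P x) \<and>
       (\<forall>f\<in>carrier (ghost_ring S F). \<forall>P. fully_normalized S F P \<longrightarrow>
          \<Psi> f (fusion_conj_class S F P) = psi S F P f)) \<and>
    (\<forall>P P'. fully_normalized S F P \<and> fully_normalized S F P' \<and> P' \<in> fusion_conj_class S F P \<longrightarrow>
       order (weyl_group S P) = order (weyl_group S P') \<and>
       (\<forall>f\<in>carrier (ghost_ring S F). psi S F P f = psi S F P' f))"
proof -
  interpret saturated_fusion_system p S F
    by (rule assms(1))
  note rep = assms(2)
  let ?\<Phi> = "mark_map rep" and ?\<Psi> = "psi_map rep"
  \<comment> \<open>Although \<Psi> is computed at the chosen representative, any other fully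
    normalized member of the class gives the same value.\<close>
  have "?\<Psi> f (fusion_conj_class S F P) = psi S F P f" if "fully_normalized S F P" for f P
    using psi_rep[OF rep that] that
    by (simp add: psi_map_def[OF rep] fusion_classesI fully_normalized_def)
  then show ?thesis
    using subring_fusion_burnside_ring ring_hom_mark_map[OF rep] group_hom_psi_map[OF rep]
      short_exact_mark_psi[OF rep] mark_map_class[OF rep] psi_fully_normalized_eq
    by (intro conjI exI[of _ ?\<Phi>] exI[of _ ?\<Psi>] allI impI ballI; (elim conjE)?) blast+
qed

end
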